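(* Let $\Gamma$ be a compact polyhedron in some Euclidean space, defined as the union of the simplices of a finite set $T$ of simplices. Let $\xi$ be a definable $k$-cycle in $\Gamma$ such that for any positive real number $\varepsilon$ small enough there exists a definable $k$-cycle $\xi_\varepsilon$ in $\Gamma$, homologous to $\xi$ in $\Gamma$, whose support has $k$-dimensional volume $\mathrm{vol}_k(\mathrm{supp}(\xi_\varepsilon))$ smaller than $\varepsilon$. Then $\xi$ bounds a definable $(k+1)$-chain of $\Gamma$.
   Context: An o-minimal structure expanding the field of real numbers is fixed, and "definable" means definable in it. Cycles and chains are definable singular cycles and chains, with coefficients in a fixed standard group such as $\mathbb{Z}/2$, $\mathbb{Z}$, $\mathbb{Q}$ or $\mathbb{R}$; $\mathrm{supp}$ denotes the support of a chain. $\mathrm{vol}_k$ is the $k$-dimensional volume taken with respect to the outer metric (the metric of the ambient Euclidean space). *)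

theory Defs
  imports "HOL-Analysis.Analysis" "HOL-Homology.Homology"
begin

section \<open>O-minimal structures expanding the real field\<close>

text \<open>
  As in the library's \<^const>\<open>Euclidean_space\<close> and \<^const>\<open>standard_simplex\<close>, a point of
  $R^n$ is a sequence of reals that vanishes from index \<open>n\<close> on.
\<close>

abbreviation Rn :: "nat \<Rightarrow> (nat \<Rightarrow> real) set"
  where "Rn n \<equiv> topspace (Euclidean_space n)"

text \<open>The identification of $R^m \times R^n$ with $R^{m+n}$.\<close>

definition join :: "nat \<Rightarrow> (nat \<Rightarrow> real) \<Rightarrow> (nat \<Rightarrow> real) \<Rightarrow> nat \<Rightarrow> real"
  where "join m x y = (\<lambda>i. if i < m then x i else y (i - m))"

text \<open>
  \<open>D n\<close> is the collection of definable subsets of $R^n$. In the axiom \<open>tame\<close> an interval is an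
  order-convex set (\<^const>\<open>is_interval\<close>), so points, rays and the whole line count as intervals;
  since that axiom is an equality, definability is with arbitrary real parameters.
\<close>

locale o_minimal_field_expansion =
  fixes D :: "nat \<Rightarrow> (nat \<Rightarrow> real) set set"
  assumes boolean: "Sigma_Algebra.algebra (Rn n) (D n)"
    and product: "A \<in> D m \<Longrightarrow> B \<in> D n \<Longrightarrow> (\<lambda>(x, y). join m x y) ` (A \<times> B) \<in> D (m + n)"
    and diagonal: "i < n \<Longrightarrow> j < n \<Longrightarrow> {x \<in> Rn n. x i = x j} \<in> D n"
    and projection: "A \<in> D (Suc n) \<Longrightarrow> (\<lambda>x. x(n := 0)) ` A \<in> D n"
    and order: "{x \<in> Rn 2. x 0 < x 1} \<in> D 2"
    and addition: "{x \<in> Rn 3. x 0 + x 1 = x 2} \<in> D 3"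
    and multiplication: "{x \<in> Rn 3. x 0 * x 1 = x 2} \<in> D 3"
    and tame: "D 1 = {{x \<in> Rn 1. x 0 \<in> \<Union>F} |F. finite F \<and> (\<forall>I\<in>F. is_interval I)}"

section \<open>Definable singular chains\<close>

text \<open>
  An enumeration of the standard basis identifies the ambient space with $R^N$. Which one is
  chosen does not matter, because definability is invariant under permutations of coordinates.
\<close>

definition basis_enum :: "nat \<Rightarrow> 'a::euclidean_space"
  where "basis_enum = (SOME e. bij_betw e {..<DIM('a)} Basis)"

definition coords :: "'a::euclidean_space \<Rightarrow> nat \<Rightarrow> real"
  where "coords v = (\<lambda>i. if i < DIM('a) then v \<bullet> basis_enum i else 0)"

definition definable_map ::
    "(nat \<Rightarrow> (nat \<Rightarrow> real) set set) \<Rightarrow> nat \<Rightarrow> (nat \<Rightarrow> real) set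
      \<Rightarrow> ((nat \<Rightarrow> real) \<Rightarrow> 'a::euclidean_space) \<Rightarrow> bool"
  where "definable_map D n A f \<longleftrightarrow>
    A \<subseteq> Rn n \<and> (\<lambda>x. join n x (coords (f x))) ` A \<in> D (n + DIM('a))"

definition definable_singular_simplex ::
    "(nat \<Rightarrow> (nat \<Rightarrow> real) set set) \<Rightarrow> nat \<Rightarrow> 'a::euclidean_space set
      \<Rightarrow> ((nat \<Rightarrow> real) \<Rightarrow> 'a) \<Rightarrow> bool"
  where "definable_singular_simplex D p X \<sigma> \<longleftrightarrow>
    singular_simplex p (top_of_set X) \<sigma> \<and> definable_map D (Suc p) (standard_simplex p) \<sigma>"

text \<open>
  The library's singular chains have integer coefficients. Here the coefficients lie in an
  arbitrary abelian group \<open>'g\<close>, and the boundary is the same as that of \<^const>\<open>chain_boundary\<close>.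
\<close>

type_synonym ('a, 'g) gchain = "((nat \<Rightarrow> real) \<Rightarrow> 'a) \<Rightarrow>\<^sub>0 'g"

definition boundary :: "nat \<Rightarrow> ('a, 'g::ab_group_add) gchain \<Rightarrow> ('a, 'g) gchain"
  where "boundary p c =
    (if p = 0 then 0
     else \<Sum>\<sigma>\<in>Poly_Mapping.keys c. \<Sum>j\<le>p.
       Poly_Mapping.single (singular_face p j \<sigma>)
         (if even j then Poly_Mapping.lookup c \<sigma> else - Poly_Mapping.lookup c \<sigma>))"

lemma boundary_eq_chain_boundary: "boundary p c = chain_boundary p c"
proof -
  have "frag_cmul a (frag_cmul ((-1) ^ j) (frag_of s)) = Poly_Mapping.single s (if even j then a else - a)"
    for a :: int and j :: nat and s :: "(nat \<Rightarrow> real) \<Rightarrow> 'a"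
    by (rule poly_mapping_eqI) (auto simp: lookup_single when_def)
  then show ?thesis
    by (simp add: boundary_def chain_boundary_def frag_extend_def frag_cmul_sum)
qed

definition definable_chain ::
    "(nat \<Rightarrow> (nat \<Rightarrow> real) set set) \<Rightarrow> nat \<Rightarrow> 'a::euclidean_space set
      \<Rightarrow> ('a, 'g::ab_group_add) gchain \<Rightarrow> bool"
  where "definable_chain D p X c \<longleftrightarrow>
    (\<forall>\<sigma> \<in> Poly_Mapping.keys c. definable_singular_simplex D p X \<sigma>)"

definition definable_cycle ::
    "(nat \<Rightarrow> (nat \<Rightarrow> real) set set) \<Rightarrow> nat \<Rightarrow> 'a::euclidean_space set
      \<Rightarrow> ('a, 'g::ab_group_add) gchain \<Rightarrow> bool"
  where "definable_cycle D p X c \<longleftrightarrow> definable_chain D p X c \<and> boundary p c = 0"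

definition bounds ::
    "(nat \<Rightarrow> (nat \<Rightarrow> real) set set) \<Rightarrow> nat \<Rightarrow> 'a::euclidean_space set
      \<Rightarrow> ('a, 'g::ab_group_add) gchain \<Rightarrow> bool"
  where "bounds D p X c \<longleftrightarrow> (\<exists>d. definable_chain D (Suc p) X d \<and> boundary (Suc p) d = c)"

definition homologous ::
    "(nat \<Rightarrow> (nat \<Rightarrow> real) set set) \<Rightarrow> nat \<Rightarrow> 'a::euclidean_space set
      \<Rightarrow> ('a, 'g::ab_group_add) gchain \<Rightarrow> ('a, 'g) gchain \<Rightarrow> bool"
  where "homologous D p X c c' \<longleftrightarrow> bounds D p X (c - c')"

definition supp :: "nat \<Rightarrow> ('a, 'g::ab_group_add) gchain \<Rightarrow> 'a set"
  where "supp p c = (\<Union>\<sigma> \<in> Poly_Mapping.keys c. \<sigma> ` standard_simplex p)"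

section \<open>Volume\<close>

text \<open>
  The \<open>k\<close>-dimensional volume is the \<open>k\<close>-dimensional Hausdorff measure of the ambient metric, in
  the normalisation that agrees with Lebesgue measure on $R^k$. The empty set has to be
  excluded in \<open>diam_vol\<close> because \<open>0 ^ 0 = 1\<close>.
\<close>

definition diam_vol :: "nat \<Rightarrow> 'a::metric_space set \<Rightarrow> real"
  where "diam_vol k U =
    (if U = {} then 0 else unit_ball_vol (real k) * (diameter U / 2) ^ k)"

definition vol :: "nat \<Rightarrow> 'a::metric_space set \<Rightarrow> ennreal"
  where "vol k A =
    (SUP \<delta> \<in> {0::real<..}.
      INF U \<in> {U :: nat \<Rightarrow> 'a set. A \<subseteq> (\<Union>i. U i) \<and> (\<forall>i. bounded (U i) \<and> diameter (U i) \<le> \<delta>)}.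
        suminf (\<lambda>i. ennreal (diam_vol k (U i))))"

section \<open>Polyhedra\<close>

text \<open>
  The library's \<^const>\<open>polyhedron\<close> is a finite intersection of half-spaces, which is a different
  notion. Simplices are closed and nonempty.
\<close>

definition polyhedron_of :: "'a::euclidean_space set set \<Rightarrow> 'a set \<Rightarrow> bool"
  where "polyhedron_of T \<Gamma> \<longleftrightarrow>
    finite T \<and> (\<forall>S\<in>T. \<exists>m::nat. int m simplex S) \<and> \<Gamma> = \<Union>T"

end

theory Submission
  imports Defs
begin

text \<open>
  The idea is that of the deformation theorem of Federer and Fleming. Let \<open>\<zeta>\<close> be a cycle that is
  homologous to \<open>\<xi>\<close> and has a support of very small \<open>k\<close>-volume, and consider a cubical grid of mesh
  \<open>s\<close> in the ambient space. The points with at least \<open>k\<close> coordinates on the grid form its skeleton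
  of codimension \<open>k\<close>. For each choice of \<open>k\<close> coordinates, the projection of the support to these
  coordinates has small measure; hence some translate of the skeleton misses the support
  (\<open>small_volume_misses_grid_skeleton\<close>).

  The complement of the skeleton has the homotopy type of the dual skeleton, whose dimension is
  \<open>k - 1\<close>. So \<open>\<zeta>\<close> bounds a chain there, and as everything can be done inside cubes, the chain stays
  within a fixed multiple of \<open>s\<close> from the support. This is proved by Mayer--Vietoris and
  induction on the number of coordinates (\<open>fillable_few_on_grid\<close>); the induction starts with
  convex sets, in which cycles are filled by cones.

  The chain leaves \<open>\<Gamma>\<close> but remains close to it, if \<open>s\<close> was chosen small. Near each of its points a
  polyhedron is starlike. Therefore small simplices close to \<open>\<Gamma>\<close> can be replaced by chains in
  \<open>\<Gamma>\<close>, dimension by dimension and without changing the simplices that lie in \<open>\<Gamma>\<close> already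
  (\<open>small_chain_retraction_exists\<close>). Applied to a subdivision of the chain, this shows that a
  subdivision of \<open>\<zeta>\<close>, hence \<open>\<zeta>\<close> and \<open>\<xi>\<close>, bounds in \<open>\<Gamma>\<close> (\<open>boundary_near_imp_boundary_in\<close>).

  Apart from points, all simplices arise from the given ones by two operations, composition with affine
  maps and formation of cones. The graphs of the results are given by first-order formulas in the
  graph of the original simplex (\<open>definable_map_by_formula\<close>), so definability is preserved
  throughout.
\<close>

section \<open>Additive extension of integral chain maps to arbitrary coefficients\<close>

definition int_multiple :: "int \<Rightarrow> 'g::ab_group_add \<Rightarrow> 'g"
  where "int_multiple n g = (\<Sum>i<nat n. g) - (\<Sum>i<nat (- n). g)"

lemma int_multiple_simps [simp]:
  "int_multiple 0 g = 0" "int_multiple 1 g = g" "int_multiple n 0 = 0" "int_multiple (- n) g = - int_multiple n g"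
  by (simp_all add: int_multiple_def)

lemma int_multiple_add_right: "int_multiple n (g + h) = int_multiple n g + int_multiple n h"
  by (simp add: int_multiple_def sum.distrib)

lemma int_multiple_succ: "int_multiple (n + 1) g = int_multiple n g + g"
proof (cases "0 \<le> n")
  case True
  then have "nat (n + 1) = Suc (nat n)" by simp
  then show ?thesis using True by (simp add: int_multiple_def)
next
  case False
  then have "nat (- n) = Suc (nat (- (n + 1)))" by simp
  then show ?thesis using False by (simp add: int_multiple_def)
qed

lemma int_multiple_add_left: "int_multiple (m + n) g = int_multiple m g + int_multiple n g"
proof (induction n rule: int_induct[where k = 0])
  case (step1 i)
  then show ?case using int_multiple_succ[of "m + i" g] int_multiple_succ[of i g]
    by (simp add: add.assoc)
next
  case (step2 i)
  then show ?case using int_multiple_succ[of "m + i - 1" g] int_multiple_succ[of "i - 1" g]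
    by (simp add: algebra_simps)
qed simp

lemma int_multiple_int: "int_multiple n (g::int) = n * g"
  by (simp add: int_multiple_def)

text \<open>
  The element \<open>a \<otimes> g\<close> of the chains with coefficients in \<open>'g\<close>.
\<close>

definition tensor :: "('x \<Rightarrow>\<^sub>0 int) \<Rightarrow> 'g::ab_group_add \<Rightarrow> ('x \<Rightarrow>\<^sub>0 'g)"
  where "tensor a g = Poly_Mapping.map (\<lambda>n. int_multiple n g) a"

lemma lookup_tensor: "Poly_Mapping.lookup (tensor a g) x = int_multiple (Poly_Mapping.lookup a x) g"
  by (simp add: tensor_def Poly_Mapping.map.rep_eq when_def)

lemma tensor_simps [simp]:
  "tensor 0 g = 0" "tensor a 0 = 0" "tensor (- a) g = - tensor a g"
  "tensor (frag_of x) g = Poly_Mapping.single x g"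
  by (rule poly_mapping_eqI; simp add: lookup_tensor lookup_single when_def)+

lemma tensor_add_left: "tensor (a + b) g = tensor a g + tensor b g"
  by (rule poly_mapping_eqI) (simp add: lookup_tensor lookup_add int_multiple_add_left)

lemma tensor_add_right: "tensor a (g + h) = tensor a g + tensor a h"
  by (rule poly_mapping_eqI) (simp add: lookup_tensor lookup_add int_multiple_add_right)

lemma tensor_diff_left: "tensor (a - b) g = tensor a g - tensor b g"
  using tensor_add_left[of a "- b" g] by simp

lemma tensor_sum_left: "tensor (\<Sum>i\<in>I. a i) g = (\<Sum>i\<in>I. tensor (a i) g)"
  by (induction I rule: infinite_finite_induct) (simp_all add: tensor_add_left)

lemma keys_tensor: "Poly_Mapping.keys (tensor a g) \<subseteq> Poly_Mapping.keys a"
  by (auto simp: in_keys_iff lookup_tensor)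

text \<open>
  The homomorphism on chains with coefficients in \<open>'g\<close> that is induced by the homomorphism of free
  abelian groups with values \<open>\<phi>\<close> on the generators. Chain-level identities can thus be verified on
  generators, where all coefficients are integers.
\<close>

definition lin_extend :: "('x \<Rightarrow> ('y \<Rightarrow>\<^sub>0 int)) \<Rightarrow> ('x \<Rightarrow>\<^sub>0 'g::ab_group_add) \<Rightarrow> ('y \<Rightarrow>\<^sub>0 'g)"
  where "lin_extend \<phi> c = (\<Sum>x\<in>Poly_Mapping.keys c. tensor (\<phi> x) (Poly_Mapping.lookup c x))"

lemma lin_extend_superset:
  assumes "finite A" "Poly_Mapping.keys c \<subseteq> A"
  shows "lin_extend \<phi> c = (\<Sum>x\<in>A. tensor (\<phi> x) (Poly_Mapping.lookup c x))"
  unfolding lin_extend_def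
  by (rule sum.mono_neutral_left) (use assms in \<open>auto simp: in_keys_iff\<close>)

lemma lin_extend_0 [simp]: "lin_extend \<phi> 0 = 0"
  by (simp add: lin_extend_def)

lemma lin_extend_add: "lin_extend \<phi> (c + d) = lin_extend \<phi> c + lin_extend \<phi> d"
proof -
  let ?A = "Poly_Mapping.keys c \<union> Poly_Mapping.keys d"
  have "Poly_Mapping.keys (c + d) \<subseteq> ?A" by (rule keys_add)
  then have "lin_extend \<phi> (c + d) = (\<Sum>x\<in>?A. tensor (\<phi> x) (Poly_Mapping.lookup (c + d) x))"
    by (intro lin_extend_superset) auto
  also have "\<dots> = lin_extend \<phi> c + lin_extend \<phi> d"
    by (simp add: lookup_add tensor_add_right sum.distrib lin_extend_superset[of ?A])
  finally show ?thesis .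
qed

lemma lin_extend_minus: "lin_extend \<phi> (- c) = - lin_extend \<phi> c"
proof -
  have "lin_extend \<phi> c + lin_extend \<phi> (- c) = 0"
    using lin_extend_add[of \<phi> c "- c"] by simp
  then show ?thesis
    by (metis minus_unique)
qed

lemma lin_extend_diff: "lin_extend \<phi> (c - d) = lin_extend \<phi> c - lin_extend \<phi> d"
  using lin_extend_add[of \<phi> c "- d"] by (simp add: lin_extend_minus)

lemma lin_extend_sum: "lin_extend \<phi> (\<Sum>i\<in>I. c i) = (\<Sum>i\<in>I. lin_extend \<phi> (c i))"
  by (induction I rule: infinite_finite_induct) (simp_all add: lin_extend_add)

lemma lin_extend_single [simp]: "lin_extend \<phi> (Poly_Mapping.single x g) = tensor (\<phi> x) g"
  by (cases "g = 0") (simp_all add: lin_extend_def)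

lemma lin_extend_cong:
  "(\<And>x. x \<in> Poly_Mapping.keys c \<Longrightarrow> \<phi> x = \<psi> x) \<Longrightarrow> lin_extend \<phi> c = lin_extend \<psi> c"
  by (simp add: lin_extend_def)

lemma lin_extend_add_fun: "lin_extend (\<lambda>x. \<phi> x + \<psi> x) c = lin_extend \<phi> c + lin_extend \<psi> c"
  by (simp add: lin_extend_def tensor_add_left sum.distrib)

lemma lin_extend_diff_fun: "lin_extend (\<lambda>x. \<phi> x - \<psi> x) c = lin_extend \<phi> c - lin_extend \<psi> c"
  by (simp add: lin_extend_def tensor_diff_left sum_subtractf)

lemma lin_extend_zero_fun [simp]: "lin_extend (\<lambda>x. 0) c = 0"
  by (simp add: lin_extend_def)

lemma lin_extend_frag_of [simp]: "lin_extend frag_of c = c"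
proof (rule poly_mapping_eqI)
  fix x
  have "Poly_Mapping.lookup (lin_extend frag_of c) x
      = (\<Sum>y\<in>Poly_Mapping.keys c. Poly_Mapping.lookup c y when y = x)"
    by (simp add: lin_extend_def lookup_sum lookup_single)
  also have "\<dots> = Poly_Mapping.lookup c x"
    by (simp add: when_def in_keys_iff)
  finally show "Poly_Mapping.lookup (lin_extend frag_of c) x = Poly_Mapping.lookup c x" .
qed

lemma lin_extend_tensor: "lin_extend \<phi> (tensor a g) = tensor (frag_extend \<phi> a) g"
proof -
  have "Poly_Mapping.keys a \<subseteq> UNIV" by simp
  then show ?thesis
    by (induction a rule: frag_induction) (simp_all add: tensor_diff_left lin_extend_diff frag_extend_diff)
qed

lemma lin_extend_extend: "lin_extend \<phi> (lin_extend \<psi> c) = lin_extend (\<lambda>x. frag_extend \<phi> (\<psi> x)) c"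
  unfolding lin_extend_def[of \<psi>] lin_extend_def[of "\<lambda>x. frag_extend \<phi> (\<psi> x)"]
  by (simp add: lin_extend_sum lin_extend_tensor)

lemma keys_lin_extend: "Poly_Mapping.keys (lin_extend \<phi> c) \<subseteq> (\<Union>x\<in>Poly_Mapping.keys c. Poly_Mapping.keys (\<phi> x))"
proof -
  have "Poly_Mapping.keys (lin_extend \<phi> c)
      \<subseteq> (\<Union>x\<in>Poly_Mapping.keys c. Poly_Mapping.keys (tensor (\<phi> x) (Poly_Mapping.lookup c x)))"
    unfolding lin_extend_def by (rule keys_sum)
  also have "\<dots> \<subseteq> (\<Union>x\<in>Poly_Mapping.keys c. Poly_Mapping.keys (\<phi> x))"
    by (intro UN_mono order_refl keys_tensor)
  finally show ?thesis .
qed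

lemma lin_extend_int:
  fixes \<phi> :: "'x \<Rightarrow> ('y \<Rightarrow>\<^sub>0 int)"
  shows "lin_extend \<phi> c = frag_extend \<phi> c"
proof -
  have "tensor a n = frag_cmul n a" for a :: "'y \<Rightarrow>\<^sub>0 int" and n
    by (rule poly_mapping_eqI) (simp add: lookup_tensor int_multiple_int)
  then show ?thesis
    by (simp add: lin_extend_def frag_extend_def)
qed

text \<open>
  The boundary is induced from integral chains as well; so an identity between natural operations
  on integral chains, such as subdivision and its homotopy, carries over to coefficients in \<open>'g\<close>.
\<close>

lemma boundary_eq_lin_extend: "boundary p c = lin_extend (\<lambda>\<sigma>. chain_boundary p (frag_of \<sigma>)) c"
proof (cases "p = 0")
  case False
  have *: "Poly_Mapping.single s (if even j then g else - g) = tensor (frag_cmul ((-1) ^ j) (frag_of s)) g"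
    for s :: "(nat \<Rightarrow> real) \<Rightarrow> 'a" and j :: nat and g :: 'b
    by (rule poly_mapping_eqI, cases "even j") (simp_all add: lookup_tensor lookup_single when_def)
  show ?thesis
    using False by (simp add: boundary_def lin_extend_def chain_boundary_of tensor_sum_left *)
qed (simp add: boundary_def chain_boundary_of)

lemma boundary_add: "boundary p (c + d) = boundary p c + boundary p d"
  and boundary_diff: "boundary p (c - d) = boundary p c - boundary p d"
  and boundary_sum: "boundary p (\<Sum>i\<in>I. f i) = (\<Sum>i\<in>I. boundary p (f i))"
  and boundary_zero [simp]: "boundary p 0 = 0"
  by (simp_all add: boundary_eq_lin_extend lin_extend_add lin_extend_diff lin_extend_sum)

lemma boundary_lin_extend: "boundary p (lin_extend \<phi> c) = lin_extend (\<lambda>\<sigma>. chain_boundary p (\<phi> \<sigma>)) c"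
proof -
  have "frag_extend (\<lambda>\<sigma>. chain_boundary p (frag_of \<sigma>)) a = chain_boundary p a" for a :: "'a chain"
    using boundary_eq_lin_extend[of p a] by (simp add: lin_extend_int boundary_eq_chain_boundary)
  then show ?thesis
    by (simp add: boundary_eq_lin_extend lin_extend_extend)
qed

section \<open>First-order definability\<close>

lemma Rn_iff: "x \<in> Rn n \<longleftrightarrow> (\<forall>i\<ge>n. x i = 0)"
  by (simp add: topspace_Euclidean_space)

lemma join_in_Rn: "x \<in> Rn n \<Longrightarrow> y \<in> Rn m \<Longrightarrow> join n x y \<in> Rn (n + m)"
  by (auto simp: Rn_iff join_def)

definition trunc :: "nat \<Rightarrow> (nat \<Rightarrow> real) \<Rightarrow> nat \<Rightarrow> real"
  where "trunc n x = (\<lambda>i. if i < n then x i else 0)"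

lemma trunc_in_Rn [simp]: "trunc n x \<in> Rn n"
  by (simp add: trunc_def Rn_iff)

lemma trunc_join [simp]: "x \<in> Rn n \<Longrightarrow> trunc n (join n x y) = x"
  by (auto simp: trunc_def join_def Rn_iff fun_eq_iff)

context o_minimal_field_expansion
begin

definition defpred :: "nat \<Rightarrow> ((nat \<Rightarrow> real) \<Rightarrow> bool) \<Rightarrow> bool"
  where "defpred n P \<longleftrightarrow> {x \<in> Rn n. P x} \<in> D n"

definition deffun :: "nat \<Rightarrow> ((nat \<Rightarrow> real) \<Rightarrow> real) \<Rightarrow> bool"
  where "deffun n f \<longleftrightarrow> defpred (Suc n) (\<lambda>x. x n = f (x(n := 0)))"

lemma definable_subset: "A \<in> D n \<Longrightarrow> A \<subseteq> Rn n"
  using boolean[of n] unfolding algebra_iff_Un by blast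

lemma defpred_mem: "A \<in> D n \<Longrightarrow> defpred n (\<lambda>x. x \<in> A)"
proof -
  assume A: "A \<in> D n"
  then have "{x \<in> Rn n. x \<in> A} = A"
    using definable_subset[of A n] by auto
  then show ?thesis using A by (simp add: defpred_def)
qed

lemma defpred_cong: "defpred n P \<Longrightarrow> (\<And>x. x \<in> Rn n \<Longrightarrow> P x \<longleftrightarrow> Q x) \<Longrightarrow> defpred n Q"
  unfolding defpred_def by (metis (mono_tags, lifting) Collect_cong)

lemma defpred_True: "defpred n (\<lambda>x. True)"
  using algebra.top[OF boolean[of n]] by (simp add: defpred_def)

lemma defpred_conj:
  assumes "defpred n P" "defpred n Q" shows "defpred n (\<lambda>x. P x \<and> Q x)"
proof -
  have "{x \<in> Rn n. P x} \<inter> {x \<in> Rn n. Q x} \<in> D n"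
    using assms boolean[of n] unfolding defpred_def algebra_iff_Int by blast
  also have "{x \<in> Rn n. P x} \<inter> {x \<in> Rn n. Q x} = {x \<in> Rn n. P x \<and> Q x}" by auto
  finally show ?thesis by (simp add: defpred_def)
qed

lemma defpred_ball:
  assumes "finite I" "\<And>i. i \<in> I \<Longrightarrow> defpred n (P i)" shows "defpred n (\<lambda>x. \<forall>i\<in>I. P i x)"
  using assms by (induction I) (auto intro: defpred_True defpred_conj)

lemma defpred_ex:
  assumes "defpred (Suc n) P" shows "defpred n (\<lambda>x. \<exists>t. P (x(n := t)))"
proof -
  have "(\<lambda>x. x(n := 0)) ` {x \<in> Rn (Suc n). P x} \<in> D n"
    using assms by (intro projection) (simp add: defpred_def)
  also have "(\<lambda>x. x(n := 0)) ` {x \<in> Rn (Suc n). P x} = {x \<in> Rn n. \<exists>t. P (x(n := t))}"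
  proof (intro equalityI subsetI)
    fix y assume "y \<in> (\<lambda>x. x(n := 0)) ` {x \<in> Rn (Suc n). P x}"
    then obtain x where x: "x \<in> Rn (Suc n)" "P x" "y = x(n := 0)" by auto
    then have "y(n := x n) = x" by simp
    then have "\<exists>t. P (y(n := t))" using x by metis
    moreover have "y \<in> Rn n" using x by (auto simp: Rn_iff)
    ultimately show "y \<in> {x \<in> Rn n. \<exists>t. P (x(n := t))}" by simp
  next
    fix y assume "y \<in> {x \<in> Rn n. \<exists>t. P (x(n := t))}"
    then obtain t where y: "y \<in> Rn n" "P (y(n := t))" by auto
    then have "y = (y(n := t))(n := 0)" "y(n := t) \<in> Rn (Suc n)"
      by (auto simp: Rn_iff fun_eq_iff)
    then show "y \<in> (\<lambda>x. x(n := 0)) ` {x \<in> Rn (Suc n). P x}"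
      using y by blast
  qed
  finally show ?thesis by (simp add: defpred_def)
qed

lemma defpred_ex_many:
  "defpred (n + m) P \<Longrightarrow> defpred n (\<lambda>x. \<exists>y\<in>Rn m. P (join n x y))"
proof (induction m arbitrary: P)
  case 0
  have "(\<exists>y\<in>Rn 0. P (join n x y)) \<longleftrightarrow> P x" if "x \<in> Rn n" for x
  proof -
    have "join n x y = x" if "y \<in> Rn 0" for y
      using that \<open>x \<in> Rn n\<close> by (auto simp: join_def Rn_iff fun_eq_iff)
    moreover have "(\<lambda>i. 0) \<in> Rn 0" by (simp add: Rn_iff)
    ultimately show ?thesis by metis
  qed
  then show ?case using 0 by (auto elim!: defpred_cong)
next
  case (Suc m)
  have "defpred (n + m) (\<lambda>z. \<exists>t. P (z(n + m := t)))"
    using Suc.prems by (intro defpred_ex) simp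
  then have "defpred n (\<lambda>x. \<exists>y\<in>Rn m. \<exists>t. P ((join n x y)(n + m := t)))"
    by (rule Suc.IH)
  moreover have "(\<exists>y\<in>Rn m. \<exists>t. P ((join n x y)(n + m := t))) \<longleftrightarrow> (\<exists>y\<in>Rn (Suc m). P (join n x y))" for x
  proof -
    have *: "(join n x y)(n + m := t) = join n x (y(m := t))" for y t
      by (auto simp: join_def fun_eq_iff)
    show ?thesis
    proof
      assume "\<exists>y\<in>Rn m. \<exists>t. P ((join n x y)(n + m := t))"
      then obtain y t where "y \<in> Rn m" "P (join n x (y(m := t)))" by (auto simp: *)
      moreover from this have "y(m := t) \<in> Rn (Suc m)" by (simp add: Rn_iff)
      ultimately show "\<exists>y\<in>Rn (Suc m). P (join n x y)" by blast
    next
      assume "\<exists>y\<in>Rn (Suc m). P (join n x y)"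
      then obtain y where y: "y \<in> Rn (Suc m)" "P (join n x y)" by auto
      then have "y(m := 0) \<in> Rn m" "(y(m := 0))(m := y m) = y" by (auto simp: Rn_iff)
      then show "\<exists>y\<in>Rn m. \<exists>t. P ((join n x y)(n + m := t))"
        using y by (metis *)
    qed
  qed
  ultimately show ?case by simp
qed

lemma defpred_shift:
  assumes "defpred m P" shows "defpred (n + m) (\<lambda>z. P (\<lambda>i. z (n + i)))"
proof -
  have "(\<lambda>(x, y). join n x y) ` (Rn n \<times> {x \<in> Rn m. P x}) \<in> D (n + m)"
    using assms defpred_True[of n] by (intro product) (auto simp: defpred_def)
  also have "(\<lambda>(x, y). join n x y) ` (Rn n \<times> {x \<in> Rn m. P x}) = {z \<in> Rn (n + m). P (\<lambda>i. z (n + i))}"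
  proof (intro equalityI subsetI)
    fix z assume "z \<in> (\<lambda>(x, y). join n x y) ` (Rn n \<times> {x \<in> Rn m. P x})"
    then obtain x y where xy: "x \<in> Rn n" "y \<in> Rn m" "P y" and z: "z = join n x y" by auto
    have "(\<lambda>i. z (n + i)) = y" by (simp add: z join_def)
    then show "z \<in> {z \<in> Rn (n + m). P (\<lambda>i. z (n + i))}"
      using xy join_in_Rn z by auto
  next
    fix z assume z: "z \<in> {z \<in> Rn (n + m). P (\<lambda>i. z (n + i))}"
    then have "z = join n (trunc n z) (\<lambda>i. z (n + i))" "(\<lambda>i. z (n + i)) \<in> Rn m"
      by (auto simp: join_def trunc_def Rn_iff fun_eq_iff)
    then show "z \<in> (\<lambda>(x, y). join n x y) ` (Rn n \<times> {x \<in> Rn m. P x})"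
      using z by (intro rev_image_eqI[of "(trunc n z, \<lambda>i. z (n + i))"]) auto
  qed
  finally show ?thesis by (simp add: defpred_def)
qed

text \<open>
  The substituted point is the unique \<open>y\<close> whose coordinates agree with the coordinates of \<open>x\<close>
  selected by \<open>\<pi>\<close>; so the substitution is expressed with diagonals and existential quantifiers.
\<close>

lemma defpred_subst:
  assumes P: "defpred m P" and \<pi>: "\<And>i. i < m \<Longrightarrow> \<pi> i < n"
  shows "defpred n (\<lambda>x. P (\<lambda>i. if i < m then x (\<pi> i) else 0))"
proof -
  have "defpred (n + m) (\<lambda>z. P (\<lambda>i. z (n + i)) \<and> (\<forall>i\<in>{..<m}. z (n + i) = z (\<pi> i)))"
  proof (intro defpred_conj defpred_shift P defpred_ball)
    fix i assume "i \<in> {..<m}"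
    then show "defpred (n + m) (\<lambda>z. z (n + i) = z (\<pi> i))"
      using diagonal[of "n + i" "n + m" "\<pi> i"] \<pi>[of i] by (simp add: defpred_def)
  qed simp
  then have "defpred n (\<lambda>x. \<exists>y\<in>Rn m. P (\<lambda>i. join n x y (n + i)) \<and>
      (\<forall>i\<in>{..<m}. join n x y (n + i) = join n x y (\<pi> i)))"
    by (rule defpred_ex_many)
  moreover have "(\<exists>y\<in>Rn m. P (\<lambda>i. join n x y (n + i)) \<and> (\<forall>i\<in>{..<m}. join n x y (n + i) = join n x y (\<pi> i)))
      \<longleftrightarrow> P (\<lambda>i. if i < m then x (\<pi> i) else 0)" for x
  proof -
    have "(\<forall>i\<in>{..<m}. join n x y (n + i) = join n x y (\<pi> i)) \<longleftrightarrow> y = (\<lambda>i. if i < m then x (\<pi> i) else 0)"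
      if "y \<in> Rn m" for y
      using that \<pi> by (auto simp: join_def Rn_iff fun_eq_iff)
    moreover have "(\<lambda>i. join n x y (n + i)) = y" for y
      by (simp add: join_def)
    moreover have "(\<lambda>i. if i < m then x (\<pi> i) else 0) \<in> Rn m"
      by (simp add: Rn_iff)
    ultimately show ?thesis by auto
  qed
  ultimately show ?thesis by simp
qed

lemma deffun_subst:
  assumes f: "deffun m f" and \<pi>: "\<And>i. i < m \<Longrightarrow> \<pi> i < n"
  shows "deffun n (\<lambda>x. f (\<lambda>i. if i < m then x (\<pi> i) else 0))"
proof -
  let ?\<pi> = "\<lambda>i. if i < m then \<pi> i else n"
  have subst: "defpred (Suc n) (\<lambda>x. (\<lambda>y. y m = f (y(m := 0))) (\<lambda>i. if i < Suc m then x (?\<pi> i) else 0))"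
    by (rule defpred_subst[OF f[unfolded deffun_def]]) (use \<pi> in \<open>auto simp: less_Suc_eq\<close>)
  have upd: "(\<lambda>i. if i < Suc m then x (?\<pi> i) else 0)(m := 0) = (\<lambda>i. if i < m then (x(n := 0)) (\<pi> i) else 0)" for x
    using \<pi> by (auto simp: fun_eq_iff)
  show ?thesis
    using subst unfolding deffun_def upd by simp
qed

lemma deffun_proj: "i < n \<Longrightarrow> deffun n (\<lambda>x. x i)"
  using diagonal[of n "Suc n" i] by (simp add: deffun_def defpred_def)

lemma deffun_const: "deffun n (\<lambda>x. c)"
proof -
  have "{x \<in> Rn 1. x 0 \<in> \<Union>{{c}}} \<in> D 1"
    unfolding tame by (rule CollectI, rule exI[of _ "{{c}}"]) (simp add: is_interval_1)
  then have "defpred 1 (\<lambda>x. x 0 = c)" by (simp add: defpred_def)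
  from defpred_subst[OF this, of "\<lambda>_. n" "Suc n"] show ?thesis
    by (simp add: deffun_def)
qed

lemma defpred_eq:
  assumes "deffun n f" "deffun n g" shows "defpred n (\<lambda>x. f x = g x)"
proof -
  have "defpred n (\<lambda>x. \<exists>t. (x(n := t)) n = f ((x(n := t))(n := 0)) \<and> (x(n := t)) n = g ((x(n := t))(n := 0)))"
    by (rule defpred_ex[OF defpred_conj[OF assms[unfolded deffun_def]]])
  then show ?thesis
    by (rule defpred_cong) (auto simp: Rn_iff fun_upd_idem)
qed

text \<open>
  The values of \<open>f\<close> and \<open>g\<close> are quantified away as two further coordinates \<open>n + 1\<close> and \<open>n + 2\<close>,
  behind the coordinate \<open>n\<close> that holds the value of the composite.
\<close>

lemma deffun_binop:
  assumes op: "defpred 3 (\<lambda>x. opr (x 0) (x 1) = x 2)" and f: "deffun n f" and g: "deffun n g"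
  shows "deffun n (\<lambda>x. opr (f x) (g x))"
proof -
  have at: "defpred (Suc n + 2) (\<lambda>w. w j = h (trunc n w))" if "deffun n h" "j < Suc n + 2" for h j
  proof -
    have "deffun (Suc n + 2) (\<lambda>w. h (\<lambda>i. if i < n then w i else 0))"
      using that by (intro deffun_subst) auto
    then show ?thesis
      using defpred_eq[OF deffun_proj] that by (simp add: trunc_def)
  qed
  let ?\<pi> = "\<lambda>i::nat. if i = 0 then n + 1 else if i = 1 then n + 2 else n"
  have "defpred (Suc n + 2) (\<lambda>w. (\<lambda>x. opr (x 0) (x 1) = x 2) (\<lambda>i. if i < 3 then w (?\<pi> i) else 0))"
    by (intro defpred_subst op) auto
  then have "defpred (Suc n + 2) (\<lambda>w. opr (w (n + 1)) (w (n + 2)) = w n)"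
    by simp
  then have "defpred (Suc n + 2) (\<lambda>w. (w (n + 1) = f (trunc n w) \<and> w (n + 2) = g (trunc n w)) \<and>
      opr (w (n + 1)) (w (n + 2)) = w n)"
    using f g by (intro defpred_conj at) auto
  then have "defpred (Suc n) (\<lambda>x. \<exists>y\<in>Rn 2. (join (Suc n) x y (n + 1) = f (trunc n (join (Suc n) x y)) \<and>
      join (Suc n) x y (n + 2) = g (trunc n (join (Suc n) x y))) \<and>
      opr (join (Suc n) x y (n + 1)) (join (Suc n) x y (n + 2)) = join (Suc n) x y n)"
    by (rule defpred_ex_many)
  then show ?thesis
    unfolding deffun_def
  proof (rule defpred_cong)
    fix x :: "nat \<Rightarrow> real" assume x: "x \<in> Rn (Suc n)"
    have t: "trunc n (join (Suc n) x y) = x(n := 0)" for y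
      using x by (auto simp: trunc_def join_def Rn_iff fun_eq_iff)
    have ex: "\<exists>y\<in>Rn 2. y 0 = a \<and> y 1 = b" for a b :: real
      by (rule bexI[of _ "\<lambda>i. if i = 0 then a else if i = 1 then b else 0"]) (auto simp: Rn_iff)
    show "(\<exists>y\<in>Rn 2. (join (Suc n) x y (n + 1) = f (trunc n (join (Suc n) x y)) \<and>
      join (Suc n) x y (n + 2) = g (trunc n (join (Suc n) x y))) \<and>
      opr (join (Suc n) x y (n + 1)) (join (Suc n) x y (n + 2)) = join (Suc n) x y n)
      \<longleftrightarrow> x n = opr (f (x(n := 0))) (g (x(n := 0)))"
      unfolding t using ex[of "f (x(n := 0))" "g (x(n := 0))"] by (auto simp: join_def)
  qed
qed

lemma deffun_add: "deffun n f \<Longrightarrow> deffun n g \<Longrightarrow> deffun n (\<lambda>x. f x + g x)"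
  by (rule deffun_binop) (use addition in \<open>auto simp: defpred_def\<close>)

lemma deffun_mult: "deffun n f \<Longrightarrow> deffun n g \<Longrightarrow> deffun n (\<lambda>x. f x * g x)"
  by (rule deffun_binop) (use multiplication in \<open>auto simp: defpred_def\<close>)

lemma deffun_diff:
  assumes "deffun n f" "deffun n g" shows "deffun n (\<lambda>x. f x - g x)"
  using deffun_add[OF assms(1) deffun_mult[OF deffun_const[of _ "-1"] assms(2)]] by simp

lemma deffun_sum: "finite I \<Longrightarrow> (\<And>i. i \<in> I \<Longrightarrow> deffun n (f i)) \<Longrightarrow> deffun n (\<lambda>x. \<Sum>i\<in>I. f i x)"
  by (induction I rule: finite_induct) (auto intro: deffun_add deffun_const)

text \<open>
  The nonnegative reals are the squares.
\<close>

lemma defpred_nonneg: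
  assumes "deffun n f" shows "defpred n (\<lambda>x. 0 \<le> f x)"
proof -
  have "deffun (Suc n) (\<lambda>x. f (\<lambda>i. if i < n then x i else 0))"
    using assms by (rule deffun_subst) simp
  then have "defpred n (\<lambda>x. \<exists>t. (x(n := t)) n * (x(n := t)) n = f (\<lambda>i. if i < n then (x(n := t)) i else 0))"
    by (intro defpred_ex defpred_eq deffun_mult deffun_proj) auto
  then show ?thesis
  proof (rule defpred_cong)
    fix x :: "nat \<Rightarrow> real" assume x: "x \<in> Rn n"
    have "(\<lambda>i. if i < n then (x(n := t)) i else 0) = x" for t
      using x by (auto simp: Rn_iff fun_eq_iff)
    moreover have "(\<exists>t. t * t = a) \<longleftrightarrow> 0 \<le> a" for a :: real
      by (metis real_sqrt_mult_self abs_of_nonneg zero_le_square)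
    ultimately show "(\<exists>t. (x(n := t)) n * (x(n := t)) n = f (\<lambda>i. if i < n then (x(n := t)) i else 0)) \<longleftrightarrow> 0 \<le> f x"
      by simp
  qed
qed

lemma definable_standard_simplex: "standard_simplex p \<in> D (Suc p)"
proof -
  have "defpred (Suc p) (\<lambda>x. (\<forall>i\<in>{..p}. 0 \<le> x i) \<and> (\<Sum>i\<in>{..p}. x i) = 1)"
    by (intro defpred_conj defpred_ball defpred_nonneg defpred_eq deffun_sum deffun_proj deffun_const) auto
  moreover have "{x \<in> Rn (Suc p). (\<forall>i\<in>{..p}. 0 \<le> x i) \<and> (\<Sum>i\<in>{..p}. x i) = 1} = standard_simplex p"
  proof -
    have "x i \<le> 1" if "\<forall>i\<in>{..p}. 0 \<le> x i" "(\<Sum>i\<in>{..p}. x i) = 1" "x \<in> Rn (Suc p)" for x :: "nat \<Rightarrow> real" and i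
    proof (cases "i \<le> p")
      case True
      then show ?thesis using that member_le_sum[of i "{..p}" x] by auto
    qed (use that in \<open>auto simp: Rn_iff\<close>)
    moreover have "x \<in> Rn (Suc p) \<longleftrightarrow> (\<forall>i>p. x i = 0)" for x
      by (simp add: Rn_iff Suc_le_eq)
    moreover have "(\<forall>i. 0 \<le> x i) \<longleftrightarrow> (\<forall>i\<in>{..p}. 0 \<le> x i)" if "\<forall>i>p. x i = 0" for x :: "nat \<Rightarrow> real"
      by (metis atMost_iff not_le order_refl that)
    ultimately show ?thesis
      unfolding standard_simplex_def by (intro Collect_cong) metis
  qed
  ultimately show ?thesis by (simp add: defpred_def)
qed

end

section \<open>Definable singular simplices\<close>

lemma coords_in_Rn [simp]: "coords (v :: 'a::euclidean_space) \<in> Rn DIM('a)"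
  by (simp add: coords_def Rn_iff)

lemma coords_combine:
  "coords (a *\<^sub>R u + b *\<^sub>R v) j = a * coords u j + b * coords v j"
  by (simp add: coords_def inner_simps)

lemma singular_simplex_top_of_set_iff:
  fixes \<sigma> :: "(nat \<Rightarrow> real) \<Rightarrow> 'a::topological_space"
  shows "singular_simplex p (top_of_set X) \<sigma> \<longleftrightarrow>
    continuous_on (standard_simplex p) \<sigma> \<and> \<sigma> ` standard_simplex p \<subseteq> X \<and> \<sigma> \<in> extensional (standard_simplex p)"
  unfolding singular_simplex_def euclidean_product_topology
  by (auto simp: continuous_map_in_subtopology)

lemma singular_simplex_euclidean_iff:
  fixes \<sigma> :: "(nat \<Rightarrow> real) \<Rightarrow> 'a::topological_space"
  shows "singular_simplex p euclidean \<sigma> \<longleftrightarrow>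
    continuous_on (standard_simplex p) \<sigma> \<and> \<sigma> \<in> extensional (standard_simplex p)"
  using singular_simplex_top_of_set_iff[of p UNIV \<sigma>] by simp

lemma compact_standard_simplex: "compact (standard_simplex p)"
  using compactin_standard_simplex[of p] by (simp add: euclidean_product_topology)

lemma connected_standard_simplex: "connected (standard_simplex p)"
  using connectedin_standard_simplex[of p] by (simp add: euclidean_product_topology)

definition point_simplex :: "'a \<Rightarrow> (nat \<Rightarrow> real) \<Rightarrow> 'a"
  where "point_simplex a = restrict (\<lambda>_. a) (standard_simplex 0)"

text \<open>
  The cone with vertex \<open>x\<close> over \<open>\<sigma>\<close>; the vertex comes first. At \<open>t 0 = 1\<close>, where the rescaling
  divides by zero, the value of \<open>\<sigma>\<close> is multiplied by zero.
\<close>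

definition cone_simplex :: "nat \<Rightarrow> 'a::real_vector \<Rightarrow> ((nat \<Rightarrow> real) \<Rightarrow> 'a) \<Rightarrow> (nat \<Rightarrow> real) \<Rightarrow> 'a"
  where "cone_simplex p x \<sigma> = restrict (\<lambda>t. t 0 *\<^sub>R x + (1 - t 0) *\<^sub>R \<sigma> (\<lambda>i. t (Suc i) / (1 - t 0))) (standard_simplex (Suc p))"

lemma opposite_face_point:
  assumes "t \<in> standard_simplex (Suc p)" "t 0 \<noteq> 1"
  shows "(\<lambda>i. t (Suc i) / (1 - t 0)) \<in> standard_simplex p"
proof -
  have t: "\<And>i. 0 \<le> t i" "\<And>i. t i \<le> 1" "\<And>i. i > Suc p \<Longrightarrow> t i = 0" and s: "(\<Sum>i\<le>Suc p. t i) = 1"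
    using assms by (auto simp: standard_simplex_def)
  have s': "(\<Sum>i\<le>p. t (Suc i)) = 1 - t 0"
    using s unfolding sum.atMost_Suc_shift by simp
  have "t 0 < 1" using t(2)[of 0] assms by simp
  have "t (Suc i) \<le> 1 - t 0" for i
  proof (cases "i \<le> p")
    case True
    then have "t (Suc i) \<le> (\<Sum>i\<le>p. t (Suc i))"
      using t by (intro member_le_sum) auto
    then show ?thesis using s' by simp
  qed (use t in auto)
  then show ?thesis
    using t \<open>t 0 < 1\<close> s' by (auto simp: standard_simplex_def simp flip: sum_divide_distrib)
qed

lemma vertex_coordinates:
  assumes "t \<in> standard_simplex (Suc p)" "t 0 = 1" shows "t (Suc i) = 0"
proof (cases "i \<le> p")
  case True
  have t: "\<And>i. 0 \<le> t i" and s: "(\<Sum>i\<le>Suc p. t i) = 1"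
    using assms by (auto simp: standard_simplex_def)
  have "(\<Sum>i\<le>p. t (Suc i)) = 0"
    using s assms unfolding sum.atMost_Suc_shift by simp
  then show ?thesis
    using True t by (subst (asm) sum_nonneg_eq_0_iff) auto
qed (use assms in \<open>auto simp: standard_simplex_def\<close>)

text \<open>
  Away from the vertex \<open>x\<close> the cone is a composite of continuous maps. At the vertex the division
  by \<open>1 - t 0\<close> is harmless because \<open>\<sigma>\<close> is bounded, its domain being compact.
\<close>

lemma continuous_on_cone:
  fixes \<sigma> :: "(nat \<Rightarrow> real) \<Rightarrow> 'a::real_normed_vector"
  assumes "continuous_on (standard_simplex p) \<sigma>"
  shows "continuous_on (standard_simplex (Suc p)) (cone_simplex p x \<sigma>)"
proof -
  let ?f = "\<lambda>t. t 0 *\<^sub>R x + (1 - t 0) *\<^sub>R \<sigma> (\<lambda>i. t (Suc i) / (1 - t 0))"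
  let ?\<Delta> = "standard_simplex (Suc p)"
  have coord: "continuous_on S (\<lambda>t::nat \<Rightarrow> real. t i)" for S i
    by (rule continuous_on_subset[OF continuous_on_product_coordinates]) simp
  have "compact (\<sigma> ` standard_simplex p)"
    using assms compact_standard_simplex by (rule compact_continuous_image)
  then have "bounded (\<sigma> ` standard_simplex p)"
    by (rule compact_imp_bounded)
  then obtain M where M: "\<And>u. u \<in> standard_simplex p \<Longrightarrow> norm (\<sigma> u) \<le> M"
    by (auto simp: bounded_iff)
  have "continuous_on ?\<Delta> ?f"
    unfolding continuous_on_def
  proof
    fix t assume t: "t \<in> ?\<Delta>"
    have t1: "s 0 \<le> 1" if "s \<in> ?\<Delta>" for s
      using that by (simp add: standard_simplex_def)
    show "(?f \<longlongrightarrow> ?f t) (at t within ?\<Delta>)"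
    proof (cases "t 0 = 1")
      case True
      have "((\<lambda>s. ?f s - x) \<longlongrightarrow> 0) (at t within ?\<Delta>)"
      proof (rule Lim_null_comparison)
        show "\<forall>\<^sub>F s in at t within ?\<Delta>. norm (?f s - x) \<le> (1 - s 0) * (M + norm x)"
          unfolding eventually_at_filter
        proof (rule always_eventually, intro allI impI)
          fix s assume s: "s \<in> ?\<Delta>"
          have eq: "?f s - x = (1 - s 0) *\<^sub>R (\<sigma> (\<lambda>i. s (Suc i) / (1 - s 0)) - x)"
            by (simp add: algebra_simps)
          show "norm (?f s - x) \<le> (1 - s 0) * (M + norm x)"
          proof (cases "s 0 = 1")
            case False
            then have "norm (\<sigma> (\<lambda>i. s (Suc i) / (1 - s 0)) - x) \<le> M + norm x"
              using M[OF opposite_face_point[OF s]] norm_triangle_ineq4[of "\<sigma> (\<lambda>i. s (Suc i) / (1 - s 0))" x]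
              by linarith
            then show ?thesis
              unfolding eq using t1[OF s] by (simp add: mult_left_mono)
          qed simp
        qed
        have "((\<lambda>s. (1 - s 0) * (M + norm x)) \<longlongrightarrow> (1 - t 0) * (M + norm x)) (at t within ?\<Delta>)"
          using coord[of ?\<Delta> 0] t unfolding continuous_on_def by (intro tendsto_intros) auto
        then show "((\<lambda>s. (1 - s 0) * (M + norm x)) \<longlongrightarrow> 0) (at t within ?\<Delta>)"
          using True by simp
      qed
      then show ?thesis
        using True by (simp add: LIM_zero_iff)
    next
      case False
      let ?U = "{s::nat \<Rightarrow> real. s 0 < 1}"
      have U: "open ?U" "t \<in> ?U"
        using False t1[OF t] coord[of UNIV 0] by (auto intro!: open_Collect_less)
      have "continuous_on (?\<Delta> \<inter> ?U) ?f"
      proof -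
        have "continuous_on (?\<Delta> \<inter> ?U) (\<lambda>s i. s (Suc i) / (1 - s 0))"
          by (intro continuous_on_coordinatewise_then_product continuous_intros coord) auto
        then have "continuous_on (?\<Delta> \<inter> ?U) (\<lambda>s. \<sigma> (\<lambda>i. s (Suc i) / (1 - s 0)))"
          by (rule continuous_on_compose2[OF assms]) (auto intro!: opposite_face_point)
        then show ?thesis
          by (intro continuous_intros coord)
      qed
      then have "(?f \<longlongrightarrow> ?f t) (at t within ?\<Delta> \<inter> ?U)"
        using t U unfolding continuous_on_def by blast
      moreover have "at t within ?\<Delta> \<inter> ?U = at t within ?\<Delta>"
        using U by (intro at_within_nhd[of _ ?U]) auto
      ultimately show ?thesis by simp
    qed
  qed
  then show ?thesis
    by (rule continuous_on_eq) (simp add: cone_simplex_def)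
qed

lemma cone_image:
  assumes "\<And>u a. u \<in> standard_simplex p \<Longrightarrow> 0 \<le> a \<Longrightarrow> a \<le> 1 \<Longrightarrow> a *\<^sub>R x + (1 - a) *\<^sub>R \<sigma> u \<in> S"
  shows "cone_simplex p x \<sigma> ` standard_simplex (Suc p) \<subseteq> S"
proof
  fix y assume "y \<in> cone_simplex p x \<sigma> ` standard_simplex (Suc p)"
  then obtain t where t: "t \<in> standard_simplex (Suc p)"
    and y: "y = t 0 *\<^sub>R x + (1 - t 0) *\<^sub>R \<sigma> (\<lambda>i. t (Suc i) / (1 - t 0))"
    by (auto simp: cone_simplex_def)
  have t01: "0 \<le> t 0" "t 0 \<le> 1" using t by (auto simp: standard_simplex_def)
  show "y \<in> S"
  proof (cases "t 0 = 1")
    case True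
    obtain u where "u \<in> standard_simplex p" using nonempty_standard_simplex[of p] by auto
    then show ?thesis using assms[of u 1] True y by simp
  next
    case False
    then show ?thesis using assms[OF opposite_face_point[OF t] t01] y by simp
  qed
qed

lemma simplical_face_tail:
  "(\<lambda>i. simplical_face (Suc k) t (Suc i) / (1 - simplical_face (Suc k) t 0))
    = simplical_face k (\<lambda>i. t (Suc i) / (1 - (t 0 :: real)))"
  by (auto simp: simplical_face_def fun_eq_iff)

lemma singular_face_cone_0:
  assumes "\<sigma> \<in> extensional (standard_simplex p)"
  shows "singular_face (Suc p) 0 (cone_simplex p x \<sigma>) = \<sigma>"
proof
  fix t
  show "singular_face (Suc p) 0 (cone_simplex p x \<sigma>) t = \<sigma> t"
  proof (cases "t \<in> standard_simplex p")
    case True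
    then have "simplical_face 0 t \<in> standard_simplex (Suc p)"
      by (intro simplical_face_in_standard_simplex) auto
    moreover have "simplical_face 0 t 0 = 0" "\<And>i. simplical_face 0 t (Suc i) = t i"
      by (simp_all add: simplical_face_def)
    ultimately show ?thesis using True by (simp add: singular_face_def cone_simplex_def)
  next
    case False
    then show ?thesis using extensional_arb[OF assms False] by (simp add: singular_face_def)
  qed
qed

lemma singular_face_cone_Suc:
  assumes "k \<le> Suc p"
  shows "singular_face (Suc (Suc p)) (Suc k) (cone_simplex (Suc p) x \<sigma>) = cone_simplex p x (singular_face (Suc p) k \<sigma>)"
proof
  fix t
  show "singular_face (Suc (Suc p)) (Suc k) (cone_simplex (Suc p) x \<sigma>) t = cone_simplex p x (singular_face (Suc p) k \<sigma>) t"
  proof (cases "t \<in> standard_simplex (Suc p)")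
    case True
    then have 1: "simplical_face (Suc k) t \<in> standard_simplex (Suc (Suc p))"
      using assms by (intro simplical_face_in_standard_simplex) auto
    have 0: "simplical_face (Suc k) t 0 = t 0" by (simp add: simplical_face_def)
    show ?thesis
    proof (cases "t 0 = 1")
      case True
      with \<open>t \<in> standard_simplex (Suc p)\<close> 1 0 show ?thesis by (simp add: singular_face_def cone_simplex_def)
    next
      case False
      then show ?thesis
        using True 1 opposite_face_point[OF True False] simplical_face_tail[of k t]
        by (simp add: singular_face_def cone_simplex_def 0)
    qed
  next
    case False
    then show ?thesis by (simp add: singular_face_def cone_simplex_def)
  qed
qed

text \<open>
  The face opposite to the vertex is \<open>\<sigma>\<close>; the other faces are the cones over the faces of \<open>\<sigma>\<close>, with
  the opposite sign because their indices are shifted by one.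
\<close>

lemma chain_boundary_cone:
  assumes "\<sigma> \<in> extensional (standard_simplex (Suc p))"
  shows "chain_boundary (Suc (Suc p)) (frag_of (cone_simplex (Suc p) x \<sigma>))
    = frag_of \<sigma> - frag_extend (\<lambda>\<tau>. frag_of (cone_simplex p x \<tau>)) (chain_boundary (Suc p) (frag_of \<sigma>))"
proof -
  have "chain_boundary (Suc (Suc p)) (frag_of (cone_simplex (Suc p) x \<sigma>))
      = (\<Sum>k\<le>Suc (Suc p). frag_cmul ((- 1) ^ k) (frag_of (singular_face (Suc (Suc p)) k (cone_simplex (Suc p) x \<sigma>))))"
    by (simp add: chain_boundary_of del: sum.atMost_Suc)
  also have "\<dots> = frag_of \<sigma> + (\<Sum>k\<le>Suc p. frag_cmul ((- 1) ^ Suc k) (frag_of (cone_simplex p x (singular_face (Suc p) k \<sigma>))))"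
    unfolding sum.atMost_Suc_shift[of _ "Suc p"]
    by (simp add: singular_face_cone_0[OF assms] singular_face_cone_Suc del: sum.atMost_Suc)
  finally have eq: "chain_boundary (Suc (Suc p)) (frag_of (cone_simplex (Suc p) x \<sigma>))
      = frag_of \<sigma> + (\<Sum>k\<le>Suc p. frag_cmul ((- 1) ^ Suc k) (frag_of (cone_simplex p x (singular_face (Suc p) k \<sigma>))))" .
  have "(\<Sum>k\<le>Suc p. frag_cmul ((- 1) ^ Suc k) (frag_of (cone_simplex p x (singular_face (Suc p) k \<sigma>))))
      = - frag_extend (\<lambda>\<tau>. frag_of (cone_simplex p x \<tau>)) (chain_boundary (Suc p) (frag_of \<sigma>))"
    by (simp add: chain_boundary_of frag_extend_sum frag_extend_cmul comp_def del: sum.atMost_Suc flip: sum_negf)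
  with eq show ?thesis
    by (simp only: diff_conv_add_uminus)
qed

lemma chain_boundary_cone_0:
  assumes "\<sigma> \<in> extensional (standard_simplex 0)"
  shows "chain_boundary (Suc 0) (frag_of (cone_simplex 0 x \<sigma>)) = frag_of \<sigma> - frag_of (point_simplex x)"
proof -
  have "singular_face (Suc 0) (Suc 0) (cone_simplex 0 x \<sigma>) = point_simplex x"
  proof
    fix t :: "nat \<Rightarrow> real"
    show "singular_face (Suc 0) (Suc 0) (cone_simplex 0 x \<sigma>) t = point_simplex x t"
    proof (cases "t \<in> standard_simplex 0")
      case True
      then have "simplical_face (Suc 0) t \<in> standard_simplex (Suc 0)"
        using simplical_face_in_standard_simplex[of "Suc 0" "Suc 0" t] by simp
      moreover have "simplical_face (Suc 0) t 0 = 1"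
        using True by (simp add: standard_simplex_def simplical_face_def)
      ultimately show ?thesis
        using True by (simp add: singular_face_def point_simplex_def cone_simplex_def)
    next
      case False
      then show ?thesis by (simp add: singular_face_def point_simplex_def)
    qed
  qed
  note faces = this singular_face_cone_0[OF assms]
  have "chain_boundary (Suc 0) (frag_of (cone_simplex 0 x \<sigma>))
      = (\<Sum>k\<le>Suc 0. frag_cmul ((- 1) ^ k) (frag_of (singular_face (Suc 0) k (cone_simplex 0 x \<sigma>))))"
    by (simp only: chain_boundary_of nat.simps if_False)
  also have "\<dots> = frag_of \<sigma> + - frag_of (point_simplex x)"
    by (simp only: sum.atMost_Suc atMost_0 sum.insert finite.emptyI empty_iff not_False_eq_True sum.empty
        power_0 power_Suc mult_1_right add_0_right faces frag_cmul_one frag_cmul_minus_one)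
  finally show ?thesis
    by (simp only: diff_conv_add_uminus)
qed

context o_minimal_field_expansion
begin

text \<open>
  Graphs of maps that a first-order formula produces from a definable set \<open>G\<close> of parameters:
  the condition \<open>R\<close> selects, for each \<open>t\<close>, parameters in \<open>G\<close>, and \<open>F\<close> computes the value.
\<close>

lemma definable_map_by_formula:
  fixes \<tau> :: "(nat \<Rightarrow> real) \<Rightarrow> 'a::euclidean_space"
  assumes G: "G \<in> D m" and B: "B \<in> D n"
    and R: "defpred (n + m) R" and F: "\<And>j. j < DIM('a) \<Longrightarrow> deffun (n + m) (F j)"
    and ex: "\<And>t. t \<in> B \<Longrightarrow> \<exists>v\<in>G. R (join n t v)"
    and val: "\<And>t v j. t \<in> B \<Longrightarrow> v \<in> G \<Longrightarrow> R (join n t v) \<Longrightarrow> j < DIM('a) \<Longrightarrow> coords (\<tau> t) j = F j (join n t v)"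
  shows "definable_map D n B \<tau>"
proof -
  let ?N = "DIM('a)"
  let ?\<pi> = "\<lambda>i. if i < n then i else i + ?N"
  let ?tv = "\<lambda>z::nat \<Rightarrow> real. \<lambda>i. if i < n + m then z (?\<pi> i) else 0"
  let ?Q = "\<lambda>z. (\<lambda>i. if i < n then z i else 0) \<in> B \<and> (\<lambda>i. z (n + ?N + i)) \<in> G \<and> R (?tv z) \<and>
      (\<forall>j\<in>{..<?N}. z (n + j) = F j (?tv z))"
  have "defpred ((n + ?N) + m) ?Q"
  proof (intro defpred_conj defpred_ball defpred_eq)
    show "defpred ((n + ?N) + m) (\<lambda>z. (\<lambda>i. if i < n then z i else 0) \<in> B)"
      by (intro defpred_subst defpred_mem B) auto
    show "defpred ((n + ?N) + m) (\<lambda>z. (\<lambda>i. z (n + ?N + i)) \<in> G)"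
      by (rule defpred_shift[OF defpred_mem[OF G]])
    show "defpred ((n + ?N) + m) (\<lambda>z. R (?tv z))"
      by (rule defpred_subst[OF R]) auto
    fix j assume j: "j \<in> {..<?N}"
    then show "deffun ((n + ?N) + m) (\<lambda>z. z (n + j))"
      by (intro deffun_proj) auto
    show "deffun ((n + ?N) + m) (\<lambda>z. F j (?tv z))"
      by (rule deffun_subst[OF F]) (use j in auto)
  qed simp
  then have "defpred (n + ?N) (\<lambda>w. \<exists>v\<in>Rn m. ?Q (join (n + ?N) w v))"
    by (rule defpred_ex_many)
  moreover have "{w \<in> Rn (n + ?N). \<exists>v\<in>Rn m. ?Q (join (n + ?N) w v)} = (\<lambda>t. join n t (coords (\<tau> t))) ` B"
  proof -
    have Q: "?Q (join (n + ?N) w v) \<longleftrightarrow> trunc n w \<in> B \<and> v \<in> G \<and> R (join n (trunc n w) v) \<and>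
        (\<forall>j<?N. w (n + j) = F j (join n (trunc n w) v))" if "v \<in> Rn m" for w v
    proof -
      have "?tv (join (n + ?N) w v) = join n (trunc n w) v"
        using that by (auto simp: join_def trunc_def Rn_iff fun_eq_iff)
      moreover have "(\<lambda>i. if i < n then join (n + ?N) w v i else 0) = trunc n w"
        by (auto simp: join_def trunc_def)
      moreover have "(\<lambda>i. join (n + ?N) w v (n + ?N + i)) = v"
        by (simp add: join_def)
      moreover have "join (n + ?N) w v (n + j) = w (n + j)" if "j < ?N" for j
        using that by (simp add: join_def)
      ultimately show ?thesis by auto
    qed
    show ?thesis
    proof (intro equalityI subsetI)
      fix w assume "w \<in> {w \<in> Rn (n + ?N). \<exists>v\<in>Rn m. ?Q (join (n + ?N) w v)}"
      then obtain v where w: "w \<in> Rn (n + ?N)" and v: "v \<in> Rn m" and q: "?Q (join (n + ?N) w v)"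
        by auto
      note q = q[unfolded Q[OF v]]
      have "w i = join n (trunc n w) (coords (\<tau> (trunc n w))) i" for i
      proof -
        consider "i < n" | "n \<le> i" "i - n < ?N" | "n + ?N \<le> i" by linarith
        then show ?thesis
        proof cases
          case 2
          have "w (n + (i - n)) = F (i - n) (join n (trunc n w) v)"
            using q 2 by blast
          then have "w (n + (i - n)) = coords (\<tau> (trunc n w)) (i - n)"
            using q 2 val[of "trunc n w" v "i - n"] by simp
          moreover have "n + (i - n) = i" using 2 by simp
          ultimately show ?thesis using 2 by (simp add: join_def)
        next
          case 3
          then show ?thesis using w by (simp add: join_def Rn_iff coords_def)
        qed (simp add: join_def trunc_def)
      qed
      then show "w \<in> (\<lambda>t. join n t (coords (\<tau> t))) ` B"
        using q by blast
    next
      fix w assume "w \<in> (\<lambda>t. join n t (coords (\<tau> t))) ` B"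
      then obtain t where t: "t \<in> B" and w: "w = join n t (coords (\<tau> t))" by auto
      have tn: "t \<in> Rn n" using definable_subset[OF B] t by auto
      obtain v where v: "v \<in> G" "R (join n t v)" using ex[OF t] by auto
      have vm: "v \<in> Rn m" using definable_subset[OF G] v by auto
      have "w \<in> Rn (n + ?N)" unfolding w using tn by (intro join_in_Rn) auto
      moreover have "?Q (join (n + ?N) w v)"
        unfolding Q[OF vm] using t v tn val[OF t v] by (simp add: w) (simp add: join_def)
      ultimately show "w \<in> {w \<in> Rn (n + ?N). \<exists>v\<in>Rn m. ?Q (join (n + ?N) w v)}"
        using vm by blast
    qed
  qed
  ultimately show ?thesis
    using definable_subset[OF B] by (simp add: definable_map_def defpred_def)
qed

lemma definable_map_compose:
  fixes \<sigma> \<tau> :: "(nat \<Rightarrow> real) \<Rightarrow> 'a::euclidean_space"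
  assumes \<sigma>: "definable_map D m A \<sigma>" and B: "B \<in> D n"
    and h: "\<And>i. i < m \<Longrightarrow> deffun n (h i)"
    and u: "\<And>t. t \<in> B \<Longrightarrow> u t \<in> A" "\<And>t i. t \<in> B \<Longrightarrow> i < m \<Longrightarrow> u t i = h i t"
    and \<tau>: "\<And>t. t \<in> B \<Longrightarrow> \<tau> t = \<sigma> (u t)"
  shows "definable_map D n B \<tau>"
proof (rule definable_map_by_formula)
  let ?G = "(\<lambda>x. join m x (coords (\<sigma> x))) ` A"
  let ?R = "\<lambda>z. \<forall>i\<in>{..<m}. z (n + i) = h i (\<lambda>i. if i < n then z i else 0)"
  let ?F = "\<lambda>j z. z (n + m + j)"
  show "?G \<in> D (m + DIM('a))" "B \<in> D n"
    using \<sigma> B by (simp_all add: definable_map_def)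
  have A: "A \<subseteq> Rn m" using \<sigma> by (simp add: definable_map_def)
  show "defpred (n + (m + DIM('a))) ?R"
  proof (intro defpred_ball defpred_eq)
    fix i assume i: "i \<in> {..<m}"
    then show "deffun (n + (m + DIM('a))) (\<lambda>z. z (n + i))"
      by (intro deffun_proj) auto
    show "deffun (n + (m + DIM('a))) (\<lambda>z. h i (\<lambda>i. if i < n then z i else 0))"
      by (rule deffun_subst[OF h]) (use i in auto)
  qed simp
  show "deffun (n + (m + DIM('a))) (?F j)" if "j < DIM('a)" for j
    using that by (intro deffun_proj) auto
  have R: "?R (join n t (join m x y)) \<longleftrightarrow> x = u t" if "t \<in> B" "x \<in> A" for t x y
  proof -
    have "t \<in> Rn n" using that definable_subset[OF B] by auto
    then have 1: "(\<lambda>i. if i < n then join n t v i else 0) = t" for v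
      by (auto simp: join_def Rn_iff fun_eq_iff)
    have "x \<in> Rn m" "u t \<in> Rn m" using that A u(1) by auto
    moreover have "?R (join n t (join m x y)) \<longleftrightarrow> (\<forall>i<m. x i = u t i)"
      unfolding 1 using u(2)[OF that(1)] by (auto simp: join_def)
    ultimately show ?thesis
      unfolding Rn_iff fun_eq_iff by (metis not_le)
  qed
  show "\<exists>v\<in>?G. ?R (join n t v)" if "t \<in> B" for t
    using R[OF that u(1)[OF that]] u(1)[OF that] by blast
  show "coords (\<tau> t) j = ?F j (join n t v)"
    if "t \<in> B" "v \<in> ?G" "?R (join n t v)" "j < DIM('a)" for t v j
  proof -
    from that(2) obtain x where x: "x \<in> A" "v = join m x (coords (\<sigma> x))" by auto
    then have "x = u t" using R[OF that(1) x(1)] that(3) by blast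
    then show ?thesis using x \<tau>[OF that(1)] by (simp add: join_def)
  qed
qed

text \<open>
  The point \<open>u\<close> of the face opposite to the vertex is described by equations
  \<open>(1 - t 0) * u i = t (Suc i)\<close> without division. At the vertex they hold for every \<open>u\<close>, but there
  the value does not depend on \<open>u\<close>.
\<close>

lemma definable_map_cone:
  fixes \<sigma> :: "(nat \<Rightarrow> real) \<Rightarrow> 'a::euclidean_space"
  assumes \<sigma>: "definable_map D (Suc p) (standard_simplex p) \<sigma>"
  shows "definable_map D (Suc (Suc p)) (standard_simplex (Suc p)) (cone_simplex p x \<sigma>)"
proof (rule definable_map_by_formula)
  let ?n = "Suc (Suc p)" and ?m = "Suc p + DIM('a)"
  let ?G = "(\<lambda>x. join (Suc p) x (coords (\<sigma> x))) ` standard_simplex p"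
  let ?R = "\<lambda>z. \<forall>i\<in>{..p}. (1 - z 0) * z (?n + i) = z (Suc i)"
  let ?F = "\<lambda>j z. z 0 * coords x j + (1 - z 0) * z (?n + Suc p + j)"
  show "?G \<in> D ?m"
    using \<sigma> by (simp add: definable_map_def)
  show "standard_simplex (Suc p) \<in> D ?n"
    by (rule definable_standard_simplex)
  show "defpred (?n + ?m) ?R"
    by (intro defpred_ball defpred_eq deffun_mult deffun_diff deffun_const deffun_proj) auto
  show "deffun (?n + ?m) (?F j)" if "j < DIM('a)" for j
    using that by (intro deffun_add deffun_mult deffun_diff deffun_const deffun_proj) auto
  have R: "?R (join ?n t (join (Suc p) u y)) \<longleftrightarrow> (\<forall>i\<le>p. (1 - t 0) * u i = t (Suc i))" for t u y
    by (simp add: join_def Ball_def less_Suc_eq_le)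
  show "\<exists>v\<in>?G. ?R (join ?n t v)" if t: "t \<in> standard_simplex (Suc p)" for t
  proof (cases "t 0 = 1")
    case True
    obtain u where "u \<in> standard_simplex p" using nonempty_standard_simplex[of p] by auto
    moreover have "?R (join ?n t (join (Suc p) u (coords (\<sigma> u))))"
      unfolding R using True vertex_coordinates[OF t True] by simp
    ultimately show ?thesis by blast
  next
    case False
    let ?u = "\<lambda>i. t (Suc i) / (1 - t 0)"
    have "?R (join ?n t (join (Suc p) ?u (coords (\<sigma> ?u))))"
      unfolding R using False by simp
    then show ?thesis using opposite_face_point[OF t False] by blast
  qed
  show "coords (cone_simplex p x \<sigma> t) j = ?F j (join ?n t v)"
    if t: "t \<in> standard_simplex (Suc p)" and "v \<in> ?G" "?R (join ?n t v)" "j < DIM('a)" for t v j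
  proof -
    from that obtain u where u: "u \<in> standard_simplex p" "v = join (Suc p) u (coords (\<sigma> u))" by auto
    then have r: "\<And>i. i \<le> p \<Longrightarrow> (1 - t 0) * u i = t (Suc i)" using that(3) R by blast
    have *: "?F j (join ?n t v) = t 0 * coords x j + (1 - t 0) * coords (\<sigma> u) j"
      by (simp add: u join_def)
    show ?thesis
    proof (cases "t 0 = 1")
      case True
      then show ?thesis unfolding * using t by (simp add: cone_simplex_def)
    next
      case False
      have "t (Suc i) / (1 - t 0) = u i" for i
      proof (cases "i \<le> p")
        case True
        then show ?thesis using r[of i] False by (simp add: field_simps)
      next
        case False
        then show ?thesis using u t by (simp add: standard_simplex_def)
      qed
      then show ?thesis unfolding * using t by (simp add: cone_simplex_def coords_combine)
    qed
  qed
qed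

lemma definable_map_point_simplex:
  "definable_map D (Suc 0) (standard_simplex 0) (point_simplex (a :: 'a::euclidean_space))"
proof (rule definable_map_by_formula[where m = 0 and G = "Rn 0" and R = "\<lambda>_. True" and F = "\<lambda>j _. coords a j"])
  show "Rn 0 \<in> D 0" using defpred_True[of 0] by (simp add: defpred_def)
  show "\<exists>v\<in>Rn 0. True" by (auto intro: exI[of _ "\<lambda>_. 0"] simp: Rn_iff)
qed (auto intro: definable_standard_simplex deffun_const defpred_True simp: point_simplex_def)

abbreviation dsimplex :: "nat \<Rightarrow> 'a::euclidean_space set \<Rightarrow> ((nat \<Rightarrow> real) \<Rightarrow> 'a) \<Rightarrow> bool"
  where "dsimplex \<equiv> definable_singular_simplex D"

lemma dsimplex_iff:
  "dsimplex p X \<sigma> \<longleftrightarrow> dsimplex p UNIV \<sigma> \<and> \<sigma> ` standard_simplex p \<subseteq> X"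
  by (auto simp: definable_singular_simplex_def singular_simplex_top_of_set_iff singular_simplex_euclidean_iff)

lemma dsimplex_point: "a \<in> X \<Longrightarrow> dsimplex 0 X (point_simplex a)"
  using definable_map_point_simplex[of a] continuous_on_eq[of "standard_simplex 0" "\<lambda>_. a" "point_simplex a"]
  by (auto simp: definable_singular_simplex_def singular_simplex_top_of_set_iff point_simplex_def)

lemma dsimplex_cone:
  assumes "dsimplex p UNIV \<sigma>"
    "\<And>u a. u \<in> standard_simplex p \<Longrightarrow> 0 \<le> a \<Longrightarrow> a \<le> 1 \<Longrightarrow> a *\<^sub>R x + (1 - a) *\<^sub>R \<sigma> u \<in> X"
  shows "dsimplex (Suc p) X (cone_simplex p x \<sigma>)"
proof -
  have "cone_simplex p x \<sigma> \<in> extensional (standard_simplex (Suc p))"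
    by (simp add: cone_simplex_def)
  moreover have "cone_simplex p x \<sigma> ` standard_simplex (Suc p) \<subseteq> X"
    using assms(2) by (rule cone_image)
  ultimately show ?thesis
    using assms(1) continuous_on_cone[of p \<sigma> x] definable_map_cone[of p \<sigma> x]
    by (simp add: definable_singular_simplex_def singular_simplex_top_of_set_iff singular_simplex_euclidean_iff)
qed

lemma dsimplex_face:
  fixes \<sigma> :: "(nat \<Rightarrow> real) \<Rightarrow> 'a::euclidean_space"
  assumes "dsimplex (Suc p) X \<sigma>" "k \<le> Suc p"
  shows "dsimplex p X (singular_face (Suc p) k \<sigma>)"
  unfolding definable_singular_simplex_def
proof
  show "singular_simplex p (top_of_set X) (singular_face (Suc p) k \<sigma>)"
    using assms singular_simplex_singular_face[of "Suc p" "top_of_set X" \<sigma> k]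
    by (simp add: definable_singular_simplex_def)
  show "definable_map D (Suc p) (standard_simplex p) (singular_face (Suc p) k \<sigma>)"
  proof (rule definable_map_compose)
    show "definable_map D (Suc (Suc p)) (standard_simplex (Suc p)) \<sigma>"
      using assms by (simp add: definable_singular_simplex_def)
    show "deffun (Suc p) (if i < k then (\<lambda>t. t i) else if i = k then (\<lambda>t. 0) else (\<lambda>t. t (i - 1)))"
      if "i < Suc (Suc p)" for i
      using that assms(2) by (auto intro!: deffun_proj deffun_const)
    show "simplical_face k t \<in> standard_simplex (Suc p)" if "t \<in> standard_simplex p" for t :: "nat \<Rightarrow> real"
      using that assms by (intro simplical_face_in_standard_simplex) auto
  qed (auto simp: definable_standard_simplex simplical_face_def singular_face_def)
qed

lemma dsimplex_simplex_map:
  fixes \<sigma> :: "(nat \<Rightarrow> real) \<Rightarrow> 'a::euclidean_space"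
  assumes \<sigma>: "dsimplex p X \<sigma>" and f: "simplicial_simplex q (standard_simplex p) f"
  shows "dsimplex q X (simplex_map q \<sigma> f)"
  unfolding definable_singular_simplex_def
proof
  obtain l where l: "f = oriented_simplex q l" and img: "f ` standard_simplex q \<subseteq> standard_simplex p"
    using f by (auto simp: simplicial_simplex)
  have "singular_simplex q (subtopology (powertop_real UNIV) (standard_simplex p)) f"
    using f by (simp add: simplicial_simplex_def)
  then show "singular_simplex q (top_of_set X) (simplex_map q \<sigma> f)"
    using \<sigma> by (intro singular_simplex_simplex_map) (auto simp: definable_singular_simplex_def singular_simplex_def)
  show "definable_map D (Suc q) (standard_simplex q) (simplex_map q \<sigma> f)"
  proof (rule definable_map_compose)
    show "definable_map D (Suc p) (standard_simplex p) \<sigma>"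
      using \<sigma> by (simp add: definable_singular_simplex_def)
    show "deffun (Suc q) (\<lambda>t. \<Sum>j\<le>q. l j i * t j)" if "i < Suc p" for i
      by (intro deffun_sum deffun_mult deffun_const deffun_proj) auto
    show "f t \<in> standard_simplex p" if "t \<in> standard_simplex q" for t
      using that img by auto
  qed (auto simp: definable_standard_simplex simplex_map_def l oriented_simplex_def)
qed

end

section \<open>Definable chains\<close>

lemma keys_chain_boundary:
  "Poly_Mapping.keys (chain_boundary (Suc p) (frag_of \<sigma>)) \<subseteq> (\<lambda>k. singular_face (Suc p) k \<sigma>) ` {..Suc p}"
proof -
  have "Poly_Mapping.keys (chain_boundary (Suc p) (frag_of \<sigma>))
      \<subseteq> (\<Union>k\<in>{..Suc p}. Poly_Mapping.keys (frag_cmul ((- 1) ^ k) (frag_of (singular_face (Suc p) k \<sigma>))))"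
    unfolding chain_boundary_of by (simp del: sum.atMost_Suc keys_cmul_iff) (rule keys_sum)
  then show ?thesis by auto
qed

lemma keys_chain_map: "Poly_Mapping.keys (chain_map q g a) \<subseteq> simplex_map q g ` Poly_Mapping.keys a"
  unfolding chain_map_def using keys_frag_extend[of "frag_of \<circ> simplex_map q g" a] by auto

definition restrict_chain :: "('x \<Rightarrow> bool) \<Rightarrow> ('x \<Rightarrow>\<^sub>0 'g::ab_group_add) \<Rightarrow> ('x \<Rightarrow>\<^sub>0 'g)"
  where "restrict_chain P c = lin_extend (\<lambda>x. if P x then frag_of x else 0) c"

lemma keys_restrict_chain: "Poly_Mapping.keys (restrict_chain P c) \<subseteq> {x \<in> Poly_Mapping.keys c. P x}"
  unfolding restrict_chain_def
  using keys_lin_extend[of "\<lambda>x. if P x then frag_of x else 0" c] by (auto split: if_splits)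

lemma restrict_chain_split: "c = restrict_chain P c + restrict_chain (\<lambda>x. \<not> P x) c"
proof -
  have "restrict_chain P c + restrict_chain (\<lambda>x. \<not> P x) c
      = lin_extend (\<lambda>x. (if P x then frag_of x else 0) + (if \<not> P x then frag_of x else 0)) c"
    by (simp only: restrict_chain_def lin_extend_add_fun)
  also have "\<dots> = lin_extend frag_of c"
    by (rule lin_extend_cong) simp
  finally show ?thesis by simp
qed

definition subdivide :: "nat \<Rightarrow> ('a, 'g::ab_group_add) gchain \<Rightarrow> ('a, 'g) gchain"
  where "subdivide p c = lin_extend (\<lambda>\<sigma>. singular_subdivision p (frag_of \<sigma>)) c"

text \<open>
  The canonical homotopy between a chain and its barycentric subdivision is the image of the one
  constructed in the standard simplex. Being a composite with affine maps it stays definable.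
\<close>

definition subdivision_homotopy :: "nat \<Rightarrow> ((nat \<Rightarrow> real) \<Rightarrow> 'a) \<Rightarrow> 'a chain"
  where "subdivision_homotopy p \<sigma> = chain_map (Suc p) \<sigma> (subd p (frag_of (restrict id (standard_simplex p))))"

text \<open>
  The homotopy of the standard simplex is natural for affine maps, in particular for the inclusion
  of a face.
\<close>

lemma subd_singular_face:
  assumes k: "k \<le> Suc p"
  shows "chain_map (Suc p) \<sigma> (subd p (frag_of (singular_face (Suc p) k id)))
    = subdivision_homotopy p (singular_face (Suc p) k \<sigma>)"
proof -
  let ?I = "frag_of (restrict id (standard_simplex p)) :: (nat \<Rightarrow> real) chain"
  let ?f = "singular_face (Suc p) k id :: (nat \<Rightarrow> real) \<Rightarrow> nat \<Rightarrow> real"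
  have I: "simplicial_chain p (standard_simplex p) ?I"
    by simp
  have "simplicial_simplex (Suc p) (standard_simplex (Suc p)) (restrict id (standard_simplex (Suc p)))"
    by simp
  from simplicial_simplex_singular_face[OF this _ k]
  have f: "simplicial_simplex p (standard_simplex (Suc p)) ?f"
    using k by (simp add: singular_face_restrict)
  have fx: "?f x \<in> standard_simplex (Suc p)" "?f x = simplical_face k x" if "x \<in> standard_simplex p" for x
    using that k simplical_face_in_standard_simplex[of "Suc p" k x] by (simp_all add: singular_face_def)
  have "simplex_map p ?f (restrict id (standard_simplex p)) = ?f"
    by (auto simp: simplex_map_def singular_face_def)
  then have "subd p (frag_of ?f) = chain_map (Suc p) ?f (subd p ?I)"
    using chain_homotopic_simplicial_subdivision1[OF I f] by simp
  then have "chain_map (Suc p) \<sigma> (subd p (frag_of ?f)) = chain_map (Suc p) (\<sigma> \<circ> ?f) (subd p ?I)"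
    by (simp add: chain_map_compose)
  also have "\<dots> = chain_map (Suc p) (singular_face (Suc p) k \<sigma>) (subd p ?I)"
  proof (rule chain_map_eq)
    show "singular_chain (Suc p) (subtopology (powertop_real UNIV) (standard_simplex p)) (subd p ?I)"
      by (intro simplicial_imp_singular_chain chain_homotopic_simplicial_subdivision2 I)
    show "(\<sigma> \<circ> ?f) x = singular_face (Suc p) k \<sigma> x"
      if "x \<in> topspace (subtopology (powertop_real UNIV) (standard_simplex p))" for x
      using that by (simp add: singular_face_def)
  qed
  finally show ?thesis by (simp add: subdivision_homotopy_def)
qed

text \<open>
  This is the homotopy formula for the identity of the standard simplex, transported by \<open>\<sigma>\<close>.
\<close>

lemma chain_boundary_subdivision_homotopy:
  assumes \<sigma>: "singular_simplex p X \<sigma>"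
  shows "chain_boundary (Suc p) (subdivision_homotopy p \<sigma>)
    = singular_subdivision p (frag_of \<sigma>) - frag_of \<sigma>
      - frag_extend (subdivision_homotopy (p - 1)) (chain_boundary p (frag_of \<sigma>))"
proof -
  let ?I = "\<lambda>q. frag_of (restrict id (standard_simplex q)) :: (nat \<Rightarrow> real) chain"
  have I: "simplicial_chain p (standard_simplex p) (?I p)"
    by simp
  have "chain_boundary (Suc p) (subdivision_homotopy p \<sigma>)
      = chain_map p \<sigma> (chain_boundary (Suc p) (subd p (?I p)))"
    using chain_boundary_chain_map[OF simplicial_imp_singular_chain[OF chain_homotopic_simplicial_subdivision2[OF I]]]
    by (simp add: subdivision_homotopy_def)
  then have boundary: "chain_boundary (Suc p) (subdivision_homotopy p \<sigma>)
      = chain_map p \<sigma> (simplicial_subdivision p (?I p)) - chain_map p \<sigma> (?I p)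
      - chain_map p \<sigma> (subd (p - Suc 0) (chain_boundary p (?I p)))"
    by (simp only: chain_homotopic_simplicial_subdivision3[OF I] chain_map_diff)
  have id: "chain_map p \<sigma> (?I p) = frag_of \<sigma>"
    using \<sigma> by (rule singular_simplex_chain_map_id)
  have sd: "chain_map p \<sigma> (simplicial_subdivision p (?I p)) = singular_subdivision p (frag_of \<sigma>)"
    by (simp add: singular_subdivision_def)
  have faces: "chain_map p \<sigma> (subd (p - Suc 0) (chain_boundary p (?I p)))
      = frag_extend (subdivision_homotopy (p - 1)) (chain_boundary p (frag_of \<sigma>))"
  proof (cases p)
    case (Suc q)
    have "chain_map p \<sigma> (subd q (frag_cmul ((- 1) ^ k) (frag_of (singular_face p k (restrict id (standard_simplex p))))))
        = frag_cmul ((- 1) ^ k) (subdivision_homotopy q (singular_face p k \<sigma>))" if "k \<le> p" for k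
      using subd_singular_face[of k q \<sigma>] that Suc by (simp add: subd_power_uminus singular_face_restrict)
    then have "(\<Sum>k\<le>p. chain_map p \<sigma> (subd q (frag_cmul ((- 1) ^ k) (frag_of (singular_face p k (restrict id (standard_simplex p)))))))
        = (\<Sum>k\<le>p. frag_cmul ((- 1) ^ k) (subdivision_homotopy q (singular_face p k \<sigma>)))"
      by (intro sum.cong) auto
    then show ?thesis
      using Suc by (simp add: chain_boundary_of subd_power_sum chain_map_sum frag_extend_sum frag_extend_cmul comp_def
          del: sum.atMost_Suc)
  qed (simp add: chain_boundary_of)
  show ?thesis
    unfolding boundary id sd faces ..
qed

definition cone_chain :: "nat \<Rightarrow> 'a::real_vector \<Rightarrow> ('a, 'g::ab_group_add) gchain \<Rightarrow> ('a, 'g) gchain"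
  where "cone_chain p x c = lin_extend (\<lambda>\<sigma>. frag_of (cone_simplex p x \<sigma>)) c"

context o_minimal_field_expansion
begin

abbreviation dchain :: "nat \<Rightarrow> 'a::euclidean_space set \<Rightarrow> ('a, 'g::ab_group_add) gchain \<Rightarrow> bool"
  where "dchain \<equiv> definable_chain D"

text \<open>
  Since the constructions below do not depend on the target, they can be carried out in the support
  of the given chain; this is how supports are controlled.
\<close>

lemma dchain_iff: "dchain p X c \<longleftrightarrow> dchain p UNIV c \<and> supp p c \<subseteq> X"
  by (simp only: definable_chain_def supp_def dsimplex_iff[of p X] ball_conj_distrib UN_subset_iff)

lemma dchain_UNIV: "dchain p X c \<Longrightarrow> dchain p UNIV c"
  by (simp only: dchain_iff[of p X])

lemma supp_subset: "dchain p X c \<Longrightarrow> supp p c \<subseteq> X"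
  by (simp only: dchain_iff[of p X])

lemma dchain_supp: "dchain p X c \<Longrightarrow> dchain p (supp p c) c"
  by (simp only: dchain_iff[of p X] dchain_iff[of p "supp p c"] order_refl)

lemma dchain_mono: "dchain p X c \<Longrightarrow> X \<subseteq> Y \<Longrightarrow> dchain p Y c"
  using dchain_UNIV[of p X c] supp_subset[of p X c] by (subst dchain_iff) auto

lemma dsimplex_singular:
  "dsimplex p X \<sigma> \<Longrightarrow> singular_simplex p (top_of_set X) \<sigma>"
  "dsimplex p X \<sigma> \<Longrightarrow> \<sigma> \<in> extensional (standard_simplex p)"
  by (auto simp: definable_singular_simplex_def singular_simplex_def)

lemma dchain_0 [simp]: "dchain p X 0"
  by (simp add: definable_chain_def)

lemma dchain_add: "dchain p X a \<Longrightarrow> dchain p X b \<Longrightarrow> dchain p X (a + b)"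
  unfolding definable_chain_def using keys_add[of a b] by blast

lemma dchain_minus: "dchain p X a \<Longrightarrow> dchain p X (- a)"
  unfolding definable_chain_def by (simp add: keys_minus)

lemma dchain_diff: "dchain p X a \<Longrightarrow> dchain p X b \<Longrightarrow> dchain p X (a - b)"
  using dchain_add[of p X a "- b"] dchain_minus[of p X b] by simp

lemma dchain_sum: "(\<And>i. i \<in> I \<Longrightarrow> dchain p X (f i)) \<Longrightarrow> dchain p X (\<Sum>i\<in>I. f i)"
  by (induction I rule: infinite_finite_induct) (auto intro: dchain_add)

lemma dchain_restrict: "dchain p X c \<Longrightarrow> dchain p X (restrict_chain P c)"
  unfolding definable_chain_def using keys_restrict_chain[of P c] by blast

lemma dchain_frag_of: "dchain p X (frag_of \<sigma>) \<longleftrightarrow> dsimplex p X \<sigma>"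
  by (simp add: definable_chain_def)

lemma dchain_lin_extend:
  assumes "dchain p X c" "\<And>\<sigma>. \<sigma> \<in> Poly_Mapping.keys c \<Longrightarrow> dsimplex p X \<sigma> \<Longrightarrow> dchain q Y (\<phi> \<sigma>)"
  shows "dchain q Y (lin_extend \<phi> c)"
  unfolding definable_chain_def
proof
  fix \<tau> assume "\<tau> \<in> Poly_Mapping.keys (lin_extend \<phi> c)"
  then obtain \<sigma> where "\<sigma> \<in> Poly_Mapping.keys c" "\<tau> \<in> Poly_Mapping.keys (\<phi> \<sigma>)"
    using keys_lin_extend[of \<phi> c] by blast
  then show "dsimplex q Y \<tau>"
    using assms unfolding definable_chain_def by blast
qed

lemma dchain_chain_boundary: "dsimplex (Suc p) X \<sigma> \<Longrightarrow> dchain p X (chain_boundary (Suc p) (frag_of \<sigma>))"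
  unfolding definable_chain_def
proof
  fix \<tau> assume "dsimplex (Suc p) X \<sigma>" "\<tau> \<in> Poly_Mapping.keys (chain_boundary (Suc p) (frag_of \<sigma>))"
  then show "dsimplex p X \<tau>"
    using keys_chain_boundary[of p \<sigma>] by (auto intro: dsimplex_face)
qed

lemma dchain_boundary: "dchain (Suc p) X c \<Longrightarrow> dchain p X (boundary (Suc p) c)"
  unfolding boundary_eq_lin_extend by (rule dchain_lin_extend) (auto intro: dchain_chain_boundary)

lemma boundary_boundary:
  assumes "dchain (Suc p) X c" shows "boundary p (boundary (Suc p) c) = 0"
proof -
  have "boundary p (boundary (Suc p) c)
      = lin_extend (\<lambda>\<sigma>. chain_boundary p (chain_boundary (Suc p) (frag_of \<sigma>))) c"
    unfolding boundary_eq_lin_extend[of "Suc p"] boundary_lin_extend ..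
  also have "\<dots> = lin_extend (\<lambda>_. 0) c"
  proof (rule lin_extend_cong)
    fix \<sigma> assume "\<sigma> \<in> Poly_Mapping.keys c"
    then have "singular_chain (Suc p) (top_of_set X) (frag_of \<sigma>)"
      using assms dsimplex_singular(1)[of "Suc p" X \<sigma>] by (simp add: definable_chain_def singular_chain_of)
    then show "chain_boundary p (chain_boundary (Suc p) (frag_of \<sigma>)) = 0"
      by (rule chain_boundary_boundary_alt)
  qed
  finally show ?thesis by simp
qed

lemma dchain_chain_map:
  assumes \<sigma>: "dsimplex p X \<sigma>" and a: "simplicial_chain q (standard_simplex p) a"
  shows "dchain q X (chain_map q \<sigma> a)"
  unfolding definable_chain_def
proof
  fix \<tau> assume "\<tau> \<in> Poly_Mapping.keys (chain_map q \<sigma> a)"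
  then obtain f where "f \<in> Poly_Mapping.keys a" "\<tau> = simplex_map q \<sigma> f"
    using keys_chain_map by blast
  moreover from this have "simplicial_simplex q (standard_simplex p) f"
    using a by (auto simp: simplicial_chain_def)
  ultimately show "dsimplex q X \<tau>"
    using dsimplex_simplex_map[OF \<sigma>] by blast
qed

lemma dchain_subdivide: "dchain p X c \<Longrightarrow> dchain p X (subdivide p c)"
  unfolding subdivide_def singular_subdivision_def
  by (rule dchain_lin_extend) (auto intro!: dchain_chain_map simplicial_chain_simplicial_subdivision)

lemma boundary_subdivide:
  assumes "dchain (Suc p) X c"
  shows "boundary (Suc p) (subdivide (Suc p) c) = subdivide p (boundary (Suc p) c)"
proof -
  have "frag_extend (\<lambda>\<sigma>. singular_subdivision p (frag_of \<sigma>)) a = singular_subdivision p a" for a :: "'a chain"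
    by (simp add: singular_subdivision_def)
  moreover have "chain_boundary (Suc p) (singular_subdivision (Suc p) (frag_of \<sigma>))
      = singular_subdivision p (chain_boundary (Suc p) (frag_of \<sigma>))" if "\<sigma> \<in> Poly_Mapping.keys c" for \<sigma>
    using chain_boundary_singular_subdivision[of "Suc p" "top_of_set X" "frag_of \<sigma>"] assms that
      dsimplex_singular(1)[of "Suc p" X \<sigma>]
    by (simp add: definable_chain_def singular_chain_of)
  ultimately show ?thesis
    unfolding subdivide_def boundary_lin_extend boundary_eq_lin_extend[of "Suc p" c] lin_extend_extend
    by (intro lin_extend_cong) simp
qed

lemma dchain_subdivide_iter: "dchain p X c \<Longrightarrow> dchain p X ((subdivide p ^^ n) c)"
  by (induction n) (auto intro: dchain_subdivide)

lemma boundary_subdivide_iter: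
  assumes "dchain (Suc p) X c"
  shows "boundary (Suc p) ((subdivide (Suc p) ^^ n) c) = (subdivide p ^^ n) (boundary (Suc p) c)"
  by (induction n) (simp_all add: boundary_subdivide[OF dchain_subdivide_iter[OF assms]])

lemma cycle_subdivide_homologous:
  assumes c: "dchain p X c" and "boundary p c = 0"
  obtains e where "dchain (Suc p) X e" "boundary (Suc p) e = subdivide p c - c"
proof
  let ?e = "lin_extend (subdivision_homotopy p) c"
  show "dchain (Suc p) X ?e"
    unfolding subdivision_homotopy_def using c
    by (rule dchain_lin_extend) (auto intro!: dchain_chain_map chain_homotopic_simplicial_subdivision2)
  have "boundary (Suc p) ?e = lin_extend (\<lambda>\<sigma>. singular_subdivision p (frag_of \<sigma>) - frag_of \<sigma>
      - frag_extend (subdivision_homotopy (p - 1)) (chain_boundary p (frag_of \<sigma>))) c"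
    unfolding boundary_lin_extend
    by (rule lin_extend_cong, rule chain_boundary_subdivision_homotopy[of _ "top_of_set X"], rule dsimplex_singular(1))
      (use c in \<open>simp add: definable_chain_def\<close>)
  also have "\<dots> = subdivide p c - c - lin_extend (subdivision_homotopy (p - 1)) (boundary p c)"
    by (simp only: lin_extend_diff_fun subdivide_def lin_extend_frag_of lin_extend_extend boundary_eq_lin_extend)
  finally show "boundary (Suc p) ?e = subdivide p c - c"
    using assms by simp
qed

lemma boundary_zero_subdivide_iter:
  assumes c: "dchain p X c" and "boundary p c = 0"
  shows "boundary p ((subdivide p ^^ n) c) = 0"
proof (cases p)
  case 0
  then show ?thesis by (simp add: boundary_def)
next
  case (Suc q)
  have "(subdivide q ^^ n) 0 = (0 :: ('a, 'b) gchain)"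
    by (induction n) (simp_all add: subdivide_def)
  then show ?thesis
    using boundary_subdivide_iter[of q X c n] assms Suc by simp
qed

lemma cycle_subdivide_iter_homologous:
  assumes c: "dchain p X c" and "boundary p c = 0"
  obtains e where "dchain (Suc p) X e" "boundary (Suc p) e = (subdivide p ^^ n) c - c"
proof -
  have "\<exists>e. dchain (Suc p) X e \<and> boundary (Suc p) e = (subdivide p ^^ n) c - c"
  proof (induction n)
    case 0
    then show ?case by (intro exI[of _ 0]) simp
  next
    case (Suc n)
    then obtain e where e: "dchain (Suc p) X e" "boundary (Suc p) e = (subdivide p ^^ n) c - c" by blast
    obtain e' where "dchain (Suc p) X e'"
      "boundary (Suc p) e' = subdivide p ((subdivide p ^^ n) c) - (subdivide p ^^ n) c"
      using cycle_subdivide_homologous[OF dchain_subdivide_iter[OF c] boundary_zero_subdivide_iter[OF assms]] by blast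
    then show ?case
      using e by (intro exI[of _ "e + e'"]) (simp add: dchain_add boundary_add)
  qed
  then show thesis using that by blast
qed

lemma subdivide_iter_small:
  assumes c: "dchain p X c" and U: "\<And>U. U \<in> \<U> \<Longrightarrow> openin (top_of_set X) U" "X \<subseteq> \<Union>\<U>"
  obtains n where "\<And>\<tau>. \<tau> \<in> Poly_Mapping.keys ((subdivide p ^^ n) c) \<Longrightarrow> \<exists>U\<in>\<U>. \<tau> ` standard_simplex p \<subseteq> U"
proof -
  have "\<exists>n. \<forall>m\<ge>n. \<forall>\<tau>\<in>Poly_Mapping.keys ((singular_subdivision p ^^ m) (frag_of \<sigma>)).
      \<exists>U\<in>\<U>. \<tau> ` standard_simplex p \<subseteq> U" if "\<sigma> \<in> Poly_Mapping.keys c" for \<sigma>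
  proof -
    have "singular_chain p (top_of_set X) (frag_of \<sigma>)"
      using c that dsimplex_singular(1) by (auto simp: definable_chain_def singular_chain_of)
    from sufficient_iterated_singular_subdivision_exists[OF U(1) _ this] U(2)
    obtain n where "\<And>m f. \<lbrakk>n \<le> m; f \<in> Poly_Mapping.keys ((singular_subdivision p ^^ m) (frag_of \<sigma>))\<rbrakk>
        \<Longrightarrow> \<exists>V \<in> \<U>. f \<in> standard_simplex p \<rightarrow> V" by auto
    then show ?thesis
      by (simp only: image_subset_iff_funcset) (intro exI[of _ n], auto)
  qed
  then have "\<exists>N. \<forall>\<sigma>\<in>Poly_Mapping.keys c. \<forall>m\<ge>N \<sigma>. \<forall>\<tau>\<in>Poly_Mapping.keys ((singular_subdivision p ^^ m) (frag_of \<sigma>)).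
      \<exists>U\<in>\<U>. \<tau> ` standard_simplex p \<subseteq> U"
    by (intro bchoice) simp
  then obtain N where N: "\<And>\<sigma> m \<tau>. \<sigma> \<in> Poly_Mapping.keys c \<Longrightarrow> N \<sigma> \<le> m \<Longrightarrow>
      \<tau> \<in> Poly_Mapping.keys ((singular_subdivision p ^^ m) (frag_of \<sigma>)) \<Longrightarrow> \<exists>U\<in>\<U>. \<tau> ` standard_simplex p \<subseteq> U"
    by blast
  have iter: "(subdivide p ^^ m) c = lin_extend (\<lambda>\<sigma>. (singular_subdivision p ^^ m) (frag_of \<sigma>)) c" for m
  proof (induction m)
    case (Suc m)
    have "frag_extend (\<lambda>\<sigma>. singular_subdivision p (frag_of \<sigma>)) a = singular_subdivision p a" for a :: "'a chain"
      by (simp add: singular_subdivision_def)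
    with Suc show ?case by (simp add: subdivide_def[of p "lin_extend _ _"] lin_extend_extend)
  qed simp
  \<comment> \<open>the sum serves as a common upper bound of the numbers \<open>N \<sigma>\<close>\<close>
  define n where "n = (\<Sum>\<sigma>\<in>Poly_Mapping.keys c. N \<sigma>)"
  show thesis
  proof (rule that[of n])
    fix \<tau> assume "\<tau> \<in> Poly_Mapping.keys ((subdivide p ^^ n) c)"
    then obtain \<sigma> where \<sigma>: "\<sigma> \<in> Poly_Mapping.keys c"
      "\<tau> \<in> Poly_Mapping.keys ((singular_subdivision p ^^ n) (frag_of \<sigma>))"
      unfolding iter using keys_lin_extend[of "\<lambda>\<sigma>. (singular_subdivision p ^^ n) (frag_of \<sigma>)" c] by auto
    moreover have "N \<sigma> \<le> n"
      unfolding n_def using \<sigma> by (intro member_le_sum) auto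
    ultimately show "\<exists>U\<in>\<U>. \<tau> ` standard_simplex p \<subseteq> U"
      by (intro N)
  qed
qed

lemma dchain_cone_chain:
  assumes "dchain p Y c" "\<And>y a. y \<in> Y \<Longrightarrow> 0 \<le> a \<Longrightarrow> a \<le> 1 \<Longrightarrow> a *\<^sub>R x + (1 - a) *\<^sub>R y \<in> X"
  shows "dchain (Suc p) X (cone_chain p x c)"
  unfolding cone_chain_def using assms(1)
proof (rule dchain_lin_extend)
  fix \<sigma> assume "dsimplex p Y \<sigma>"
  then have \<sigma>: "dsimplex p UNIV \<sigma>" and "\<sigma> ` standard_simplex p \<subseteq> Y"
    by (simp_all only: dsimplex_iff[of p Y \<sigma>])
  then have "a *\<^sub>R x + (1 - a) *\<^sub>R \<sigma> u \<in> X" if "u \<in> standard_simplex p" "0 \<le> a" "a \<le> 1" for u a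
    using that by (intro assms(2)) (simp_all add: image_subset_iff)
  with \<sigma> show "dchain (Suc p) X (frag_of (cone_simplex p x \<sigma>))"
    unfolding dchain_frag_of by (rule dsimplex_cone)
qed

lemma boundary_cone_chain:
  assumes "dchain (Suc p) X c"
  shows "boundary (Suc (Suc p)) (cone_chain (Suc p) x c) = c - cone_chain p x (boundary (Suc p) c)"
proof -
  have "boundary (Suc (Suc p)) (cone_chain (Suc p) x c)
      = lin_extend (\<lambda>\<sigma>. frag_of \<sigma> - frag_extend (\<lambda>\<tau>. frag_of (cone_simplex p x \<tau>)) (chain_boundary (Suc p) (frag_of \<sigma>))) c"
    unfolding cone_chain_def boundary_lin_extend
    by (rule lin_extend_cong, rule chain_boundary_cone, rule dsimplex_singular(2)[where X = X])
      (use assms in \<open>simp add: definable_chain_def\<close>)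
  then show ?thesis
    by (simp only: lin_extend_diff_fun cone_chain_def lin_extend_frag_of lin_extend_extend boundary_eq_lin_extend)
qed

text \<open>
  The cone over a chain has as boundary the chain minus the cone over the boundary, which is zero for
  a cycle of positive dimension.
\<close>

lemma cycle_bounds_by_coning:
  assumes "dchain (Suc p) Y c" "boundary (Suc p) c = 0"
    and "\<And>y a. y \<in> Y \<Longrightarrow> 0 \<le> a \<Longrightarrow> a \<le> 1 \<Longrightarrow> a *\<^sub>R x + (1 - a) *\<^sub>R y \<in> X"
  obtains d where "dchain (Suc (Suc p)) X d" "boundary (Suc (Suc p)) d = c"
proof
  show "dchain (Suc (Suc p)) X (cone_chain (Suc p) x c)"
    using assms by (intro dchain_cone_chain[of "Suc p" Y]) auto
  show "boundary (Suc (Suc p)) (cone_chain (Suc p) x c) = c"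
    unfolding boundary_cone_chain[OF assms(1)] using assms(2) by (simp add: cone_chain_def)
qed

end

section \<open>Filling cycles in the complement of a skeleton of a cubical grid\<close>

lemma supp_add: "supp p (a + b) \<subseteq> supp p a \<union> supp p b"
  unfolding supp_def using keys_add[of a b] by auto

lemma supp_diff: "supp p (a - b) \<subseteq> supp p a \<union> supp p b"
  unfolding supp_def using keys_diff[of a b] by auto

lemma supp_sum: "supp p (\<Sum>i\<in>I. f i) \<subseteq> (\<Union>i\<in>I. supp p (f i))"
proof -
  have "supp p (\<Sum>i\<in>I. f i) \<subseteq> (\<Union>\<sigma>\<in>(\<Union>i\<in>I. Poly_Mapping.keys (f i)). \<sigma> ` standard_simplex p)"
    unfolding supp_def by (rule UN_mono[OF keys_sum]) simp
  then show ?thesis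
    by (simp add: supp_def)
qed

lemma supp_0 [simp]: "supp p 0 = {}"
  by (simp add: supp_def)

lemma supp_restrict: "supp p (restrict_chain P c) \<subseteq> supp p c"
  unfolding supp_def using keys_restrict_chain[of P c] by auto

lemma supp_empty_iff: "supp p c = {} \<longleftrightarrow> c = 0"
  by (simp add: supp_def nonempty_standard_simplex)

definition thicken :: "real \<Rightarrow> 'a::metric_space set \<Rightarrow> 'a set"
  where "thicken r X = (\<Union>x\<in>X. cball x r)"

lemma thicken_mono: "X \<subseteq> Y \<Longrightarrow> r \<le> s \<Longrightarrow> thicken r X \<subseteq> thicken s Y"
  unfolding thicken_def by (intro UN_mono) auto

lemma thicken_superset: "0 \<le> r \<Longrightarrow> X \<subseteq> thicken r X"
  unfolding thicken_def by force

lemma thicken_thicken: "thicken r (thicken s X) \<subseteq> thicken (r + s) X"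
proof
  fix z assume "z \<in> thicken r (thicken s X)"
  then obtain y x where "dist y z \<le> r" "dist x y \<le> s" "x \<in> X"
    by (auto simp: thicken_def)
  moreover have "dist x z \<le> dist x y + dist y z" by (rule dist_triangle)
  ultimately show "z \<in> thicken (r + s) X" by (auto simp: thicken_def intro!: bexI[of _ x])
qed

context o_minimal_field_expansion
begin

text \<open>
  Vanishing of the homology of \<open>X\<close> in dimension \<open>p\<close>, with control over the location of the
  filling: a filling that stays near a cycle in \<open>\<Gamma>\<close> can later be pushed into \<open>\<Gamma>\<close>.
\<close>

definition fillable :: "'g::ab_group_add itself \<Rightarrow> nat \<Rightarrow> real \<Rightarrow> 'a::euclidean_space set \<Rightarrow> bool"
  where "fillable G p r X \<longleftrightarrow> (\<forall>z :: ('a, 'g) gchain. dchain p X z \<longrightarrow> boundary p z = 0 \<longrightarrow>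
    (\<exists>d. dchain (Suc p) X d \<and> boundary (Suc p) d = z \<and> supp (Suc p) d \<subseteq> thicken r (supp p z)))"

lemma fillable_obtain:
  fixes z :: "('a::euclidean_space, 'g::ab_group_add) gchain" and G :: "'g itself"
  assumes "fillable G p r X" "dchain p X z" "boundary p z = 0"
  obtains d where "dchain (Suc p) X d" "boundary (Suc p) d = z" "supp (Suc p) d \<subseteq> thicken r (supp p z)"
  using assms unfolding fillable_def by blast

lemma fillable_empty:
  fixes G :: "'g::ab_group_add itself"
  shows "fillable G p r ({} :: 'a::euclidean_space set)"
  unfolding fillable_def
proof (intro allI impI)
  fix z :: "('a, 'g) gchain"
  assume "dchain p {} z"
  then have "z = 0" using supp_subset[of p "{}" z] by (simp add: supp_empty_iff)
  then show "\<exists>d. dchain (Suc p) {} d \<and> boundary (Suc p) d = z \<and> supp (Suc p) d \<subseteq> thicken r (supp p z)"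
    by (intro exI[of _ 0]) simp
qed

lemma fillable_convex:
  fixes G :: "'g::ab_group_add itself" and X :: "'a::euclidean_space set"
  assumes "convex X" "\<And>x y. x \<in> X \<Longrightarrow> y \<in> X \<Longrightarrow> dist x y \<le> r"
  shows "fillable G (Suc p) r X"
  unfolding fillable_def
proof (intro allI impI)
  fix z :: "('a, 'g) gchain"
  assume z: "dchain (Suc p) X z" "boundary (Suc p) z = 0"
  show "\<exists>d. dchain (Suc (Suc p)) X d \<and> boundary (Suc (Suc p)) d = z \<and> supp (Suc (Suc p)) d \<subseteq> thicken r (supp (Suc p) z)"
  proof (cases "z = 0")
    case True
    then show ?thesis by (intro exI[of _ 0]) simp
  next
    case False
    then obtain x where x: "x \<in> supp (Suc p) z"
      using supp_empty_iff[of "Suc p" z] by auto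
    then have xX: "x \<in> X" using supp_subset[OF z(1)] by auto
    obtain d where d: "dchain (Suc (Suc p)) X d" "boundary (Suc (Suc p)) d = z"
    proof (rule cycle_bounds_by_coning[OF z, of x X])
      show "a *\<^sub>R x + (1 - a) *\<^sub>R y \<in> X" if "y \<in> X" "0 \<le> a" "a \<le> 1" for y a
        using convexD[OF assms(1) xX, of y a "1 - a"] that by simp
    qed
    have "supp (Suc (Suc p)) d \<subseteq> cball x r"
      using supp_subset[OF d(1)] assms(2) xX by auto
    then have "supp (Suc (Suc p)) d \<subseteq> thicken r (supp (Suc p) z)"
      using x unfolding thicken_def by auto
    then show ?thesis using d by blast
  qed
qed

text \<open>
  The exactness part of the Mayer--Vietoris sequence: the cycle is split along the cover after
  subdivision, the common boundary of the two parts is filled in the intersection, and the two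
  corrected parts are filled separately.
\<close>

lemma fillable_Mayer_Vietoris:
  fixes G :: "'g::ab_group_add itself" and X :: "'a::euclidean_space set"
  assumes open_sets: "openin (top_of_set X) A" "openin (top_of_set X) B" and X: "X = A \<union> B"
    and fill: "fillable G (Suc p) r A" "fillable G (Suc p) r B" "fillable G p r (A \<inter> B)"
    and r: "0 \<le> r"
  shows "fillable G (Suc p) (2 * r) X"
  unfolding fillable_def
proof (intro allI impI)
  fix z :: "('a, 'g) gchain"
  assume z: "dchain (Suc p) X z" "boundary (Suc p) z = 0"
  let ?S = "supp (Suc p) z"
  have zS: "dchain (Suc p) ?S z" using z(1) by (rule dchain_supp)
  have SX: "?S \<subseteq> X" using z(1) by (rule supp_subset)
  obtain n where n: "\<And>\<tau>. \<tau> \<in> Poly_Mapping.keys ((subdivide (Suc p) ^^ n) z) \<Longrightarrow>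
      \<exists>U\<in>{A, B}. \<tau> ` standard_simplex (Suc p) \<subseteq> U"
    by (rule subdivide_iter_small[OF z(1), of "{A, B}"]) (use open_sets X in auto)
  obtain e where e: "dchain (Suc (Suc p)) ?S e" "boundary (Suc (Suc p)) e = (subdivide (Suc p) ^^ n) z - z"
    using cycle_subdivide_iter_homologous[OF zS z(2)] by blast
  let ?z = "(subdivide (Suc p) ^^ n) z"
  have z'S: "dchain (Suc p) ?S ?z" by (rule dchain_subdivide_iter[OF zS])
  \<comment> \<open>the simplices in \<open>A\<close> go to the first part, all others lie in \<open>B\<close>\<close>
  let ?P = "\<lambda>\<sigma>. \<sigma> ` standard_simplex (Suc p) \<subseteq> A"
  let ?a = "restrict_chain ?P ?z" and ?b = "restrict_chain (\<lambda>\<sigma>. \<not> ?P \<sigma>) ?z"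
  have split: "?z = ?a + ?b" by (rule restrict_chain_split)
  have aS: "dchain (Suc p) ?S ?a" and bS: "dchain (Suc p) ?S ?b"
    using z'S by (rule dchain_restrict)+
  have "supp (Suc p) ?a \<subseteq> A"
    unfolding supp_def using keys_restrict_chain[of ?P ?z] by auto
  then have a: "dchain (Suc p) A ?a"
    using dchain_UNIV[OF aS] dchain_iff[of "Suc p" A ?a] by simp
  have "supp (Suc p) ?b \<subseteq> B"
    unfolding supp_def using keys_restrict_chain[of "\<lambda>\<sigma>. \<not> ?P \<sigma>" ?z] n by blast
  then have b: "dchain (Suc p) B ?b"
    using dchain_UNIV[OF bS] dchain_iff[of "Suc p" B ?b] by simp
  have "boundary (Suc p) ?z = 0"
    by (rule boundary_zero_subdivide_iter[OF z])
  then have "boundary (Suc p) ?a + boundary (Suc p) ?b = 0"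
    using split boundary_add[of "Suc p" ?a ?b] by simp
  then have ab: "boundary (Suc p) ?b = - boundary (Suc p) ?a"
    by (metis minus_unique)
  let ?u = "boundary (Suc p) ?a"
  have uA: "dchain p A ?u" and uS: "dchain p ?S ?u"
    using a aS by (auto intro: dchain_boundary)
  have uB: "dchain p B ?u"
    using dchain_minus[OF dchain_boundary[OF b]] ab by simp
  have u: "dchain p (A \<inter> B) ?u"
    using supp_subset[OF uA] supp_subset[OF uB] dchain_UNIV[OF uA] dchain_iff[of p "A \<inter> B" ?u] by simp
  obtain w where w: "dchain (Suc p) (A \<inter> B) w" "boundary (Suc p) w = ?u" "supp (Suc p) w \<subseteq> thicken r (supp p ?u)"
    by (rule fillable_obtain[OF fill(3) u boundary_boundary[OF a]])
  have wS: "supp (Suc p) w \<subseteq> thicken r ?S"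
    using w(3) thicken_mono[OF supp_subset[OF uS] order_refl] by blast
  have awA: "dchain (Suc p) A (?a - w)"
    using a dchain_mono[OF w(1), of A] by (auto intro: dchain_diff)
  have bwB: "dchain (Suc p) B (?b + w)"
    using b dchain_mono[OF w(1), of B] by (auto intro: dchain_add)
  have aw0: "boundary (Suc p) (?a - w) = 0" and bw0: "boundary (Suc p) (?b + w) = 0"
    using w(2) ab by (simp_all add: boundary_diff boundary_add)
  obtain d1 where d1: "dchain (Suc (Suc p)) A d1" "boundary (Suc (Suc p)) d1 = ?a - w"
      "supp (Suc (Suc p)) d1 \<subseteq> thicken r (supp (Suc p) (?a - w))"
    by (rule fillable_obtain[OF fill(1) awA aw0])
  obtain d2 where d2: "dchain (Suc (Suc p)) B d2" "boundary (Suc (Suc p)) d2 = ?b + w"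
      "supp (Suc (Suc p)) d2 \<subseteq> thicken r (supp (Suc p) (?b + w))"
    by (rule fillable_obtain[OF fill(2) bwB bw0])
  have near: "thicken r (supp (Suc p) c) \<subseteq> thicken (2 * r) ?S"
    if "supp (Suc p) c \<subseteq> ?S \<union> supp (Suc p) w" for c :: "('a, 'g) gchain"
  proof -
    have "supp (Suc p) c \<subseteq> thicken r ?S"
      using that wS thicken_superset[OF r, of ?S] by blast
    then have "thicken r (supp (Suc p) c) \<subseteq> thicken r (thicken r ?S)"
      by (rule thicken_mono) simp
    also have "\<dots> \<subseteq> thicken (r + r) ?S" by (rule thicken_thicken)
    finally show ?thesis by simp
  qed
  have s1: "supp (Suc p) (?a - w) \<subseteq> ?S \<union> supp (Suc p) w"
    using supp_diff[of "Suc p" ?a w] supp_subset[OF aS] by blast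
  have s2: "supp (Suc p) (?b + w) \<subseteq> ?S \<union> supp (Suc p) w"
    using supp_add[of "Suc p" ?b w] supp_subset[OF bS] by blast
  let ?d = "d1 + d2 - e"
  show "\<exists>d. dchain (Suc (Suc p)) X d \<and> boundary (Suc (Suc p)) d = z \<and> supp (Suc (Suc p)) d \<subseteq> thicken (2 * r) ?S"
  proof (intro exI conjI)
    show "dchain (Suc (Suc p)) X ?d"
      using dchain_mono[OF d1(1), of X] dchain_mono[OF d2(1), of X] dchain_mono[OF e(1) SX] X
      by (auto intro!: dchain_add dchain_diff)
    have "boundary (Suc (Suc p)) ?d = (?a - w) + (?b + w) - (?z - z)"
      by (simp only: boundary_add boundary_diff d1 d2 e)
    also have "\<dots> = (?a + ?b) - ?z + z" by simp
    also have "\<dots> = z" by (simp only: split[symmetric] diff_self add_0)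
    finally show "boundary (Suc (Suc p)) ?d = z" .
    have "supp (Suc (Suc p)) ?d \<subseteq> supp (Suc (Suc p)) d1 \<union> supp (Suc (Suc p)) d2 \<union> supp (Suc (Suc p)) e"
      using supp_add[of "Suc (Suc p)" d1 d2] supp_diff[of "Suc (Suc p)" "d1 + d2" e] by blast
    also have "\<dots> \<subseteq> thicken (2 * r) ?S"
      using d1(3) d2(3) near[OF s1] near[OF s2] supp_subset[OF e(1)] thicken_superset[of "2 * r" ?S] r by auto
    finally show "supp (Suc (Suc p)) ?d \<subseteq> thicken (2 * r) ?S" .
  qed
qed

text \<open>
  A singular simplex is connected, so in a disjoint union of open sets a cycle splits into cycles
  of the members.
\<close>

lemma fillable_disjoint_Union:
  fixes G :: "'g::ab_group_add itself" and Y :: "'i \<Rightarrow> 'a::euclidean_space set"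
  assumes open_sets: "\<And>i. openin (top_of_set (\<Union>i. Y i)) (Y i)" and disj: "\<And>i j. i \<noteq> j \<Longrightarrow> Y i \<inter> Y j = {}"
    and fill: "\<And>i. fillable G p r (Y i)"
  shows "fillable G p r (\<Union>i. Y i)"
  unfolding fillable_def
proof (intro allI impI)
  fix z :: "('a, 'g) gchain"
  assume z: "dchain p (\<Union>i. Y i) z" "boundary p z = 0"
  let ?P = "\<lambda>i q \<sigma>. \<sigma> ` standard_simplex q \<subseteq> Y i"
  have uniq: "i = j" if "?P i q \<sigma>" "?P j q \<sigma>" for i j q and \<sigma> :: "(nat \<Rightarrow> real) \<Rightarrow> 'a"
  proof (rule ccontr)
    assume "i \<noteq> j"
    obtain t where "t \<in> standard_simplex q" using nonempty_standard_simplex[of q] by auto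
    then have "\<sigma> t \<in> Y i \<inter> Y j" using that by auto
    then show False using disj[OF \<open>i \<noteq> j\<close>] by simp
  qed
  have "\<exists>i. ?P i p \<sigma>" if "\<sigma> \<in> Poly_Mapping.keys z" for \<sigma>
  proof -
    have \<sigma>: "continuous_on (standard_simplex p) \<sigma>" "\<sigma> ` standard_simplex p \<subseteq> (\<Union>i. Y i)"
      using z(1) that unfolding definable_chain_def definable_singular_simplex_def singular_simplex_top_of_set_iff
      by auto
    let ?K = "\<sigma> ` standard_simplex p"
    obtain t where t: "t \<in> standard_simplex p" using nonempty_standard_simplex[of p] by auto
    then obtain i where i: "\<sigma> t \<in> Y i" using \<sigma>(2) by auto
    have K: "connected ?K"
      using \<sigma>(1) connected_standard_simplex by (rule connected_continuous_image)
    have rel: "openin (top_of_set ?K) (?K \<inter> V)" if V: "openin (top_of_set (\<Union>i. Y i)) V" for V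
    proof -
      obtain T where "open T" "V = (\<Union>i. Y i) \<inter> T"
        using V unfolding openin_open by blast
      moreover from this have "?K \<inter> V = ?K \<inter> T" using \<sigma>(2) by auto
      ultimately show ?thesis by (simp add: openin_open_Int)
    qed
    have o1: "openin (top_of_set ?K) (?K \<inter> Y i)"
      by (rule rel[OF open_sets])
    have "openin (top_of_set (\<Union>i. Y i)) (\<Union>j\<in>- {i}. Y j)"
      using open_sets by (intro openin_Union) auto
    then have o2: "openin (top_of_set ?K) (?K \<inter> (\<Union>j\<in>- {i}. Y j))"
      by (rule rel)
    have "Y i \<inter> (\<Union>j\<in>- {i}. Y j) = {}"
    proof (rule equals0I)
      fix x assume "x \<in> Y i \<inter> (\<Union>j\<in>- {i}. Y j)"
      then obtain j where "j \<noteq> i" "x \<in> Y i \<inter> Y j" by auto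
      then show False using disj[of i j] by auto
    qed
    moreover have "?K \<subseteq> Y i \<union> (\<Union>j\<in>- {i}. Y j)" using \<sigma>(2) by auto
    moreover have "S - (S \<inter> A) = S \<inter> C" if "A \<inter> C = {}" "S \<subseteq> A \<union> C" for S A C :: "'a set"
      using that by blast
    ultimately have "?K - (?K \<inter> Y i) = ?K \<inter> (\<Union>j\<in>- {i}. Y j)"
      by metis
    then have "closedin (top_of_set ?K) (?K \<inter> Y i)"
      using o2 by (simp add: closedin_def)
    then have "?K \<inter> Y i = {} \<or> ?K \<inter> Y i = ?K"
      using K o1 by (simp add: connected_clopen)
    then have "?K \<subseteq> Y i" using i t by auto
    then show ?thesis by blast
  qed
  then obtain \<iota> where \<iota>: "\<And>\<sigma>. \<sigma> \<in> Poly_Mapping.keys z \<Longrightarrow> ?P (\<iota> \<sigma>) p \<sigma>"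
    by metis
  define J where "J = \<iota> ` Poly_Mapping.keys z"
  have J: "finite J" by (simp add: J_def)
  define c where "c i = restrict_chain (?P i p) z" for i
  have z_sum: "z = (\<Sum>i\<in>J. c i)"
  proof -
    have "lin_extend (\<lambda>\<sigma>. \<Sum>i\<in>K. if ?P i p \<sigma> then frag_of \<sigma> else 0) z = (\<Sum>i\<in>K. c i)" if "finite K" for K
      using that by (induction K) (simp_all add: lin_extend_add_fun c_def restrict_chain_def)
    from this[OF J] have "(\<Sum>i\<in>J. c i) = lin_extend (\<lambda>\<sigma>. \<Sum>i\<in>J. if ?P i p \<sigma> then frag_of \<sigma> else 0) z" ..
    also have "\<dots> = lin_extend frag_of z"
    proof (rule lin_extend_cong)
      fix \<sigma> assume \<sigma>: "\<sigma> \<in> Poly_Mapping.keys z"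
      have "?P i p \<sigma> \<longleftrightarrow> i = \<iota> \<sigma>" for i
        using uniq[of \<sigma> p i "\<iota> \<sigma>"] \<iota>[OF \<sigma>] by metis
      moreover have "\<iota> \<sigma> \<in> J" using \<sigma> by (simp add: J_def)
      ultimately show "(\<Sum>i\<in>J. if ?P i p \<sigma> then frag_of \<sigma> else 0) = frag_of \<sigma>"
        using J by simp
    qed
    finally show ?thesis by simp
  qed
  have c: "dchain p (Y i) (c i)" for i
  proof -
    have "supp p (c i) \<subseteq> Y i"
      unfolding supp_def c_def using keys_restrict_chain[of "?P i p" z] by auto
    moreover have "dchain p UNIV (c i)"
      unfolding c_def by (rule dchain_UNIV[OF dchain_restrict[OF z(1)]])
    ultimately show ?thesis using dchain_iff[of p "Y i" "c i"] by simp
  qed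
  have c0: "boundary p (c i) = 0" if "i \<in> J" for i
  proof (cases p)
    case 0
    then show ?thesis by (simp add: boundary_def)
  next
    case (Suc q)
    have sub: "?P j q \<tau>" if "\<tau> \<in> Poly_Mapping.keys (boundary p (c j))" for j \<tau>
      using dchain_boundary[of q "Y j" "c j"] c[of j] that Suc dsimplex_iff[of q "Y j" \<tau>]
      unfolding definable_chain_def by simp
    show ?thesis
    proof (rule poly_mapping_eqI)
      fix \<tau>
      show "Poly_Mapping.lookup (boundary p (c i)) \<tau> = Poly_Mapping.lookup 0 \<tau>"
      proof (rule ccontr)
        assume "Poly_Mapping.lookup (boundary p (c i)) \<tau> \<noteq> Poly_Mapping.lookup 0 \<tau>"
        then have \<tau>: "\<tau> \<in> Poly_Mapping.keys (boundary p (c i))" by (simp add: in_keys_iff)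
        have "Poly_Mapping.lookup (boundary p (c j)) \<tau> = 0" if "j \<noteq> i" for j
          using uniq[of \<tau> q i j] sub[OF \<tau>] sub[of \<tau> j] that
          by (auto simp: in_keys_iff)
        then have "(\<Sum>j\<in>J - {i}. Poly_Mapping.lookup (boundary p (c j)) \<tau>) = 0"
          by (intro sum.neutral) auto
        then have "(\<Sum>j\<in>J. Poly_Mapping.lookup (boundary p (c j)) \<tau>) = Poly_Mapping.lookup (boundary p (c i)) \<tau>"
          using J \<open>i \<in> J\<close> by (simp add: sum.remove[of J i])
        moreover have "(\<Sum>j\<in>J. Poly_Mapping.lookup (boundary p (c j)) \<tau>) = Poly_Mapping.lookup (boundary p z) \<tau>"
          by (subst z_sum) (simp add: boundary_sum lookup_sum)
        ultimately show False using z(2) \<tau> by (simp add: in_keys_iff)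
      qed
    qed
  qed
  have "\<exists>d. dchain (Suc p) (Y i) d \<and> boundary (Suc p) d = c i \<and> supp (Suc p) d \<subseteq> thicken r (supp p (c i))"
    if "i \<in> J" for i
    using fill[of i] c[of i] c0[OF that] unfolding fillable_def by blast
  then obtain d where d: "\<And>i. i \<in> J \<Longrightarrow> dchain (Suc p) (Y i) (d i)" "\<And>i. i \<in> J \<Longrightarrow> boundary (Suc p) (d i) = c i"
      "\<And>i. i \<in> J \<Longrightarrow> supp (Suc p) (d i) \<subseteq> thicken r (supp p (c i))"
    by metis
  show "\<exists>d. dchain (Suc p) (\<Union>i. Y i) d \<and> boundary (Suc p) d = z \<and> supp (Suc p) d \<subseteq> thicken r (supp p z)"
  proof (intro exI conjI)
    show "dchain (Suc p) (\<Union>i. Y i) (\<Sum>i\<in>J. d i)"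
      using d(1) by (intro dchain_sum) (auto intro: dchain_mono)
    show "boundary (Suc p) (\<Sum>i\<in>J. d i) = z"
      using d(2) z_sum by (simp add: boundary_sum)
    have "supp p (c i) \<subseteq> supp p z" for i
      unfolding c_def by (rule supp_restrict)
    then have "supp (Suc p) (d i) \<subseteq> thicken r (supp p z)" if "i \<in> J" for i
      using d(3)[OF that] thicken_mono[of "supp p (c i)" "supp p z" r r] by auto
    then show "supp (Suc p) (\<Sum>i\<in>J. d i) \<subseteq> thicken r (supp p z)"
      using supp_sum[of "Suc p" d J] by blast
  qed
qed

end

text \<open>
  For \<open>I = Basis\<close> and \<open>B = UNIV\<close> this is the complement of the skeleton of codimension \<open>k\<close> of the
  cubical grid of mesh \<open>s\<close> with origin \<open>v\<close>. In the induction on the number of coordinates,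
  \<open>I\<close> consists of the coordinates still to be treated, and \<open>B\<close> is bounded in the others.
\<close>

definition few_on_grid :: "'a::euclidean_space \<Rightarrow> real \<Rightarrow> 'a set \<Rightarrow> nat \<Rightarrow> 'a set \<Rightarrow> 'a set"
  where "few_on_grid v s I k B = {x \<in> B. card {b \<in> I. (x \<bullet> b - v \<bullet> b) / s \<in> \<int>} < k}"

lemma few_on_grid_0 [simp]: "few_on_grid v s I 0 B = {}"
  by (simp add: few_on_grid_def)

lemma few_on_grid_Int: "few_on_grid v s I k (B \<inter> C) = few_on_grid v s I k B \<inter> C"
  by (auto simp: few_on_grid_def)

lemma open_few_on_grid:
  assumes "finite I" "s \<noteq> 0" shows "open (few_on_grid v s I k UNIV)"
proof -
  have closed_grid: "closed {x. (x \<bullet> b - v \<bullet> b) / s \<in> \<int>}" for b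
  proof -
    have "closed ((\<lambda>x. (x \<bullet> b - v \<bullet> b) / s) -` (\<int> :: real set))"
      using assms by (intro closed_vimage closed_Ints continuous_intros) auto
    then show ?thesis by (simp add: vimage_def)
  qed
  have eq: "- few_on_grid v s I k UNIV = (\<Union>K\<in>{K. K \<subseteq> I \<and> card K = k}. \<Inter>b\<in>K. {x. (x \<bullet> b - v \<bullet> b) / s \<in> \<int>})"
  proof (intro equalityI subsetI)
    fix x assume "x \<in> - few_on_grid v s I k UNIV"
    then have "k \<le> card {b \<in> I. (x \<bullet> b - v \<bullet> b) / s \<in> \<int>}" by (simp add: few_on_grid_def)
    then obtain K where "K \<subseteq> {b \<in> I. (x \<bullet> b - v \<bullet> b) / s \<in> \<int>}" "card K = k"
      by (rule obtain_subset_with_card_n)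
    then show "x \<in> (\<Union>K\<in>{K. K \<subseteq> I \<and> card K = k}. \<Inter>b\<in>K. {x. (x \<bullet> b - v \<bullet> b) / s \<in> \<int>})"
      by (intro UN_I[of K]) auto
  next
    fix x assume "x \<in> (\<Union>K\<in>{K. K \<subseteq> I \<and> card K = k}. \<Inter>b\<in>K. {x. (x \<bullet> b - v \<bullet> b) / s \<in> \<int>})"
    then obtain K where K: "K \<subseteq> I" "card K = k" "\<And>b. b \<in> K \<Longrightarrow> (x \<bullet> b - v \<bullet> b) / s \<in> \<int>" by auto
    then have "K \<subseteq> {b \<in> I. (x \<bullet> b - v \<bullet> b) / s \<in> \<int>}" by auto
    then have "card K \<le> card {b \<in> I. (x \<bullet> b - v \<bullet> b) / s \<in> \<int>}"
      using assms by (intro card_mono) auto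
    then show "x \<in> - few_on_grid v s I k UNIV"
      using K(2) by (simp add: few_on_grid_def)
  qed
  have "finite {K. K \<subseteq> I \<and> card K = k}"
    using assms by (auto intro: finite_subset[of _ "Pow I"])
  then have "closed (- few_on_grid v s I k UNIV)"
    unfolding eq by (intro closed_UN closed_INT ballI closed_grid)
  then show ?thesis by (simp add: closed_def)
qed

context o_minimal_field_expansion
begin

text \<open>
  The slabs between consecutive integers are the level sets of a locally constant function, the
  integral part of the rescaled coordinate.
\<close>

lemma fillable_slabs:
  fixes G :: "'g::ab_group_add itself" and B :: "'a::euclidean_space set"
  assumes w: "w \<noteq> 0" and fill: "\<And>m::int. fillable G p r
    (few_on_grid v s I k (B \<inter> {x. real_of_int m < (x \<bullet> b - c) / w \<and> (x \<bullet> b - c) / w < real_of_int m + 1}))"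
  shows "fillable G p r (few_on_grid v s I k (B \<inter> {x. (x \<bullet> b - c) / w \<notin> \<int>}))"
proof -
  let ?u = "\<lambda>x. (x \<bullet> b - c) / w"
  let ?Y = "\<lambda>m::int. few_on_grid v s I k (B \<inter> {x. real_of_int m < ?u x \<and> ?u x < real_of_int m + 1})"
  have floor: "\<lfloor>?u x\<rfloor> = m" if "real_of_int m < ?u x \<and> ?u x < real_of_int m + 1" for x m
    using that by (intro floor_unique) auto
  have notin: "?u x \<notin> \<int>" if "real_of_int m < ?u x \<and> ?u x < real_of_int m + 1" for x m
  proof
    assume "?u x \<in> \<int>"
    then obtain i where "?u x = of_int i" by (auto elim: Ints_cases)
    then have "m < i" "i < m + 1" using that by auto
    then show False by simp
  qed
  have strict: "real_of_int \<lfloor>?u x\<rfloor> < ?u x \<and> ?u x < real_of_int \<lfloor>?u x\<rfloor> + 1" if "?u x \<notin> \<int>" for x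
  proof -
    have "real_of_int \<lfloor>?u x\<rfloor> \<noteq> ?u x" using that by (metis Ints_of_int)
    then show ?thesis using floor_correct[of "?u x"] by linarith
  qed
  have U: "(\<Union>m. ?Y m) = few_on_grid v s I k (B \<inter> {x. ?u x \<notin> \<int>})"
    using notin strict unfolding few_on_grid_Int by blast
  have "fillable G p r (\<Union>m. ?Y m)"
  proof (rule fillable_disjoint_Union)
    fix m
    have "open {x. real_of_int m < ?u x \<and> ?u x < real_of_int m + 1}"
      using w by (intro open_Collect_conj open_Collect_less continuous_intros) auto
    moreover have "?Y m = (\<Union>m. ?Y m) \<inter> {x. real_of_int m < ?u x \<and> ?u x < real_of_int m + 1}"
      using floor unfolding few_on_grid_Int by auto
    ultimately show "openin (top_of_set (\<Union>m. ?Y m)) (?Y m)"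
      unfolding openin_open by blast
  next
    show "?Y i \<inter> ?Y j = {}" if "i \<noteq> j" for i j
      using floor that unfolding few_on_grid_Int by blast
  qed (rule fill)
  then show ?thesis unfolding U .
qed

text \<open>
  Induction on the set \<open>I\<close> of coordinates that are compared with the grid. For a new coordinate
  \<open>b\<close>, the points whose \<open>b\<close>-coordinate is off the grid form slabs in which \<open>k\<close> is unchanged; the
  points that are less than half a mesh away from the grid and satisfy the condition for \<open>k - 1\<close>
  in the remaining coordinates form slabs as well, and so do the intersections. So Mayer--Vietoris
  reduces the assertion to slabs in which \<open>b\<close> is not compared with the grid, and the bound on the
  width of the slabs keeps the filling near the cycle.
\<close>

lemma fillable_few_on_grid:
  fixes G :: "'g::ab_group_add itself" and B :: "'a::euclidean_space set" and s :: real
  assumes "finite I" "I \<subseteq> Basis" "0 < s" "convex B" "k \<le> p"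
    and "\<And>b x y. b \<in> Basis - I \<Longrightarrow> x \<in> B \<Longrightarrow> y \<in> B \<Longrightarrow> \<bar>x \<bullet> b - y \<bullet> b\<bar> \<le> s"
  shows "fillable G p (2 ^ card I * (DIM('a) * s)) (few_on_grid v s I k B)"
  using assms(1,2,4-)
proof (induction I arbitrary: k p B rule: finite_induct)
  case empty
  show ?case
  proof (cases p)
    case 0
    then show ?thesis using empty by (simp add: fillable_empty)
  next
    case (Suc q)
    show ?thesis
    proof (cases k)
      case 0
      then show ?thesis by (simp add: fillable_empty)
    next
      case (Suc k')
      then have "few_on_grid v s {} k B = B" by (simp add: few_on_grid_def)
      moreover have "dist x y \<le> DIM('a) * s" if "x \<in> B" "y \<in> B" for x y
      proof -
        have "norm (x - y) \<le> (\<Sum>b\<in>Basis. \<bar>(x - y) \<bullet> b\<bar>)" by (rule norm_le_l1)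
        also have "\<dots> \<le> (\<Sum>b\<in>(Basis :: 'a set). s)"
          using empty.prems(4) that by (intro sum_mono) (auto simp: inner_diff_left)
        finally show ?thesis by (simp add: dist_norm)
      qed
      ultimately show ?thesis
        using fillable_convex[of B "DIM('a) * s" G q] empty.prems(2) \<open>p = Suc q\<close> by simp
    qed
  qed
next
  case (insert b J)
  show ?case
  proof (cases k)
    case 0
    then show ?thesis by (simp add: fillable_empty)
  next
    case (Suc k')
    then obtain p' where p': "p = Suc p'" "k' \<le> p'" using insert.prems(3) by (cases p) auto
    let ?r = "2 ^ card J * (DIM('a) * s)"
    let ?t = "\<lambda>x. (x \<bullet> b - v \<bullet> b) / s"
    let ?X = "few_on_grid v s (insert b J) k B"
    have bB: "b \<in> Basis" "J \<subseteq> Basis" using insert.prems(1) by auto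
    have slabs: "fillable G q ?r (few_on_grid v s J l (B \<inter> {x. (x \<bullet> b - c) / w \<notin> \<int>}))"
      if "l \<le> q" "0 < w" "w \<le> s" for q l c w
    proof (rule fillable_slabs)
      show "w \<noteq> 0" using that by simp
      fix m :: int
      let ?S = "{x. real_of_int m < (x \<bullet> b - c) / w \<and> (x \<bullet> b - c) / w < real_of_int m + 1}"
      show "fillable G q ?r (few_on_grid v s J l (B \<inter> ?S))"
      proof (rule insert.IH)
        have S: "?S = {x. b \<bullet> x > m * w + c} \<inter> {x. b \<bullet> x < (m + 1) * w + c}"
          using that by (auto simp: field_simps inner_commute)
        show "convex (B \<inter> ?S)"
          unfolding S by (intro convex_Int insert.prems convex_halfspace_lt convex_halfspace_gt)
        show "\<bar>x \<bullet> b' - y \<bullet> b'\<bar> \<le> s" if "b' \<in> Basis - J" "x \<in> B \<inter> ?S" "y \<in> B \<inter> ?S" for b' x y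
        proof (cases "b' = b")
          case True
          have "\<bar>x \<bullet> b - y \<bullet> b\<bar> \<le> w"
            using that(2,3) unfolding S by (auto simp: inner_commute algebra_simps abs_le_iff)
          then show ?thesis using True \<open>w \<le> s\<close> by simp
        next
          case False
          then show ?thesis using insert.prems(4)[of b' x y] that by auto
        qed
      qed (use bB that in auto)
    qed
    \<comment> \<open>\<open>?A\<close>: the \<open>b\<close>-coordinate is off the grid; \<open>?B\<close>: it is not at the centre between two grid points\<close>
    let ?A = "few_on_grid v s J k (B \<inter> {x. ?t x \<notin> \<int>})"
    let ?B = "few_on_grid v s J k' (B \<inter> {x. (x \<bullet> b - (v \<bullet> b - s / 2)) / s \<notin> \<int>})"
    have half: "(x \<bullet> b - (v \<bullet> b - s / 2)) / s = ?t x + 1 / 2" for x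
      using \<open>0 < s\<close> by (simp add: field_simps)
    have double: "(x \<bullet> b - v \<bullet> b) / (s / 2) = 2 * ?t x" for x
      by simp
    have int_half: "2 * y \<notin> \<int> \<longleftrightarrow> y \<notin> \<int> \<and> y + 1 / 2 \<notin> \<int>" for y :: real
    proof -
      have "2 * y \<in> \<int> \<longleftrightarrow> y \<in> \<int> \<or> y + 1 / 2 \<in> \<int>"
      proof
        assume "2 * y \<in> \<int>"
        then obtain i :: int where i: "2 * y = of_int i" by (auto elim: Ints_cases)
        show "y \<in> \<int> \<or> y + 1 / 2 \<in> \<int>"
        proof (cases "even i")
          case True
          then obtain j where "i = 2 * j" by auto
          then have "y = of_int j" using i by simp
          then show ?thesis by simp
        next
          case False
          then obtain j where "i = 2 * j + 1" by (auto elim: oddE)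
          then have "y + 1 / 2 = of_int (j + 1)" using i by simp
          then show ?thesis by (metis Ints_of_int)
        qed
      next
        assume "y \<in> \<int> \<or> y + 1 / 2 \<in> \<int>"
        then obtain i :: int where "y = of_int i \<or> y + 1 / 2 = of_int i" by (auto elim: Ints_cases)
        then have "2 * y = of_int (2 * i) \<or> 2 * y = of_int (2 * i - 1)" by auto
        then show "2 * y \<in> \<int>" by (metis Ints_of_int)
      qed
      then show ?thesis by blast
    qed
    let ?n = "\<lambda>x. card {b \<in> J. (x \<bullet> b - v \<bullet> b) / s \<in> \<int>}"
    have card_insert: "card {b' \<in> insert b J. (x \<bullet> b' - v \<bullet> b') / s \<in> \<int>} = (if ?t x \<in> \<int> then Suc (?n x) else ?n x)" for x
    proof -
      have "{b' \<in> insert b J. (x \<bullet> b' - v \<bullet> b') / s \<in> \<int>}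
          = (if ?t x \<in> \<int> then insert b {b \<in> J. (x \<bullet> b - v \<bullet> b) / s \<in> \<int>} else {b \<in> J. (x \<bullet> b - v \<bullet> b) / s \<in> \<int>})"
        by auto
      then show ?thesis using insert.hyps by simp
    qed
    have X_mem: "x \<in> ?X \<longleftrightarrow> x \<in> B \<and> (if ?t x \<in> \<int> then Suc (?n x) else ?n x) < k" for x
      unfolding few_on_grid_def mem_Collect_eq card_insert ..
    have A_mem: "x \<in> ?A \<longleftrightarrow> x \<in> B \<and> ?t x \<notin> \<int> \<and> ?n x < k" for x
      by (auto simp: few_on_grid_def)
    have B_mem: "x \<in> ?B \<longleftrightarrow> x \<in> B \<and> ?t x + 1 / 2 \<notin> \<int> \<and> ?n x < k'" for x
      unfolding half by (auto simp: few_on_grid_def)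
    have A_eq: "?A = ?X \<inter> {x. ?t x \<notin> \<int>}"
    proof (rule Set.set_eqI)
      show "x \<in> ?A \<longleftrightarrow> x \<in> ?X \<inter> {x. ?t x \<notin> \<int>}" for x
        unfolding Int_iff mem_Collect_eq X_mem A_mem by auto
    qed
    have B_eq: "?B = ?X \<inter> (few_on_grid v s J k' UNIV \<inter> {x. ?t x + 1 / 2 \<notin> \<int>})"
    proof (rule Set.set_eqI)
      have "x \<in> few_on_grid v s J k' UNIV \<longleftrightarrow> ?n x < k'" for x
        by (simp add: few_on_grid_def)
      then show "x \<in> ?B \<longleftrightarrow> x \<in> ?X \<inter> (few_on_grid v s J k' UNIV \<inter> {x. ?t x + 1 / 2 \<notin> \<int>})" for x
        unfolding Int_iff mem_Collect_eq X_mem B_mem by (auto simp: Suc)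
    qed
    \<comment> \<open>off the grid and off the centres means off the grid of half the mesh\<close>
    have AB_eq: "?A \<inter> ?B = few_on_grid v s J k' (B \<inter> {x. (x \<bullet> b - v \<bullet> b) / (s / 2) \<notin> \<int>})"
      unfolding few_on_grid_def half double int_half by (auto simp: Suc)
    have open_notin: "open {x::'a. f x \<notin> \<int>}" if "continuous_on UNIV f" for f :: "'a \<Rightarrow> real"
    proof -
      have "open (f -` (- \<int>))"
        using that by (intro open_vimage) (simp_all add: closed_Ints open_Compl)
      then show ?thesis by (simp add: vimage_def)
    qed
    have "fillable G (Suc p') (2 * ?r) ?X"
    proof (rule fillable_Mayer_Vietoris)
      show "openin (top_of_set ?X) ?A"
        unfolding A_eq openin_open by (intro exI[of _ "{x. ?t x \<notin> \<int>}"] conjI open_notin continuous_intros refl)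
          (use \<open>0 < s\<close> in auto)
      show "openin (top_of_set ?X) ?B"
        unfolding B_eq openin_open
        by (intro exI[of _ "few_on_grid v s J k' UNIV \<inter> {x. ?t x + 1 / 2 \<notin> \<int>}"] conjI open_Int
            open_few_on_grid insert.hyps open_notin continuous_intros refl)
          (use \<open>0 < s\<close> in auto)
      show "?X = ?A \<union> ?B"
      proof -
        have "x \<in> ?B" if "x \<in> ?X" "?t x \<in> \<int>" for x
        proof -
          have "?t x + 1 / 2 \<notin> \<int>"
          proof
            assume "?t x + 1 / 2 \<in> \<int>"
            then have "(?t x + 1 / 2) - ?t x \<in> \<int>" using that(2) by (rule Ints_diff)
            then show False by simp
          qed
          then show ?thesis
            using that unfolding X_mem B_mem by (simp add: Suc)
        qed
        then show ?thesis unfolding A_eq B_eq by blast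
      qed
      show "fillable G (Suc p') ?r ?A"
        using slabs[of k "Suc p'" s "v \<bullet> b"] Suc p' \<open>0 < s\<close> by simp
      show "fillable G (Suc p') ?r ?B"
        using slabs[of k' "Suc p'" s "v \<bullet> b - s / 2"] p' \<open>0 < s\<close> by simp
      show "fillable G p' ?r (?A \<inter> ?B)"
        unfolding AB_eq using slabs[of k' p' "s / 2" "v \<bullet> b"] p' \<open>0 < s\<close> by simp
      show "0 \<le> ?r" using \<open>0 < s\<close> by simp
    qed
    then show ?thesis
      using insert.hyps p' by (simp add: mult.assoc)
  qed
qed

end

section \<open>Pushing small chains near a polyhedron into the polyhedron\<close>

lemma boundary_lin_extend': "boundary p (lin_extend \<phi> c) = lin_extend (\<lambda>\<sigma>. boundary p (\<phi> \<sigma>)) c"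
  by (subst boundary_lin_extend) (simp only: boundary_eq_chain_boundary)

lemma lin_extend_boundary:
  "lin_extend \<phi> (boundary p c) = lin_extend (\<lambda>\<sigma>. lin_extend \<phi> (boundary p (frag_of \<sigma>))) c"
proof -
  have "lin_extend \<phi> (boundary p (frag_of \<sigma>)) = frag_extend \<phi> (chain_boundary p (frag_of \<sigma>))" for \<sigma>
    by (simp only: lin_extend_int boundary_eq_chain_boundary)
  then show ?thesis
    by (simp only: boundary_eq_lin_extend[of p c] lin_extend_extend)
qed

definition starlike_about :: "'a::real_vector \<Rightarrow> 'a set \<Rightarrow> bool"
  where "starlike_about x S \<longleftrightarrow> x \<in> S \<and> (\<forall>y\<in>S. \<forall>a. 0 \<le> a \<longrightarrow> a \<le> 1 \<longrightarrow> a *\<^sub>R x + (1 - a) *\<^sub>R y \<in> S)"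

text \<open>
  A ball around \<open>x\<close> that misses the members of \<open>T\<close> to which \<open>x\<close> does not belong meets the union
  in convex sets all of which contain \<open>x\<close>.
\<close>

lemma starlike_ball_in_Union_convex:
  fixes T :: "'a::euclidean_space set set"
  assumes "finite T" "\<And>S. S \<in> T \<Longrightarrow> closed S" "\<And>S. S \<in> T \<Longrightarrow> convex S" "x \<in> \<Union>T" "0 < r"
  obtains \<rho> where "0 < \<rho>" "\<rho> \<le> r" "starlike_about x (\<Union>T \<inter> ball x \<rho>)"
proof -
  let ?F = "\<Union>{S \<in> T. x \<notin> S}"
  have "closed ?F" using assms by (intro closed_Union) auto
  then have "open (- ?F)" by (simp add: open_Compl)
  moreover have "x \<in> - ?F" by auto
  ultimately obtain e where e: "0 < e" "ball x e \<subseteq> - ?F"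
    unfolding open_contains_ball by blast
  show thesis
  proof (rule that[of "min e r"])
    show "starlike_about x (\<Union>T \<inter> ball x (min e r))"
      unfolding starlike_about_def
    proof (intro conjI ballI allI impI)
      show "x \<in> \<Union>T \<inter> ball x (min e r)" using assms e by auto
      fix y a assume y: "y \<in> \<Union>T \<inter> ball x (min e r)" and a: "0 \<le> a" "a \<le> (1::real)"
      then obtain S where S: "S \<in> T" "y \<in> S" by auto
      have "x \<in> S"
      proof (rule ccontr)
        assume "x \<notin> S"
        then have "y \<in> ?F" using S by auto
        then show False using y e(2) by auto
      qed
      then have "a *\<^sub>R x + (1 - a) *\<^sub>R y \<in> S"
        using assms(3)[OF S(1)] S a by (intro convexD) auto
      moreover have "a *\<^sub>R x + (1 - a) *\<^sub>R y \<in> ball x (min e r)"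
        using y a e assms(5) by (intro convexD[OF convex_ball]) auto
      ultimately show "a *\<^sub>R x + (1 - a) *\<^sub>R y \<in> \<Union>T \<inter> ball x (min e r)"
        using S by auto
    qed
  qed (use e assms in auto)
qed

text \<open>
  The property of \<open>\<Gamma>\<close> from which the retraction is built; it is a uniform form of local
  contractibility.
\<close>

definition uniformly_locally_starlike :: "'a::real_normed_vector set \<Rightarrow> bool"
  where "uniformly_locally_starlike \<Gamma> \<longleftrightarrow> (\<forall>r>0. \<exists>\<eta>>0. \<forall>x\<in>\<Gamma>. \<exists>y S. starlike_about y S \<and>
    \<Gamma> \<inter> ball x \<eta> \<subseteq> S \<and> S \<subseteq> \<Gamma> \<inter> ball x r)"

text \<open>
  A Lebesgue number of the cover by the starlike balls of the previous lemma.
\<close>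

lemma uniformly_locally_starlike_polyhedron:
  fixes T :: "'a::euclidean_space set set"
  assumes "finite T" "\<And>S. S \<in> T \<Longrightarrow> compact S" "\<And>S. S \<in> T \<Longrightarrow> convex S"
  shows "uniformly_locally_starlike (\<Union>T)"
  unfolding uniformly_locally_starlike_def
proof (intro allI impI)
  fix r :: real assume "0 < r"
  have "\<exists>\<rho>. 0 < \<rho> \<and> \<rho> \<le> r / 2 \<and> starlike_about x (\<Union>T \<inter> ball x \<rho>)" if "x \<in> \<Union>T" for x
    by (rule starlike_ball_in_Union_convex[of T x "r / 2"])
      (use assms \<open>0 < r\<close> that compact_imp_closed in auto)
  then obtain \<rho> where \<rho>: "\<And>x. x \<in> \<Union>T \<Longrightarrow> 0 < \<rho> x" "\<And>x. x \<in> \<Union>T \<Longrightarrow> \<rho> x \<le> r / 2"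
      "\<And>x. x \<in> \<Union>T \<Longrightarrow> starlike_about x (\<Union>T \<inter> ball x (\<rho> x))"
    by metis
  have "compact (\<Union>T)" using assms by (intro compact_Union) auto
  moreover have "\<Union>T \<subseteq> \<Union>((\<lambda>x. ball x (\<rho> x)) ` \<Union>T)" using \<rho>(1) by force
  ultimately obtain e where e: "0 < e" "\<And>x. x \<in> \<Union>T \<Longrightarrow> \<exists>G \<in> (\<lambda>x. ball x (\<rho> x)) ` \<Union>T. ball x e \<subseteq> G"
    by (rule Heine_Borel_lemma) auto
  show "\<exists>\<eta>>0. \<forall>x\<in>\<Union>T. \<exists>y S. starlike_about y S \<and> \<Union>T \<inter> ball x \<eta> \<subseteq> S \<and> S \<subseteq> \<Union>T \<inter> ball x r"
  proof (intro exI[of _ e] conjI ballI e(1))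
    fix x assume x: "x \<in> \<Union>T"
    then obtain y where y: "y \<in> \<Union>T" "ball x e \<subseteq> ball y (\<rho> y)" using e(2) by blast
    have "x \<in> ball y (\<rho> y)" using y(2) e(1) centre_in_ball[of x e] by blast
    then have xy: "dist y x < \<rho> y" by simp
    have "ball y (\<rho> y) \<subseteq> ball x r"
    proof
      fix w assume "w \<in> ball y (\<rho> y)"
      then have "dist x w < \<rho> y + \<rho> y"
        using xy dist_triangle2[of x w y] by (simp add: dist_commute)
      then show "w \<in> ball x r" using \<rho>(2)[OF y(1)] by simp
    qed
    then show "\<exists>y S. starlike_about y S \<and> \<Union>T \<inter> ball x e \<subseteq> S \<and> S \<subseteq> \<Union>T \<inter> ball x r"
      using \<rho>(3)[OF y(1)] y(2) by (intro exI[of _ y] exI[of _ "\<Union>T \<inter> ball y (\<rho> y)"]) auto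
  qed
qed

lemma zero_simplex_eq_point_simplex:
  assumes "\<sigma> \<in> extensional (standard_simplex 0)"
  obtains y where "\<sigma> = point_simplex y"
proof
  show "\<sigma> = point_simplex (\<sigma> (\<lambda>j. if j = 0 then 1 else 0))"
  proof
    fix t
    show "\<sigma> t = point_simplex (\<sigma> (\<lambda>j. if j = 0 then 1 else 0)) t"
    proof (cases "t \<in> standard_simplex 0")
      case True
      then have "t = (\<lambda>j. if j = 0 then 1 else 0)" by (simp add: standard_simplex_0)
      then have "\<sigma> t = \<sigma> (\<lambda>j. if j = 0 then 1 else 0)" by (rule arg_cong)
      then show ?thesis using True by (simp add: point_simplex_def)
    next
      case False
      then show ?thesis using extensional_arb[OF assms False] by (simp add: point_simplex_def)
    qed
  qed
qed

context o_minimal_field_expansion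
begin

text \<open>
  The substitute in dimension zero for \<open>cycle_bounds_by_coning\<close>: the two points are joined through
  the centre.
\<close>

lemma point_difference_bounds:
  assumes "starlike_about x S" "y \<in> S" "z \<in> S"
  obtains d :: "'a::euclidean_space chain" where "dchain (Suc 0) S d"
    "boundary (Suc 0) d = frag_of (point_simplex y) - frag_of (point_simplex z)"
proof -
  have *: "dchain (Suc 0) S (frag_of (cone_simplex 0 x (point_simplex w)))"
    "boundary (Suc 0) (frag_of (cone_simplex 0 x (point_simplex w))) = frag_of (point_simplex w) - frag_of (point_simplex x)"
    if "w \<in> S" for w
  proof -
    have "dsimplex 0 UNIV (point_simplex w)" by (rule dsimplex_point) simp
    then show "dchain (Suc 0) S (frag_of (cone_simplex 0 x (point_simplex w)))"
      unfolding dchain_frag_of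
      by (rule dsimplex_cone) (use assms(1) that in \<open>auto simp: starlike_about_def point_simplex_def\<close>)
    show "boundary (Suc 0) (frag_of (cone_simplex 0 x (point_simplex w))) = frag_of (point_simplex w) - frag_of (point_simplex x)"
      unfolding boundary_eq_chain_boundary by (rule chain_boundary_cone_0) (simp add: point_simplex_def)
  qed
  show thesis
  proof (rule that)
    show "dchain (Suc 0) S (frag_of (cone_simplex 0 x (point_simplex y)) - frag_of (cone_simplex 0 x (point_simplex z)))"
      using assms by (intro dchain_diff *)
    show "boundary (Suc 0) (frag_of (cone_simplex 0 x (point_simplex y)) - frag_of (cone_simplex 0 x (point_simplex z)))
        = frag_of (point_simplex y) - frag_of (point_simplex z)"
      by (simp only: boundary_diff *[OF assms(2)] *[OF assms(3)]) (rule diff_diff_eq2[THEN trans], simp)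
  qed
qed

text \<open>
  A chain map on the simplices that lie in a small ball around a point of \<open>\<Gamma>\<close>, in dimensions up
  to \<open>P\<close>, with values in \<open>\<Gamma>\<close>. Being the identity on simplices in \<open>\<Gamma>\<close>, it plays the role of a
  retraction of a neighbourhood onto \<open>\<Gamma>\<close>. The condition in dimension zero ensures that the
  boundary of a \<open>1\<close>-simplex goes to the difference of two points, which can be joined by a path.
\<close>

definition small_chain_retraction ::
    "nat \<Rightarrow> 'a::euclidean_space set \<Rightarrow> real \<Rightarrow> real \<Rightarrow> (nat \<Rightarrow> ((nat \<Rightarrow> real) \<Rightarrow> 'a) \<Rightarrow> 'a chain) \<Rightarrow> bool"
  where "small_chain_retraction P \<Gamma> \<delta> r \<rho> \<longleftrightarrow>
    (\<forall>p \<sigma> x. p \<le> P \<longrightarrow> dsimplex p UNIV \<sigma> \<longrightarrow> x \<in> \<Gamma> \<longrightarrow> \<sigma> ` standard_simplex p \<subseteq> ball x \<delta> \<longrightarrow>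
      dchain p (\<Gamma> \<inter> ball x r) (\<rho> p \<sigma>) \<and>
      (\<sigma> ` standard_simplex p \<subseteq> \<Gamma> \<longrightarrow> \<rho> p \<sigma> = frag_of \<sigma>) \<and>
      boundary p (\<rho> p \<sigma>) = lin_extend (\<rho> (p - 1)) (boundary p (frag_of \<sigma>)) \<and>
      (p = 0 \<longrightarrow> (\<exists>y. \<rho> 0 \<sigma> = frag_of (point_simplex y))))"

lemma small_chain_retraction_0:
  fixes \<Gamma> :: "'a::euclidean_space set"
  assumes "0 < r"
  shows "\<exists>\<rho>. small_chain_retraction 0 \<Gamma> (r / 2) r \<rho>"
proof -
  define c where "c \<sigma> = (SOME x. x \<in> \<Gamma> \<and> \<sigma> ` standard_simplex 0 \<subseteq> ball x (r / 2))" for \<sigma> :: "(nat \<Rightarrow> real) \<Rightarrow> 'a"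
  define \<rho> where "\<rho> p \<sigma> = (if \<sigma> ` standard_simplex 0 \<subseteq> \<Gamma> then frag_of \<sigma> else frag_of (point_simplex (c \<sigma>)))"
    for p :: nat and \<sigma> :: "(nat \<Rightarrow> real) \<Rightarrow> 'a"
  have "small_chain_retraction 0 \<Gamma> (r / 2) r \<rho>"
    unfolding small_chain_retraction_def
  proof (intro allI impI)
    fix p \<sigma> x assume p: "p \<le> (0::nat)" and \<sigma>: "dsimplex p UNIV \<sigma>" and x: "x \<in> \<Gamma>" "\<sigma> ` standard_simplex p \<subseteq> ball x (r / 2)"
    then have p0: "p = 0" by simp
    have c: "c \<sigma> \<in> \<Gamma> \<and> \<sigma> ` standard_simplex 0 \<subseteq> ball (c \<sigma>) (r / 2)"
      unfolding c_def by (rule someI[of _ x]) (use x p0 in auto)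
    obtain t where t: "t \<in> standard_simplex 0" using nonempty_standard_simplex[of 0] by auto
    have "dist x (\<sigma> t) < r / 2" "dist (c \<sigma>) (\<sigma> t) < r / 2"
      using c x t p0 by auto
    then have cx: "c \<sigma> \<in> ball x r"
      using dist_triangle2[of x "c \<sigma>" "\<sigma> t"] by simp
    have "dchain 0 (\<Gamma> \<inter> ball x r) (\<rho> 0 \<sigma>)"
    proof (cases "\<sigma> ` standard_simplex 0 \<subseteq> \<Gamma>")
      case True
      moreover have "ball x (r / 2) \<subseteq> ball x r" using assms by auto
      ultimately have "dsimplex 0 (\<Gamma> \<inter> ball x r) \<sigma>"
        using \<sigma> x p0 dsimplex_iff[of 0 "\<Gamma> \<inter> ball x r" \<sigma>] by blast
      then show ?thesis using True by (simp add: \<rho>_def dchain_frag_of)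
    next
      case False
      then show ?thesis
        using c cx by (simp add: \<rho>_def dchain_frag_of dsimplex_point)
    qed
    moreover obtain y where "\<sigma> = point_simplex y"
      using zero_simplex_eq_point_simplex dsimplex_singular(2)[OF \<sigma>] p0 by blast
    ultimately show "dchain p (\<Gamma> \<inter> ball x r) (\<rho> p \<sigma>) \<and>
      (\<sigma> ` standard_simplex p \<subseteq> \<Gamma> \<longrightarrow> \<rho> p \<sigma> = frag_of \<sigma>) \<and>
      boundary p (\<rho> p \<sigma>) = lin_extend (\<rho> (p - 1)) (boundary p (frag_of \<sigma>)) \<and>
      (p = 0 \<longrightarrow> (\<exists>y. \<rho> 0 \<sigma> = frag_of (point_simplex y)))"
      unfolding p0 by (auto simp: \<rho>_def boundary_def)
  qed
  then show ?thesis by blast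
qed

lemma face_image: "k \<le> Suc p \<Longrightarrow> singular_face (Suc p) k \<sigma> ` standard_simplex p \<subseteq> \<sigma> ` standard_simplex (Suc p)"
  using simplical_face_in_standard_simplex[of "Suc p" k] by (auto simp: singular_face_def)

lemma small_chain_retractionD:
  assumes "small_chain_retraction P \<Gamma> \<delta> r \<rho>" "p \<le> P" "dsimplex p UNIV \<sigma>" "x \<in> \<Gamma>" "\<sigma> ` standard_simplex p \<subseteq> ball x \<delta>"
  shows "dchain p (\<Gamma> \<inter> ball x r) (\<rho> p \<sigma>)"
    "\<sigma> ` standard_simplex p \<subseteq> \<Gamma> \<Longrightarrow> \<rho> p \<sigma> = frag_of \<sigma>"
    "boundary p (\<rho> p \<sigma>) = lin_extend (\<rho> (p - 1)) (boundary p (frag_of \<sigma>))"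
    "p = 0 \<Longrightarrow> \<exists>y. \<rho> 0 \<sigma> = frag_of (point_simplex y)"
  using assms unfolding small_chain_retraction_def by blast+

lemma boundary_frag_of_keys:
  assumes "dsimplex (Suc p) UNIV \<sigma>" "\<tau> \<in> Poly_Mapping.keys (boundary (Suc p) (frag_of \<sigma>))"
  shows "dsimplex p UNIV \<tau>" "\<tau> ` standard_simplex p \<subseteq> \<sigma> ` standard_simplex (Suc p)"
proof -
  obtain k where k: "k \<le> Suc p" "\<tau> = singular_face (Suc p) k \<sigma>"
    using assms(2) keys_chain_boundary[of p \<sigma>] unfolding boundary_eq_chain_boundary by auto
  then show "dsimplex p UNIV \<tau>" "\<tau> ` standard_simplex p \<subseteq> \<sigma> ` standard_simplex (Suc p)"
    using dsimplex_face[OF assms(1)] face_image[of k p \<sigma>] by auto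
qed

text \<open>
  Prescribing the values on the boundary, the extension to the next dimension amounts to filling a
  small cycle, which is done by a cone in a starlike subset of \<open>\<Gamma>\<close>.
\<close>

lemma fill_retracted_boundary:
  fixes \<Gamma> :: "'a::euclidean_space set"
  assumes \<rho>: "small_chain_retraction P \<Gamma> \<delta> r \<rho>"
    and \<sigma>: "dsimplex (Suc P) UNIV \<sigma>" and x: "x \<in> \<Gamma>" "\<sigma> ` standard_simplex (Suc P) \<subseteq> ball x \<delta>"
    and S: "starlike_about y S" "\<Gamma> \<inter> ball x r \<subseteq> S"
  shows "\<exists>c. dchain (Suc P) S c \<and> boundary (Suc P) c = lin_extend (\<rho> P) (boundary (Suc P) (frag_of \<sigma>))"
proof -
  let ?b = "boundary (Suc P) (frag_of \<sigma>)"
  have face: "dsimplex P UNIV \<tau>" "\<tau> ` standard_simplex P \<subseteq> ball x \<delta>" if "\<tau> \<in> Poly_Mapping.keys ?b" for \<tau>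
    using boundary_frag_of_keys[OF \<sigma> that] x(2) by auto
  note retr = small_chain_retractionD[OF \<rho> order_refl face(1) x(1) face(2)]
  have b: "dchain P UNIV ?b"
    by (rule dchain_boundary) (simp add: dchain_frag_of \<sigma>)
  have rb: "dchain P S (lin_extend (\<rho> P) ?b)"
    using b by (rule dchain_lin_extend) (rule dchain_mono[OF retr(1) S(2)])
  show ?thesis
  proof (cases P)
    case (Suc q)
    have "boundary P (lin_extend (\<rho> P) ?b) = lin_extend (\<lambda>\<tau>. boundary P (\<rho> P \<tau>)) ?b"
      by (rule boundary_lin_extend')
    also have "\<dots> = lin_extend (\<lambda>\<tau>. lin_extend (\<rho> q) (boundary P (frag_of \<tau>))) ?b"
      by (rule lin_extend_cong) (use retr(3) Suc in simp)
    also have "\<dots> = lin_extend (\<rho> q) (boundary P ?b)"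
      by (rule lin_extend_boundary[symmetric])
    also have "boundary P ?b = 0"
      by (rule boundary_boundary[of P UNIV]) (simp add: dchain_frag_of \<sigma>)
    finally have "boundary (Suc q) (lin_extend (\<rho> P) ?b) = 0" using Suc by simp
    then obtain c where "dchain (Suc (Suc q)) S c" "boundary (Suc (Suc q)) c = lin_extend (\<rho> P) ?b"
      using cycle_bounds_by_coning[of q S "lin_extend (\<rho> P) ?b" y S] rb S(1) Suc
      unfolding starlike_about_def by blast
    then show ?thesis using Suc by blast
  next
    case 0
    let ?f = "\<lambda>k. singular_face (Suc 0) k \<sigma>"
    have f: "dsimplex 0 UNIV (?f k)" "?f k ` standard_simplex 0 \<subseteq> ball x \<delta>" if "k \<le> Suc 0" for k
      using dsimplex_face[of 0 UNIV \<sigma> k] face_image[of k 0 \<sigma>] that \<sigma> x(2) 0 by auto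
    have "\<exists>y. \<rho> 0 (?f k) = frag_of (point_simplex y) \<and> y \<in> S" if k: "k \<le> Suc 0" for k
    proof -
      obtain y where y: "\<rho> 0 (?f k) = frag_of (point_simplex y)"
        using small_chain_retractionD(4)[OF \<rho> _ f(1)[OF k] x(1) f(2)[OF k]] 0 by auto
      have "dchain 0 S (\<rho> 0 (?f k))"
        using small_chain_retractionD(1)[OF \<rho> _ f(1)[OF k] x(1) f(2)[OF k]] S(2) by (auto intro: dchain_mono)
      then have "supp 0 (frag_of (point_simplex y) :: 'a chain) \<subseteq> S"
        unfolding y by (rule supp_subset)
      then have "y \<in> S"
        by (simp add: supp_def point_simplex_def image_constant_conv nonempty_standard_simplex)
      then show ?thesis using y by blast
    qed
    then obtain w where w: "\<And>k. k \<le> Suc 0 \<Longrightarrow> \<rho> 0 (?f k) = frag_of (point_simplex (w k))" "\<And>k. k \<le> Suc 0 \<Longrightarrow> w k \<in> S"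
      by metis
    have "?b = (\<Sum>k\<le>Suc 0. frag_cmul ((- 1) ^ k) (frag_of (?f k)))"
      unfolding boundary_eq_chain_boundary 0 by (simp only: chain_boundary_of nat.simps if_False)
    also have "\<dots> = frag_of (?f 0) - frag_of (?f (Suc 0))"
      by (simp only: sum.atMost_Suc atMost_0 sum.insert finite.emptyI empty_iff not_False_eq_True sum.empty
          power_0 power_Suc mult_1_right add_0_right frag_cmul_one frag_cmul_minus_one diff_conv_add_uminus)
    finally have "lin_extend (\<rho> P) ?b = \<rho> 0 (?f 0) - \<rho> 0 (?f (Suc 0))"
      using 0 by (simp only: lin_extend_int frag_extend_diff frag_extend_of)
    then have "lin_extend (\<rho> P) ?b = frag_of (point_simplex (w 0)) - frag_of (point_simplex (w (Suc 0)))"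
      using w(1)[of 0] w(1)[of "Suc 0"] by (simp only: le0 order_refl)
    then show ?thesis
      using point_difference_bounds[OF S(1) w(2)[of 0] w(2)[of "Suc 0"]] 0 by (metis le0 order_refl)
  qed
qed

lemma small_chain_retraction_exists:
  fixes \<Gamma> :: "'a::euclidean_space set"
  assumes \<Gamma>: "uniformly_locally_starlike \<Gamma>"
  shows "0 < r \<Longrightarrow> \<exists>\<delta>>0. \<exists>\<rho>. small_chain_retraction P \<Gamma> \<delta> r \<rho>"
proof (induction P arbitrary: r)
  case 0
  then show ?case using small_chain_retraction_0[of r \<Gamma>] by (intro exI[of _ "r / 2"]) auto
next
  case (Suc P)
  obtain \<eta> where \<eta>: "0 < \<eta>" "\<And>x. x \<in> \<Gamma> \<Longrightarrow> \<exists>y S. starlike_about y S \<and> \<Gamma> \<inter> ball x \<eta> \<subseteq> S \<and> S \<subseteq> \<Gamma> \<inter> ball x (r / 2)"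
    using \<Gamma> Suc.prems unfolding uniformly_locally_starlike_def by (metis half_gt_zero)
  let ?r = "min \<eta> r"
  obtain \<delta>' \<rho> where \<delta>': "0 < \<delta>'" and \<rho>: "small_chain_retraction P \<Gamma> \<delta>' ?r \<rho>"
    using Suc.IH[of ?r] \<eta>(1) Suc.prems by auto
  define \<delta> where "\<delta> = min \<delta>' (r / 4)"
  have \<delta>: "0 < \<delta>" "\<delta> \<le> \<delta>'" "\<delta> \<le> r / 4" using \<delta>' Suc.prems by (auto simp: \<delta>_def)
  let ?small = "\<lambda>\<sigma> x. x \<in> \<Gamma> \<and> \<sigma> ` standard_simplex (Suc P) \<subseteq> ball x \<delta>"
  let ?fills = "\<lambda>\<sigma> x c. dchain (Suc P) (\<Gamma> \<inter> ball x (r / 2)) c \<and>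
      boundary (Suc P) c = lin_extend (\<rho> P) (boundary (Suc P) (frag_of \<sigma>))"
  have fill: "\<exists>c. \<exists>x. ?small \<sigma> x \<and> ?fills \<sigma> x c" if \<sigma>: "dsimplex (Suc P) UNIV \<sigma>" "?small \<sigma> x" for \<sigma> x
  proof -
    obtain y S where S: "starlike_about y S" "\<Gamma> \<inter> ball x \<eta> \<subseteq> S" "S \<subseteq> \<Gamma> \<inter> ball x (r / 2)"
      using \<eta>(2)[of x] \<sigma>(2) by blast
    have "\<Gamma> \<inter> ball x ?r \<subseteq> S" using S(2) by auto
    moreover have "\<sigma> ` standard_simplex (Suc P) \<subseteq> ball x \<delta>'"
      using \<sigma>(2) subset_ball[OF \<delta>(2), of x] by auto
    ultimately obtain c where "dchain (Suc P) S c" "boundary (Suc P) c = lin_extend (\<rho> P) (boundary (Suc P) (frag_of \<sigma>))"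
      using fill_retracted_boundary[OF \<rho> \<sigma>(1) _ _ S(1), of x] \<sigma>(2) by blast
    then show ?thesis using \<sigma>(2) dchain_mono[OF _ S(3)] by blast
  qed
  define f where "f \<sigma> = (SOME c. \<exists>x. ?small \<sigma> x \<and> ?fills \<sigma> x c)" for \<sigma>
  have f: "\<exists>x. ?small \<sigma> x \<and> ?fills \<sigma> x (f \<sigma>)" if "dsimplex (Suc P) UNIV \<sigma>" "?small \<sigma> x" for \<sigma> x
    unfolding f_def by (rule someI_ex[OF fill[OF that]])
  define \<rho>' where "\<rho>' = \<rho>(Suc P := \<lambda>\<sigma>. if \<sigma> ` standard_simplex (Suc P) \<subseteq> \<Gamma> then frag_of \<sigma> else f \<sigma>)"
  have "small_chain_retraction (Suc P) \<Gamma> \<delta> r \<rho>'"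
    unfolding small_chain_retraction_def
  proof (intro allI impI)
    fix p \<sigma> x assume p: "p \<le> Suc P" and \<sigma>: "dsimplex p UNIV \<sigma>" and x: "x \<in> \<Gamma>" "\<sigma> ` standard_simplex p \<subseteq> ball x \<delta>"
    have x': "\<sigma> ` standard_simplex p \<subseteq> ball x \<delta>'"
      using x(2) subset_ball[OF \<delta>(2), of x] by auto
    show "dchain p (\<Gamma> \<inter> ball x r) (\<rho>' p \<sigma>) \<and>
      (\<sigma> ` standard_simplex p \<subseteq> \<Gamma> \<longrightarrow> \<rho>' p \<sigma> = frag_of \<sigma>) \<and>
      boundary p (\<rho>' p \<sigma>) = lin_extend (\<rho>' (p - 1)) (boundary p (frag_of \<sigma>)) \<and>
      (p = 0 \<longrightarrow> (\<exists>y. \<rho>' 0 \<sigma> = frag_of (point_simplex y)))"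
    proof (cases "p \<le> P")
      case True
      have "\<Gamma> \<inter> ball x ?r \<subseteq> \<Gamma> \<inter> ball x r" by auto
      then show ?thesis
        using small_chain_retractionD[OF \<rho> True \<sigma> x(1) x'] True
        by (auto simp: \<rho>'_def intro: dchain_mono)
    next
      case False
      then have p: "p = Suc P" using \<open>p \<le> Suc P\<close> by simp
      note \<sigma> = \<sigma>[unfolded p] and x = x[unfolded p]
      show ?thesis
      proof (cases "\<sigma> ` standard_simplex (Suc P) \<subseteq> \<Gamma>")
        case True
        have "ball x \<delta> \<subseteq> ball x r" using \<delta>(3) Suc.prems by (intro subset_ball) simp
        then have "dsimplex (Suc P) (\<Gamma> \<inter> ball x r) \<sigma>"
          using dsimplex_iff[of "Suc P" "\<Gamma> \<inter> ball x r" \<sigma>] \<sigma> x True by blast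
        moreover have "lin_extend (\<rho> P) (boundary (Suc P) (frag_of \<sigma>)) = lin_extend frag_of (boundary (Suc P) (frag_of \<sigma>))"
        proof (rule lin_extend_cong)
          fix \<tau> assume "\<tau> \<in> Poly_Mapping.keys (boundary (Suc P) (frag_of \<sigma> :: 'a chain))"
          note \<tau> = boundary_frag_of_keys[OF \<sigma> this]
          show "\<rho> P \<tau> = frag_of \<tau>"
            by (rule small_chain_retractionD(2)[OF \<rho> order_refl \<tau>(1) x(1)]) (use \<tau>(2) x' p True in auto)
        qed
        ultimately show ?thesis
          using True p by (simp add: \<rho>'_def dchain_frag_of)
      next
        case False
        obtain x1 where x1: "?small \<sigma> x1" "?fills \<sigma> x1 (f \<sigma>)" using f[OF \<sigma>, of x] x by blast
        obtain t where t: "t \<in> standard_simplex (Suc P)" using nonempty_standard_simplex[of "Suc P"] by auto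
        have "dist x (\<sigma> t) < \<delta>" "dist x1 (\<sigma> t) < \<delta>"
          using x1(1) x(2) t by auto
        \<comment> \<open>the chain \<open>f \<sigma>\<close> was chosen near some centre \<open>x1\<close>, which may differ from \<open>x\<close>\<close>
        then have xx: "dist x x1 < r / 2"
          using dist_triangle2[of x x1 "\<sigma> t"] \<delta>(3) by linarith
        have "ball x1 (r / 2) \<subseteq> ball x r"
        proof
          fix w assume "w \<in> ball x1 (r / 2)"
          then show "w \<in> ball x r" using xx dist_triangle[of x w x1] by simp
        qed
        then have "dchain (Suc P) (\<Gamma> \<inter> ball x r) (f \<sigma>)"
          using x1(2) dchain_mono[of "Suc P" "\<Gamma> \<inter> ball x1 (r / 2)" "f \<sigma>" "\<Gamma> \<inter> ball x r"] by blast
        then show ?thesis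
          using False p x1(2) by (simp add: \<rho>'_def)
      qed
    qed
  qed
  then show ?case using \<delta>(1) by blast
qed

text \<open>
  The chain is subdivided until its simplices are small and then retracted. The retraction leaves
  the subdivided boundary in \<open>\<Gamma>\<close> unchanged, and this is homologous in \<open>\<Gamma>\<close> to the boundary itself.
\<close>

lemma boundary_near_imp_boundary_in:
  fixes \<Gamma> :: "'a::euclidean_space set"
  assumes \<Gamma>: "uniformly_locally_starlike \<Gamma>"
  obtains \<delta> where "0 < \<delta>" "\<And>d :: ('a, 'g::ab_group_add) gchain. dchain (Suc k) (\<Union>x\<in>\<Gamma>. ball x \<delta>) d \<Longrightarrow>
    dchain k \<Gamma> (boundary (Suc k) d) \<Longrightarrow> bounds D k \<Gamma> (boundary (Suc k) d)"
proof -
  obtain \<delta> \<rho> where \<delta>: "0 < \<delta>" and \<rho>: "small_chain_retraction (Suc k) \<Gamma> \<delta> 1 \<rho>"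
    using small_chain_retraction_exists[OF \<Gamma>, of 1 "Suc k"] by auto
  have "bounds D k \<Gamma> (boundary (Suc k) d)"
    if d: "dchain (Suc k) (\<Union>x\<in>\<Gamma>. ball x \<delta>) d" and z: "dchain k \<Gamma> (boundary (Suc k) d)"
    for d :: "('a, 'g) gchain"
  proof -
    let ?z = "boundary (Suc k) d"
    obtain n where n: "\<And>\<sigma>. \<sigma> \<in> Poly_Mapping.keys ((subdivide (Suc k) ^^ n) d) \<Longrightarrow>
        \<exists>U\<in>(\<lambda>x. ball x \<delta>) ` \<Gamma>. \<sigma> ` standard_simplex (Suc k) \<subseteq> U"
    proof (rule subdivide_iter_small[OF d])
      show "openin (top_of_set (\<Union>x\<in>\<Gamma>. ball x \<delta>)) U" if "U \<in> (\<lambda>x. ball x \<delta>) ` \<Gamma>" for U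
        using that by (intro open_subset) auto
    qed auto
    let ?d = "(subdivide (Suc k) ^^ n) d"
    have d': "dchain (Suc k) UNIV ?d"
      by (rule dchain_UNIV[OF dchain_subdivide_iter[OF d]])
    have bd: "boundary (Suc k) ?d = (subdivide k ^^ n) ?z"
      by (rule boundary_subdivide_iter[OF d])
    have zn: "dchain k \<Gamma> ((subdivide k ^^ n) ?z)"
      by (rule dchain_subdivide_iter[OF z])
    have \<sigma>: "\<exists>x\<in>\<Gamma>. \<sigma> ` standard_simplex (Suc k) \<subseteq> ball x \<delta>" "dsimplex (Suc k) UNIV \<sigma>"
      if "\<sigma> \<in> Poly_Mapping.keys ?d" for \<sigma>
      using n[OF that] d' that by (auto simp: definable_chain_def)
    let ?d' = "lin_extend (\<rho> (Suc k)) ?d"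
    have "dchain (Suc k) \<Gamma> ?d'"
      using d'
    proof (rule dchain_lin_extend)
      fix \<sigma> assume *: "\<sigma> \<in> Poly_Mapping.keys ?d"
      obtain x where "x \<in> \<Gamma>" "\<sigma> ` standard_simplex (Suc k) \<subseteq> ball x \<delta>" using \<sigma>(1)[OF *] by blast
      from small_chain_retractionD(1)[OF \<rho> order_refl \<sigma>(2)[OF *] this]
      show "dchain (Suc k) \<Gamma> (\<rho> (Suc k) \<sigma>)" by (rule dchain_mono) simp
    qed
    moreover have "boundary (Suc k) ?d' = (subdivide k ^^ n) ?z"
    proof -
      have "boundary (Suc k) ?d' = lin_extend (\<lambda>\<sigma>. boundary (Suc k) (\<rho> (Suc k) \<sigma>)) ?d"
        by (rule boundary_lin_extend')
      also have "\<dots> = lin_extend (\<lambda>\<sigma>. lin_extend (\<rho> k) (boundary (Suc k) (frag_of \<sigma>))) ?d"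
      proof (rule lin_extend_cong)
        fix \<sigma> assume *: "\<sigma> \<in> Poly_Mapping.keys ?d"
        obtain x where "x \<in> \<Gamma>" "\<sigma> ` standard_simplex (Suc k) \<subseteq> ball x \<delta>" using \<sigma>(1)[OF *] by blast
        from small_chain_retractionD(3)[OF \<rho> order_refl \<sigma>(2)[OF *] this]
        show "boundary (Suc k) (\<rho> (Suc k) \<sigma>) = lin_extend (\<rho> k) (boundary (Suc k) (frag_of \<sigma>))" by simp
      qed
      also have "\<dots> = lin_extend (\<rho> k) (boundary (Suc k) ?d)"
        by (rule lin_extend_boundary[symmetric])
      also have "\<dots> = lin_extend frag_of (boundary (Suc k) ?d)"
      proof (rule lin_extend_cong)
        fix \<tau> assume \<tau>: "\<tau> \<in> Poly_Mapping.keys (boundary (Suc k) ?d)"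
        then obtain \<sigma> where s: "\<sigma> \<in> Poly_Mapping.keys ?d" "\<tau> \<in> Poly_Mapping.keys (boundary (Suc k) (frag_of \<sigma>))"
          using keys_lin_extend[of "\<lambda>\<sigma>. chain_boundary (Suc k) (frag_of \<sigma>)" ?d]
          unfolding boundary_eq_lin_extend[of "Suc k" ?d] boundary_eq_chain_boundary by auto
        obtain x where x: "x \<in> \<Gamma>" "\<sigma> ` standard_simplex (Suc k) \<subseteq> ball x \<delta>" using \<sigma>(1)[OF s(1)] by blast
        note face = boundary_frag_of_keys[OF \<sigma>(2)[OF s(1)] s(2)]
        have "dsimplex k \<Gamma> \<tau>"
          using zn \<tau> unfolding bd definable_chain_def by blast
        then have "\<tau> ` standard_simplex k \<subseteq> \<Gamma>" using dsimplex_iff[of k \<Gamma> \<tau>] by simp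
        moreover have "\<tau> ` standard_simplex k \<subseteq> ball x \<delta>" using face(2) x(2) by auto
        ultimately show "\<rho> k \<tau> = frag_of \<tau>"
          using small_chain_retractionD(2)[OF \<rho> _ face(1) x(1)] by simp
      qed
      finally show ?thesis by (simp add: bd)
    qed
    moreover obtain e where "dchain (Suc k) \<Gamma> e" "boundary (Suc k) e = (subdivide k ^^ n) ?z - ?z"
      using cycle_subdivide_iter_homologous[OF z boundary_boundary[OF d]] by blast
    ultimately have "dchain (Suc k) \<Gamma> (?d' - e)" "boundary (Suc k) (?d' - e) = ?z"
      by (auto intro: dchain_diff simp: boundary_diff)
    then show ?thesis unfolding bounds_def by blast
  qed
  then show thesis using that \<delta> by blast
qed

end

section \<open>Sets of small volume and translates of a grid\<close>

lemma vol_less_cover: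
  assumes "vol k A < ennreal \<epsilon>"
  obtains U :: "nat \<Rightarrow> 'a::metric_space set" where "A \<subseteq> (\<Union>i. U i)" "\<And>i. bounded (U i)"
    "suminf (\<lambda>i. ennreal (diam_vol k (U i))) < ennreal \<epsilon>"
proof -
  let ?C = "\<lambda>\<delta>. {U :: nat \<Rightarrow> 'a set. A \<subseteq> (\<Union>i. U i) \<and> (\<forall>i. bounded (U i) \<and> diameter (U i) \<le> \<delta>)}"
  let ?I = "\<lambda>\<delta>. INF U \<in> ?C \<delta>. suminf (\<lambda>i. ennreal (diam_vol k (U i)))"
  have "?I 1 \<le> vol k A"
    unfolding vol_def by (intro SUP_upper) simp
  then have "?I 1 < ennreal \<epsilon>"
    using assms by (rule le_less_trans)
  then show thesis
    unfolding INF_less_iff using that by blast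
qed

text \<open>
  For each set \<open>J\<close> of \<open>k\<close> coordinates, the translations \<open>v\<close> of the grid for which a point of \<open>A\<close>
  has its coordinates in \<open>J\<close> on the grid form, up to multiples of the mesh, the product of the
  projection of \<open>A\<close> to these coordinates with a cube in the others. Its measure is at most a
  constant times the \<open>k\<close>-volume of \<open>A\<close>; so if the latter is small, not every \<open>v\<close> is excluded.
\<close>

lemma small_volume_misses_grid_skeleton:
  fixes s R :: real
  assumes s: "0 < s"
  obtains \<epsilon> where "0 < \<epsilon>" "\<And>A :: 'a::euclidean_space set. (\<And>x b. x \<in> A \<Longrightarrow> b \<in> Basis \<Longrightarrow> \<bar>x \<bullet> b\<bar> \<le> R) \<Longrightarrow>
    vol k A < ennreal \<epsilon> \<Longrightarrow> \<exists>v. A \<subseteq> few_on_grid v s Basis k UNIV"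
proof -
  let ?N = "DIM('a)"
  \<comment> \<open>a bound for the integers \<open>(x \<bullet> b - v \<bullet> b) / s\<close> when \<open>v\<close> lies in the cube with side \<open>s\<close> at the origin\<close>
  define M where "M = \<lceil>(R + s) / s\<rceil>"
  define F where "F = (SIGMA J : {J. J \<subseteq> (Basis :: 'a set) \<and> card J = k}. PiE J (\<lambda>_. {- M .. M}))"
  have F: "finite F"
    unfolding F_def
  proof (rule finite_SigmaI)
    show "finite {J. J \<subseteq> (Basis :: 'a set) \<and> card J = k}"
      by (rule finite_subset[of _ "Pow Basis"]) auto
    fix J assume "J \<in> {J. J \<subseteq> (Basis :: 'a set) \<and> card J = k}"
    then have "finite J" using finite_subset[of J Basis] by simp
    then show "finite (PiE J (\<lambda>_. {- M .. M}))" by (intro finite_PiE) auto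
  qed
  have ball_vol: "unit_ball_vol (real k) > 0" by (rule unit_ball_vol_pos) simp
  \<comment> \<open>a covering set of diameter \<open>d\<close> excludes at most \<open>card F\<close> boxes with \<open>k\<close> sides \<open>2 * d\<close> and the others \<open>s\<close>\<close>
  define C where "C = real (card F) * (4 ^ k / unit_ball_vol (real k)) * s ^ (?N - k)"
  have C: "0 \<le> C" using ball_vol s by (simp add: C_def)
  define \<epsilon> where "\<epsilon> = s ^ ?N / (C + 1)"
  have \<epsilon>: "0 < \<epsilon>" "C * \<epsilon> < s ^ ?N"
  proof -
    show "0 < \<epsilon>" using C s by (simp add: \<epsilon>_def)
    have "C * s ^ ?N < s ^ ?N * (C + 1)" using s by (simp add: algebra_simps)
    then show "C * \<epsilon> < s ^ ?N" using C by (simp add: \<epsilon>_def divide_less_eq)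
  qed
  show thesis
  proof (rule that[OF \<epsilon>(1)])
    fix A :: "'a set"
    assume R: "\<And>x b. x \<in> A \<Longrightarrow> b \<in> Basis \<Longrightarrow> \<bar>x \<bullet> b\<bar> \<le> R" and vol: "vol k A < ennreal \<epsilon>"
    obtain U where U: "A \<subseteq> (\<Union>i. U i)" "\<And>i. bounded (U i)"
      and U_sum: "suminf (\<lambda>i. ennreal (diam_vol k (U i))) < ennreal \<epsilon>"
      using vol_less_cover[OF vol] by blast
    define a where "a i = (SOME x. x \<in> U i)" for i
    define d where "d i = diameter (U i)" for i
    have d0: "0 \<le> d i" for i unfolding d_def by (rule diameter_ge_0[OF U(2)])
    define l where "l J m i = (\<Sum>b\<in>Basis. (if b \<in> J then a i \<bullet> b - d i - s * of_int (m b) else 0) *\<^sub>R b)"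
      for J :: "'a set" and m :: "'a \<Rightarrow> int" and i
    define u where "u J m i = (\<Sum>b\<in>Basis. (if b \<in> J then a i \<bullet> b + d i - s * of_int (m b) else s) *\<^sub>R b)"
      for J :: "'a set" and m :: "'a \<Rightarrow> int" and i
    define E where "E i = (if U i = {} then {} else \<Union>(J, m)\<in>F. cbox (l J m i) (u J m i))" for i
    have E_meas: "E i \<in> sets lborel" for i
      using F by (auto simp: E_def intro!: sets.finite_UN)
    have box: "emeasure lborel (cbox (l J m i) (u J m i)) = ennreal ((2 * d i) ^ k * s ^ (?N - k))"
      if "(J, m) \<in> F" for J m i
    proof -
      have J: "J \<subseteq> Basis" "card J = k" using that by (auto simp: F_def)
      have "emeasure lborel (cbox (l J m i) (u J m i)) = (\<Prod>b\<in>Basis. (u J m i - l J m i) \<bullet> b)"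
        using d0[of i] s by (intro emeasure_lborel_cbox) (auto simp: l_def u_def)
      also have "(\<Prod>b\<in>Basis. (u J m i - l J m i) \<bullet> b) = (\<Prod>b\<in>Basis. if b \<in> J then 2 * d i else s)"
        by (intro prod.cong) (auto simp: l_def u_def inner_diff_left)
      also have "\<dots> = (2 * d i) ^ card (Basis \<inter> J) * s ^ card (Basis \<inter> - J)"
        by (simp add: prod.If_cases)
      also have "Basis \<inter> J = J" using J by auto
      also have "Basis \<inter> - J = Basis - J" by auto
      finally show ?thesis using J finite_subset[of J Basis] by (simp add: card_Diff_subset)
    qed
    have E_le: "emeasure lborel (E i) \<le> ennreal C * ennreal (diam_vol k (U i))" for i
    proof (cases "U i = {}")
      case False
      have "emeasure lborel (E i) \<le> (\<Sum>(J, m)\<in>F. emeasure lborel (cbox (l J m i) (u J m i)))"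
        using False F unfolding E_def by (auto simp: case_prod_beta intro!: emeasure_subadditive_finite)
      also have "\<dots> = (\<Sum>(J, m)\<in>F. ennreal ((2 * d i) ^ k * s ^ (?N - k)))"
        by (rule sum.cong) (auto simp: box)
      also have "\<dots> = ennreal (real (card F) * ((2 * d i) ^ k * s ^ (?N - k)))"
        using d0[of i] s by (simp add: ennreal_mult ennreal_of_nat_eq_real_of_nat case_prod_beta)
      also have "real (card F) * ((2 * d i) ^ k * s ^ (?N - k)) = C * diam_vol k (U i)"
      proof -
        have "(4::real) ^ k = 2 ^ k * 2 ^ k" by (simp flip: power_mult_distrib)
        moreover have "diam_vol k (U i) = unit_ball_vol (real k) * (d i ^ k / 2 ^ k)"
          using False by (simp add: diam_vol_def d_def power_divide)
        moreover have "unit_ball_vol (real k) \<noteq> 0" using ball_vol by linarith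
        ultimately show ?thesis
          by (simp add: C_def power_mult_distrib)
      qed
      also have "ennreal (C * diam_vol k (U i)) = ennreal C * ennreal (diam_vol k (U i))"
        using C by (rule ennreal_mult')
      finally show ?thesis .
    qed (simp add: E_def)
    show "\<exists>v. A \<subseteq> few_on_grid v s Basis k UNIV"
    proof (rule ccontr)
      assume none: "\<not> (\<exists>v. A \<subseteq> few_on_grid v s Basis k UNIV)"
      have "cbox 0 (s *\<^sub>R One) \<subseteq> (\<Union>i. E i)"
      proof
        fix v :: 'a assume v: "v \<in> cbox 0 (s *\<^sub>R One)"
        obtain x where x: "x \<in> A" "x \<notin> few_on_grid v s Basis k UNIV" using none by blast
        then have "k \<le> card {b \<in> Basis. (x \<bullet> b - v \<bullet> b) / s \<in> \<int>}" by (simp add: few_on_grid_def)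
        then obtain J where J: "J \<subseteq> {b \<in> Basis. (x \<bullet> b - v \<bullet> b) / s \<in> \<int>}" "card J = k"
          by (rule obtain_subset_with_card_n)
        obtain i where i: "x \<in> U i" using U(1) x by auto
        define m where "m = restrict (\<lambda>b. \<lfloor>(x \<bullet> b - v \<bullet> b) / s\<rfloor>) J"
        have m: "v \<bullet> b = x \<bullet> b - s * of_int (m b)" "m b \<in> {- M .. M}" if "b \<in> J" for b
        proof -
          have b: "b \<in> Basis" "(x \<bullet> b - v \<bullet> b) / s \<in> \<int>" using J that by auto
          have mb: "of_int (m b) = (x \<bullet> b - v \<bullet> b) / s"
            using b(2) that by (auto simp: m_def elim: Ints_cases)
          then show "v \<bullet> b = x \<bullet> b - s * of_int (m b)" using s by simp
          have "0 \<le> v \<bullet> b" "v \<bullet> b \<le> s" using v b by (auto simp: mem_box)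
          then have "\<bar>x \<bullet> b - v \<bullet> b\<bar> \<le> R + s" using R[OF x(1) b(1)] by linarith
          then have "\<bar>(x \<bullet> b - v \<bullet> b) / s\<bar> \<le> (R + s) / s" using s by (simp add: divide_right_mono)
          then have "\<bar>of_int (m b)\<bar> \<le> (R + s) / s" using mb by simp
          also have "\<dots> \<le> of_int M" by (simp add: M_def)
          finally have "\<bar>m b\<bar> \<le> M" by linarith
          then show "m b \<in> {- M .. M}" by auto
        qed
        have JmF: "(J, m) \<in> F" using J m(2) by (auto simp: F_def m_def)
        have "a i \<in> U i" unfolding a_def using i by (rule someI)
        then have near: "norm (x - a i) \<le> d i"
          using diameter_bounded_bound[OF U(2) i] by (simp add: d_def dist_norm)
        have "v \<in> cbox (l J m i) (u J m i)"
          unfolding mem_box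
        proof
          fix b :: 'a assume b: "b \<in> Basis"
          have "\<bar>x \<bullet> b - a i \<bullet> b\<bar> \<le> d i"
            using Basis_le_norm[OF b, of "x - a i"] near by (simp add: inner_diff_left)
          then show "l J m i \<bullet> b \<le> v \<bullet> b \<and> v \<bullet> b \<le> u J m i \<bullet> b"
            using b v m(1)[of b] by (auto simp: l_def u_def mem_box)
        qed
        then have "v \<in> E i" using i JmF by (auto simp: E_def)
        then show "v \<in> (\<Union>i. E i)" by blast
      qed
      then have "emeasure lborel (cbox 0 (s *\<^sub>R One :: 'a)) \<le> emeasure lborel (\<Union>i. E i)"
        using E_meas by (intro emeasure_mono) auto
      also have "\<dots> \<le> suminf (\<lambda>i. emeasure lborel (E i))"
        using E_meas by (intro emeasure_subadditive_countably) auto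
      also have "\<dots> \<le> suminf (\<lambda>i. ennreal C * ennreal (diam_vol k (U i)))"
        by (intro suminf_le E_le summableI)
      also have "\<dots> = ennreal C * suminf (\<lambda>i. ennreal (diam_vol k (U i)))"
        by (rule ennreal_suminf_cmult)
      also have "\<dots> \<le> ennreal C * ennreal \<epsilon>"
        using U_sum by (intro mult_left_mono) auto
      also have "\<dots> = ennreal (C * \<epsilon>)"
        using C by (simp add: ennreal_mult')
      also have "\<dots> < ennreal (s ^ ?N)"
        using \<epsilon> C by (intro ennreal_lessI) (auto simp: s)
      also have "ennreal (s ^ ?N) = emeasure lborel (cbox 0 (s *\<^sub>R One :: 'a))"
        using s by (simp add: emeasure_lborel_cbox)
      finally show False by simp
    qed
  qed
qed

section \<open>Cycles of arbitrarily small volume\<close>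

theorem theorem5p1:
  fixes D :: "nat \<Rightarrow> (nat \<Rightarrow> real) set set"
    and T :: "'a::euclidean_space set set"
    and \<Gamma> :: "'a set"
    and \<xi> :: "('a, 'g::ab_group_add) gchain"
    and k :: nat
  assumes "o_minimal_field_expansion D"
    and "polyhedron_of T \<Gamma>"
    and "definable_cycle D k \<Gamma> \<xi>"
    and "\<exists>\<epsilon>\<^sub>0>0::real. \<forall>\<epsilon>. 0 < \<epsilon> \<and> \<epsilon> < \<epsilon>\<^sub>0 \<longrightarrow>
      (\<exists>\<xi>\<^sub>\<epsilon> :: ('a, 'g) gchain. definable_cycle D k \<Gamma> \<xi>\<^sub>\<epsilon> \<and> homologous D k \<Gamma> \<xi>\<^sub>\<epsilon> \<xi> \<and>
        vol k (supp k \<xi>\<^sub>\<epsilon>) < ennreal \<epsilon>)"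
  shows "\<exists>\<eta> :: ('a, 'g) gchain. definable_chain D (k + 1) \<Gamma> \<eta> \<and> boundary (k + 1) \<eta> = \<xi>"
proof -
  interpret o_minimal_field_expansion D by fact
  have T: "finite T" "\<And>S. S \<in> T \<Longrightarrow> compact S" "\<And>S. S \<in> T \<Longrightarrow> convex S" and \<Gamma>: "\<Gamma> = \<Union>T"
    using assms(2) by (auto simp: polyhedron_of_def intro: compact_simplex convex_simplex)
  have "uniformly_locally_starlike \<Gamma>"
    unfolding \<Gamma> using T by (rule uniformly_locally_starlike_polyhedron)
  then obtain \<delta> where \<delta>: "0 < \<delta>" and near: "\<And>d :: ('a, 'g) gchain. dchain (Suc k) (\<Union>x\<in>\<Gamma>. ball x \<delta>) d \<Longrightarrow>
      dchain k \<Gamma> (boundary (Suc k) d) \<Longrightarrow> bounds D k \<Gamma> (boundary (Suc k) d)"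
    by (rule boundary_near_imp_boundary_in) blast
  define r where "r = \<delta> / 2"
  \<comment> \<open>the mesh for which \<open>fillable_few_on_grid\<close> keeps the filling within distance \<open>r\<close>\<close>
  define s where "s = r / (2 ^ DIM('a) * DIM('a))"
  have s: "0 < s" "2 ^ DIM('a) * (DIM('a) * s) = r"
    using \<delta> by (simp_all add: s_def r_def)
  have "bounded \<Gamma>"
    unfolding \<Gamma> using T by (intro compact_imp_bounded compact_Union) auto
  then obtain R where R: "\<And>x. x \<in> \<Gamma> \<Longrightarrow> norm x \<le> R"
    by (auto simp: bounded_iff)
  obtain \<epsilon>\<^sub>1 where \<epsilon>\<^sub>1: "0 < \<epsilon>\<^sub>1" "\<And>A :: 'a set. (\<And>x b. x \<in> A \<Longrightarrow> b \<in> Basis \<Longrightarrow> \<bar>x \<bullet> b\<bar> \<le> R) \<Longrightarrow>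
      vol k A < ennreal \<epsilon>\<^sub>1 \<Longrightarrow> \<exists>v. A \<subseteq> few_on_grid v s Basis k UNIV"
    using small_volume_misses_grid_skeleton[OF s(1), of R k] by blast
  obtain \<epsilon>\<^sub>0 where \<epsilon>\<^sub>0: "0 < \<epsilon>\<^sub>0" "\<And>\<epsilon>. 0 < \<epsilon> \<Longrightarrow> \<epsilon> < \<epsilon>\<^sub>0 \<Longrightarrow>
      \<exists>\<zeta> :: ('a, 'g) gchain. definable_cycle D k \<Gamma> \<zeta> \<and> homologous D k \<Gamma> \<zeta> \<xi> \<and> vol k (supp k \<zeta>) < ennreal \<epsilon>"
    using assms(4) by blast
  define \<epsilon> where "\<epsilon> = min \<epsilon>\<^sub>0 \<epsilon>\<^sub>1 / 2"
  have \<epsilon>: "0 < \<epsilon>" "\<epsilon> < \<epsilon>\<^sub>0" "\<epsilon> \<le> \<epsilon>\<^sub>1"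
    using \<epsilon>\<^sub>0(1) \<epsilon>\<^sub>1(1) by (auto simp: \<epsilon>_def min_def)
  obtain \<zeta> :: "('a, 'g) gchain" where \<zeta>: "dchain k \<Gamma> \<zeta>" "boundary k \<zeta> = 0" "bounds D k \<Gamma> (\<zeta> - \<xi>)"
    and small: "vol k (supp k \<zeta>) < ennreal \<epsilon>"
    using \<epsilon>\<^sub>0(2)[OF \<epsilon>(1,2)] by (auto simp: definable_cycle_def homologous_def)
  have supp: "supp k \<zeta> \<subseteq> \<Gamma>" using \<zeta>(1) by (rule supp_subset)
  obtain v where v: "supp k \<zeta> \<subseteq> few_on_grid v s Basis k UNIV"
  proof -
    have "\<bar>x \<bullet> b\<bar> \<le> R" if "x \<in> supp k \<zeta>" "b \<in> Basis" for x b
      using that supp R[of x] Basis_le_norm[of b x] by auto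
    moreover have "vol k (supp k \<zeta>) < ennreal \<epsilon>\<^sub>1"
      using small ennreal_leI[OF \<epsilon>(3)] by (rule less_le_trans)
    ultimately show thesis using \<epsilon>\<^sub>1(2)[of "supp k \<zeta>"] that by blast
  qed
  let ?X = "few_on_grid v s (Basis :: 'a set) k UNIV"
  have X: "dchain k ?X \<zeta>"
    using v dchain_UNIV[OF \<zeta>(1)] dchain_iff[of k ?X \<zeta>] by simp
  have "fillable TYPE('g) k r ?X"
    using fillable_few_on_grid[where G = "TYPE('g)" and v = v and p = k, OF finite_Basis subset_refl s(1) convex_UNIV order_refl] s(2) by simp
  then obtain d where d: "dchain (Suc k) ?X d" "boundary (Suc k) d = \<zeta>" "supp (Suc k) d \<subseteq> thicken r (supp k \<zeta>)"
    using X \<zeta>(2) by (rule fillable_obtain)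
  have "thicken r (supp k \<zeta>) \<subseteq> (\<Union>x\<in>\<Gamma>. ball x \<delta>)"
    unfolding thicken_def using supp \<delta> by (intro UN_mono) (auto simp: r_def)
  then have "dchain (Suc k) (\<Union>x\<in>\<Gamma>. ball x \<delta>) d"
    using d(3) dchain_UNIV[OF d(1)] dchain_iff[of "Suc k" "\<Union>x\<in>\<Gamma>. ball x \<delta>" d] by simp
  then have "bounds D k \<Gamma> \<zeta>"
    using near[of d] d(2) \<zeta>(1) by simp
  then obtain e e' where e: "dchain (Suc k) \<Gamma> e" "boundary (Suc k) e = \<zeta>"
      "dchain (Suc k) \<Gamma> e'" "boundary (Suc k) e' = \<zeta> - \<xi>"
    using \<zeta>(3) unfolding bounds_def by blast
  then have "dchain (Suc k) \<Gamma> (e - e')" "boundary (Suc k) (e - e') = \<xi>"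
    by (auto intro: dchain_diff simp: boundary_diff)
  then show ?thesis by (metis Suc_eq_plus1)
qed

end
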